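(* The Weber kernel group $\Gamma_4$ equals $\Gamma_s(8)$, and $\mathcal{W}_4=X_s(8)$.
   Context: Write $\zeta_k=e^{2\pi i/k}$. Let $\eta$ be the Dedekind eta function and $$\mathfrak{f}(\tau)=\zeta_{48}^{-1}\frac{\eta\left(\frac{\tau+1}{2}\right)}{\eta(\tau)},\quad \mathfrak{f}_1(\tau)=\frac{\eta\left(\frac{\tau}{2}\right)}{\eta(\tau)},\quad \mathfrak{f}_2(\tau)=\sqrt2\,\frac{\eta(2\tau)}{\eta(\tau)},$$ $(\mathfrak{u}_0,\mathfrak{u}_1,\mathfrak{u}_2)=(\mathfrak{f},\zeta_{16}\mathfrak{f}_1,\zeta_{16}^{-1}\mathfrak{f}_2)$. For $n\mid 24$, the Weber kernel group $\Gamma_n\subset\mathrm{PSL}_2(\mathbb{Z})$ is the group of all $g$ with $\mathfrak{u}_i^{24/n}\circ g=\mathfrak{u}_i^{24/n}$ for $i=0,1,2$. The Weber curve $\mathcal{W}_n$ is the image in $\mathbb{P}^3$ of $(\mathfrak{u}_0^{24/n}:\mathfrak{u}_1^{24/n}:\mathfrak{u}_2^{24/n}:1)$, and it is identified (as smooth projective model / function field) with the modular curve $X(\Gamma_n)$; for $n=4$ it has equations $X_0^4+X_1^4+X_2^4=48X_3^4$, $X_0X_1X_2=8X_3^3$. For a positive integer $N$, $\Gamma_s(N)$ is the image in $\mathrm{PSL}_2(\mathbb{Z})$ of the split Cartan group $\left\{\begin{pmatrix}a&b\\c&d\end{pmatrix}\in\mathrm{SL}_2(\mathbb{Z}) : b\equiv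 c\equiv0\bmod N\right\}$, and $X_s(N)$ is the associated modular curve. *)

theory Defs
  imports
    "HOL-Complex_Analysis.Complex_Analysis"
    "HOL-Algebra.Coset"
    "HOL-Algebra.QuotRing"
begin

abbreviation upper_half_plane :: "complex set" where
  "upper_half_plane \<equiv> {\<tau>. 0 < Im \<tau>}"


section \<open>Dedekind eta and the Weber functions\<close>

definition zeta_root :: "nat \<Rightarrow> complex" where
  "zeta_root k = exp (2 * of_real pi * \<i> / of_nat k)"

definition dedekind_eta :: "complex \<Rightarrow> complex" where
  "dedekind_eta \<tau> =
     exp (2 * of_real pi * \<i> * \<tau> / 24) * (\<Prod>n. 1 - exp (2 * of_real pi * \<i> * \<tau>) ^ Suc n)"

definition weber_f :: "complex \<Rightarrow> complex" where
  "weber_f \<tau> = inverse (zeta_root 48) * (dedekind_eta ((\<tau> + 1) / 2) / dedekind_eta \<tau>)"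

definition weber_f1 :: "complex \<Rightarrow> complex" where
  "weber_f1 \<tau> = dedekind_eta (\<tau> / 2) / dedekind_eta \<tau>"

definition weber_f2 :: "complex \<Rightarrow> complex" where
  "weber_f2 \<tau> = of_real (sqrt 2) * (dedekind_eta (2 * \<tau>) / dedekind_eta \<tau>)"

definition weber_u0 :: "complex \<Rightarrow> complex" where
  "weber_u0 \<tau> = weber_f \<tau>"

definition weber_u1 :: "complex \<Rightarrow> complex" where
  "weber_u1 \<tau> = zeta_root 16 * weber_f1 \<tau>"

definition weber_u2 :: "complex \<Rightarrow> complex" where
  "weber_u2 \<tau> = inverse (zeta_root 16) * weber_f2 \<tau>"


section \<open>The modular group and its subgroups\<close>

definition SL2Z :: "(int ^ 2 ^ 2) monoid" where
  "SL2Z = \<lparr>carrier = {A. det A = 1}, mult = (**), one = mat 1\<rparr>"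

definition PSL2Z :: "(int ^ 2 ^ 2) set monoid" where
  "PSL2Z = SL2Z Mod {mat 1, - mat 1}"

definition to_PSL2Z :: "int ^ 2 ^ 2 \<Rightarrow> (int ^ 2 ^ 2) set" where
  "to_PSL2Z A = {mat 1, - mat 1} #>\<^bsub>SL2Z\<^esub> A"

definition moebius :: "int ^ 2 ^ 2 \<Rightarrow> complex \<Rightarrow> complex" where
  "moebius A \<tau> =
     (of_int (A $ 1 $ 1) * \<tau> + of_int (A $ 1 $ 2)) / (of_int (A $ 2 $ 1) * \<tau> + of_int (A $ 2 $ 2))"

text \<open>
  An element of \<^const>\<open>PSL2Z\<close> is a coset \<open>g = {A, -A}\<close>. Both representatives induce the same
  transformation, so quantifying over \<open>A \<in> g\<close> expresses the action of \<open>g\<close> itself.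
\<close>

definition invariant_under :: "(int ^ 2 ^ 2) set \<Rightarrow> (complex \<Rightarrow> complex) \<Rightarrow> bool" where
  "invariant_under g f \<longleftrightarrow> (\<forall>A\<in>g. \<forall>\<tau>\<in>upper_half_plane. f (moebius A \<tau>) = f \<tau>)"

definition weber_kernel_group :: "nat \<Rightarrow> (int ^ 2 ^ 2) set set" where
  "weber_kernel_group n =
     {g \<in> carrier PSL2Z. \<forall>u\<in>{weber_u0, weber_u1, weber_u2}. invariant_under g (\<lambda>\<tau>. u \<tau> ^ (24 div n))}"

definition split_cartan :: "nat \<Rightarrow> (int ^ 2 ^ 2) set" where
  "split_cartan N = {A \<in> carrier SL2Z. int N dvd A $ 1 $ 2 \<and> int N dvd A $ 2 $ 1}"

definition Gamma_s :: "nat \<Rightarrow> (int ^ 2 ^ 2) set set" where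
  "Gamma_s N = to_PSL2Z ` split_cartan N"


section \<open>Function fields of modular curves\<close>

text \<open>
  At the cusp \<open>A \<infinity>\<close> the function has to be meromorphic in the local parameter \<open>exp (2 \<pi> i \<tau> / N)\<close>,
  where \<open>N\<close> is (a multiple of) the width of the cusp.
\<close>

definition meromorphic_at_cusps :: "(complex \<Rightarrow> complex) \<Rightarrow> bool" where
  "meromorphic_at_cusps f \<longleftrightarrow>
     (\<forall>A\<in>carrier SL2Z. \<exists>N>0. \<exists>g y. g meromorphic_on {0} \<and>
        (\<forall>\<tau>. Im \<tau> > y \<and> Im \<tau> > 0 \<longrightarrow>
           f (moebius A \<tau>) = g (exp (2 * of_real pi * \<i> * \<tau> / of_nat N))))"

text \<open>
  A meromorphic function on the upper half plane is represented by the total function that has its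
  removable singularities removed and is 0 at its poles and outside the upper half plane. Sums and
  products have to be brought into this form again.
\<close>

definition normalize_mero :: "(complex \<Rightarrow> complex) \<Rightarrow> complex \<Rightarrow> complex" where
  "normalize_mero f \<tau> = (if \<tau> \<in> upper_half_plane then remove_sings f \<tau> else 0)"

definition modular_functions :: "(int ^ 2 ^ 2) set set \<Rightarrow> (complex \<Rightarrow> complex) set" where
  "modular_functions \<Gamma> =
     {f. f nicely_meromorphic_on upper_half_plane \<and> (\<forall>\<tau>. \<tau> \<notin> upper_half_plane \<longrightarrow> f \<tau> = 0) \<and>
         (\<forall>g\<in>\<Gamma>. invariant_under g f) \<and> meromorphic_at_cusps f}"

text \<open>The function field of the modular curve \<open>X(\<Gamma>)\<close>, for \<open>\<Gamma>\<close> of finite index in \<^const>\<open>PSL2Z\<close>.\<close>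

definition modular_curve_field :: "(int ^ 2 ^ 2) set set \<Rightarrow> (complex \<Rightarrow> complex) ring" where
  "modular_curve_field \<Gamma> =
     \<lparr>carrier = modular_functions \<Gamma>,
      mult = (\<lambda>f g. normalize_mero (\<lambda>\<tau>. f \<tau> * g \<tau>)),
      one = normalize_mero (\<lambda>_. 1),
      zero = normalize_mero (\<lambda>_. 0),
      add = (\<lambda>f g. normalize_mero (\<lambda>\<tau>. f \<tau> + g \<tau>))\<rparr>"

definition split_cartan_curve_field :: "nat \<Rightarrow> (complex \<Rightarrow> complex) ring" where
  "split_cartan_curve_field N = modular_curve_field (Gamma_s N)"


section \<open>Projective 3-space and function fields of its irreducible closed subsets\<close>

text \<open>A point of projective space is the set of all its homogeneous coordinate vectors.\<close>

definition proj_point :: "complex ^ 4 \<Rightarrow> (complex ^ 4) set" where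
  "proj_point x = {c *s x |c. c \<noteq> 0}"

definition proj_space :: "(complex ^ 4) set set" where
  "proj_space = proj_point ` (- {0})"

text \<open>
  Homogeneous polynomials of degree \<open>d\<close> in the four coordinates, as functions; over the complex
  numbers a polynomial is determined by its function.
\<close>

definition forms :: "nat \<Rightarrow> (complex ^ 4 \<Rightarrow> complex) set" where
  "forms d = {F. \<exists>c :: (4 \<Rightarrow> nat) \<Rightarrow> complex.
     F = (\<lambda>x. \<Sum>e | (\<Sum>i\<in>UNIV. e i) = d. c e * (\<Prod>i\<in>UNIV. (x $ i) ^ e i))}"

definition vanishes_on :: "(complex ^ 4 \<Rightarrow> complex) \<Rightarrow> (complex ^ 4) set set \<Rightarrow> bool" where
  "vanishes_on F S \<longleftrightarrow> (\<forall>P\<in>S. \<forall>x\<in>P. F x = 0)"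

definition zariski_closure :: "(complex ^ 4) set set \<Rightarrow> (complex ^ 4) set set" where
  "zariski_closure S =
     {P \<in> proj_space. \<forall>d. \<forall>F\<in>forms d. vanishes_on F S \<longrightarrow> vanishes_on F {P}}"

definition fractions ::
    "(complex ^ 4) set set \<Rightarrow> ((complex ^ 4 \<Rightarrow> complex) \<times> (complex ^ 4 \<Rightarrow> complex)) set" where
  "fractions W = {(F, G). \<exists>d. F \<in> forms d \<and> G \<in> forms d \<and> \<not> vanishes_on G W}"

definition fraction_rel ::
    "(complex ^ 4) set set \<Rightarrow> ((complex ^ 4 \<Rightarrow> complex) \<times> (complex ^ 4 \<Rightarrow> complex)) rel" where
  "fraction_rel W =
     {((F, G), (F', G')). (F, G) \<in> fractions W \<and> (F', G') \<in> fractions W \<and>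
        vanishes_on (\<lambda>x. F x * G' x - F' x * G x) W}"

definition function_field ::
    "(complex ^ 4) set set \<Rightarrow> ((complex ^ 4 \<Rightarrow> complex) \<times> (complex ^ 4 \<Rightarrow> complex)) set ring" where
  "function_field W =
     \<lparr>carrier = fractions W // fraction_rel W,
      mult = (\<lambda>a b. \<Union>(F, G)\<in>a. \<Union>(F', G')\<in>b.
        fraction_rel W `` {(\<lambda>x. F x * F' x, \<lambda>x. G x * G' x)}),
      one = fraction_rel W `` {(\<lambda>_. 1, \<lambda>_. 1)},
      zero = fraction_rel W `` {(\<lambda>_. 0, \<lambda>_. 1)},
      add = (\<lambda>a b. \<Union>(F, G)\<in>a. \<Union>(F', G')\<in>b.
        fraction_rel W `` {(\<lambda>x. F x * G' x + F' x * G x, \<lambda>x. G x * G' x)})\<rparr>"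


section \<open>The Weber curve\<close>

definition weber_param :: "nat \<Rightarrow> complex \<Rightarrow> complex ^ 4" where
  "weber_param n \<tau> =
     vector [weber_u0 \<tau> ^ (24 div n), weber_u1 \<tau> ^ (24 div n), weber_u2 \<tau> ^ (24 div n), 1]"

text \<open>
  Taking the closure adds the images of the cusps, which the parametrization by the upper half plane
  alone misses.
\<close>

definition weber_curve :: "nat \<Rightarrow> (complex ^ 4) set set" where
  "weber_curve n = zariski_closure ((\<lambda>\<tau>. proj_point (weber_param n \<tau>)) ` upper_half_plane)"

text \<open>
  Composition of a rational function on the Weber curve with the parametrization. Different
  representatives \<open>(F, G)\<close> give functions that differ at most at zeros of \<open>G\<close>, hence the same
  normalized function.
\<close>

definition weber_pullback ::
    "nat \<Rightarrow> ((complex ^ 4 \<Rightarrow> complex) \<times> (complex ^ 4 \<Rightarrow> complex)) set \<Rightarrow> complex \<Rightarrow> complex" where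
  "weber_pullback n a =
     (case SOME p. p \<in> a of (F, G) \<Rightarrow>
        normalize_mero (\<lambda>\<tau>. F (weber_param n \<tau>) / G (weber_param n \<tau>)))"

end

theory Submission
  imports Defs
begin

text \<open>
  Put \<open>x\<^sub>i = u\<^sub>i\<^sup>6\<close>. The translation \<open>\<tau> + 1\<close> and the inversion \<open>-1/\<tau>\<close> permute the three functions
  \<open>x\<^sub>i\<close> up to fourth roots of unity. For the inversion it suffices to show \<open>f\<^sub>1(-1/\<tau>) = f\<^sub>2(\<tau>)\<close> on
  the imaginary axis; there both sides are, up to elementary factors, the two orders of summation of
  a double series with positive terms, evaluated with the partial fractions of \<open>coth\<close>. On \<open>\<Gamma>(2)\<close> the
  action is diagonal, given by the characters \<open>ac/2\<close> and \<open>bd/2\<close> modulo 4, which gives the kernel.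

  For the function field, the \<open>x\<^sub>i\<close> distinguish the cosets of \<open>\<Gamma>\<^sub>s(8)\<close>, so every modular function for
  \<open>\<Gamma>\<^sub>s(8)\<close> is a rational expression in the \<open>x\<^sub>i\<close> and in traces to level one. A level one function is
  rational in \<open>j\<close>: multiplying by a polynomial in \<open>j\<close> clears the poles in the upper half plane,
  subtracting one clears the pole at the cusp, and the maximum principle shows that the rest is
  constant. Finally \<open>j\<close> itself is a polynomial in the \<open>x\<^sub>i\<close>.
\<close>

section \<open>Euler's product\<close>

text \<open>Only quotients of eta values occur, so the square root in eta(-1/t) = sqrt(-i t) eta(t)
  cancels and eta's own transformation law is bypassed: the logarithm of f1(i/t) = f2(i t) is an
  identity between Lambert series. The exponent 6 = 24/4 leaves multipliers that are fourth roots of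
  unity. On Gamma(2) the entries a and d are odd, so the two characters vanish modulo 4 exactly when
  8 divides b and c. Odd squares are 1 modulo 8, so such a matrix is scalar modulo 8 and the group
  is normal; accordingly a function of the x_i stays invariant under it after composition with any
  modular substitution. The pullback is a homomorphism by construction, and injective because a form
  vanishes on the closure as soon as it vanishes at the parametrized points. The obstacle is
  surjectivity. Instead of comparing degrees of function fields, it is obtained by Lagrange
  interpolation: one combination h = x0 + a x1 + a^2 x2 separates the cosets, and averaging against
  the products of s - h(r t) isolates the given function. The average runs over residue classes
  modulo 8, which repeat each coset; this costs only a nonzero constant factor.\<close>

definition euler_phi :: "complex \<Rightarrow> complex" where
  "euler_phi q = (\<Prod>n. 1 - q ^ Suc n)"

lemma euler_phi_has_prod:
  assumes "norm q < 1"
  shows "(\<lambda>n. 1 - q ^ Suc n) has_prod euler_phi q"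
proof -
  have "summable (\<lambda>n. norm q ^ Suc n)"
    using assms by (subst summable_Suc_iff) (auto intro: summable_geometric)
  hence "summable (\<lambda>n. norm (1 - q ^ Suc n - 1))"
    by (simp add: norm_mult norm_power)
  hence "convergent_prod (\<lambda>n. 1 - q ^ Suc n)"
    by (intro abs_convergent_prod_imp_convergent_prod summable_imp_abs_convergent_prod)
  thus ?thesis
    unfolding euler_phi_def by (rule convergent_prod_has_prod)
qed

lemma euler_phi_tendsto:
  assumes "norm q < 1"
  shows "(\<lambda>N. \<Prod>n<N. 1 - q ^ Suc n) \<longlonglongrightarrow> euler_phi q"
  using has_prod_imp_tendsto'[OF euler_phi_has_prod[OF assms]] .

lemma euler_phi_nonzero:
  assumes "norm q < 1"
  shows "euler_phi q \<noteq> 0"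
proof -
  have "1 - q ^ Suc n \<noteq> 0" for n
  proof -
    have "norm (q ^ Suc n) < 1"
      using assms by (simp add: norm_power power_less_one_iff del: power_Suc)
    thus ?thesis by auto
  qed
  thus ?thesis
    using has_prod_eq_0_iff[OF euler_phi_has_prod[OF assms]] by fastforce
qed

lemma euler_phi_0 [simp]: "euler_phi 0 = 1"
  by (simp add: euler_phi_def)

lemma euler_phi_holomorphic: "euler_phi holomorphic_on ball 0 1"
proof (rule holomorphic_uniform_sequence)
  show "open (ball (0::complex) 1)" by simp
  show "(\<lambda>q. \<Prod>n<N. 1 - q ^ Suc n) holomorphic_on ball 0 1" for N
    by (intro holomorphic_intros)
  fix x :: complex assume x: "x \<in> ball 0 1"
  define d where "d = (1 - norm x) / 2"
  have d: "d > 0" "norm x + d < 1" using x by (auto simp: d_def field_simps)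
  have sub: "norm y \<le> norm x + d" if "y \<in> cball x d" for y
    using that norm_triangle_ineq2[of y x] by (auto simp: dist_norm norm_minus_commute)
  have "uniformly_convergent_on (cball x d) (\<lambda>N q. \<Prod>n<N. 1 - q ^ Suc n)"
  proof (rule uniformly_convergent_on_prod')
    show "uniformly_convergent_on (cball x d) (\<lambda>N q. \<Sum>n<N. norm (1 - q ^ Suc n - 1))"
    proof (rule Weierstrass_m_test'[of _ _ "\<lambda>n. (norm x + d) ^ Suc n"])
      show "summable (\<lambda>n. (norm x + d) ^ Suc n)"
        using d by (subst summable_Suc_iff) (auto intro: summable_geometric)
    qed (use sub in \<open>auto simp: norm_power norm_mult simp del: power_Suc intro!: power_mono\<close>)
  qed (auto intro!: continuous_intros)
  then obtain g where g: "uniform_limit (cball x d) (\<lambda>N q. \<Prod>n<N. 1 - q ^ Suc n) g sequentially"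
    by (auto simp: uniformly_convergent_on_def)
  have "g y = euler_phi y" if "y \<in> cball x d" for y
    using tendsto_uniform_limitI[OF g that] euler_phi_tendsto[of y] sub[OF that] d
    by (intro LIMSEQ_unique) auto
  with g have "uniform_limit (cball x d) (\<lambda>N q. \<Prod>n<N. 1 - q ^ Suc n) euler_phi sequentially"
    by (subst uniform_limit_cong'[where g = "\<lambda>N q. \<Prod>n<N. 1 - q ^ Suc n" and i = g]) auto
  moreover have "cball x d \<subseteq> ball 0 1" using sub d by (auto intro!: le_less_trans[OF sub])
  ultimately show "\<exists>d>0. cball x d \<subseteq> ball 0 1 \<and>
      uniform_limit (cball x d) (\<lambda>N q. \<Prod>n<N. 1 - q ^ Suc n) euler_phi sequentially"
    using d by blast
qed

text \<open>The identity already holds for partial products, with \<open>2*N\<close> factors at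
  \<open>x\<close> and \<open>- x\<close> and \<open>N\<close> factors at \<open>x ^ 4\<close>: even
  exponents give equal factors at \<open>x\<close> and \<open>- x\<close>, odd ones give
  \<open>(1 - a) * (1 + a)\<close>. It is the source of the relation between the three Weber
  functions.\<close>

lemma euler_phi_duplication:
  assumes "norm x < 1"
  shows "euler_phi x * euler_phi (- x) * euler_phi (x ^ 4) = euler_phi (x\<^sup>2) ^ 3"
proof -
  define p where "p = (\<lambda>N (x::complex). \<Prod>n<N. 1 - x ^ Suc n)"
  have "p (2*N) x * p (2*N) (- x) * p N (x^4) = p N (x\<^sup>2) ^ 2 * p (2*N) (x\<^sup>2)" for N
  proof (induction N)
    case (Suc N)
    have s: "p (2 * Suc N) y = p (2*N) y * (1 - y ^ (2*N+1)) * (1 - y ^ (2*N+2))" for y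
      by (simp add: p_def)
    have t: "p (Suc N) y = p N y * (1 - y ^ (N+1))" for y
      by (simp add: p_def)
    define a where "a = x ^ (2*N+1)"
    define b where "b = x ^ (2*N+2)"
    have e1: "(x^4) ^ (N+1) = b\<^sup>2" "(x\<^sup>2) ^ (2*N+1) = a\<^sup>2" "(x\<^sup>2) ^ (2*N+2) = b\<^sup>2" "(x\<^sup>2) ^ (N+1) = b"
      unfolding a_def b_def power_mult[symmetric]
      by (rule arg_cong[of _ _ "\<lambda>k. x ^ k"], simp)+
    have e2: "(- x) ^ (2*N+1) = - a" "(- x) ^ (2*N+2) = b"
      unfolding a_def b_def by simp_all
    note e = e1 e2
    have "p (2*Suc N) x * p (2*Suc N) (- x) * p (Suc N) (x^4) =
        (p (2*N) x * p (2*N) (- x) * p N (x^4)) * ((1 - a) * (1 - b) * (1 - (- a)) * (1 - b) * (1 - b\<^sup>2))"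
      unfolding s t e a_def[symmetric] b_def[symmetric] by (simp only: mult_ac)
    also have "\<dots> = (p N (x\<^sup>2) * (1 - b)) ^ 2 * (p (2*N) (x\<^sup>2) * (1 - a\<^sup>2) * (1 - b\<^sup>2))"
      unfolding Suc by (simp add: power2_eq_square algebra_simps)
    also have "\<dots> = p (Suc N) (x\<^sup>2) ^ 2 * p (2*Suc N) (x\<^sup>2)"
      unfolding s t e a_def[symmetric] b_def[symmetric] ..
    finally show ?case .
  qed (simp add: p_def)
  moreover have lim: "(\<lambda>N. p N y) \<longlonglongrightarrow> euler_phi y" if "norm y < 1" for y
    using euler_phi_tendsto[OF that] by (simp add: p_def)
  have lim2: "(\<lambda>N. p (2*N) y) \<longlonglongrightarrow> euler_phi y" if "norm y < 1" for y
    using LIMSEQ_subseq_LIMSEQ[OF lim[OF that], of "\<lambda>N. 2 * N"] by (simp add: strict_mono_def o_def)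
  have n: "norm (x^2) < 1" "norm (x^4) < 1" "norm (-x) < 1"
    using assms by (auto simp: norm_power power_less_one_iff abs_square_less_1)
  have "(\<lambda>N. p (2*N) x * p (2*N) (- x) * p N (x^4)) \<longlonglongrightarrow> euler_phi x * euler_phi (- x) * euler_phi (x ^ 4)"
    by (intro tendsto_intros lim lim2 assms n)
  moreover have "(\<lambda>N. p N (x\<^sup>2) ^ 2 * p (2*N) (x\<^sup>2)) \<longlonglongrightarrow> euler_phi (x\<^sup>2) ^ 2 * euler_phi (x\<^sup>2)"
    by (intro tendsto_intros lim lim2 assms n)
  ultimately show ?thesis
    using LIMSEQ_unique by (force simp: eval_nat_numeral)
qed

text \<open>Tonelli for series: with nonnegative entries, convergence of the row sums makes the
  family summable over all index pairs, and then the columns may be summed first.\<close>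

lemma nonneg_sums_swap:
  fixes a :: "nat \<Rightarrow> nat \<Rightarrow> real"
  assumes nonneg: "\<And>i j. a i j \<ge> 0"
    and rows: "\<And>i. (\<lambda>j. a i j) sums f i" and "f sums s"
    and cols: "\<And>j. (\<lambda>i. a i j) sums g j"
  shows "g sums s"
proof -
  have f: "((\<lambda>j. a i j) has_sum f i) UNIV" for i
    using rows nonneg by (intro sums_nonneg_imp_has_sum)
  have f0: "f i \<ge> 0" for i
    using rows[of i] nonneg sums_le[of "\<lambda>_. 0" "a i" 0 "f i"] by auto
  have fs: "(f has_sum s) UNIV"
    using \<open>f sums s\<close> f0 by (intro sums_nonneg_imp_has_sum)
  have "(\<lambda>(i,j). a i j) summable_on (UNIV \<times> UNIV)"
    by (rule summable_on_SigmaI[where g = f]) (use f fs nonneg in \<open>auto simp: summable_on_def\<close>)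
  hence "((\<lambda>(i,j). a i j) has_sum s) (UNIV \<times> UNIV)"
    by (intro has_sum_SigmaI[where g = f]) (use f fs in auto)
  hence "((\<lambda>(j,i). a i j) has_sum s) (UNIV \<times> UNIV)"
    by (subst has_sum_swap) (simp add: case_prod_unfold)
  hence "(g has_sum s) UNIV"
    by (rule has_sum_SigmaD)
       (use sums_nonneg_imp_has_sum[OF cols] nonneg in auto)
  thus ?thesis by (rule has_sum_imp_sums)
qed

text \<open>Lambert series of minus the logarithm of Euler's product on (0,1); \<open>Suc r\<close>
  runs over the positive integers.\<close>

definition lambert_log :: "real \<Rightarrow> real" where
  "lambert_log x = (\<Sum>r. x ^ Suc r / (real (Suc r) * (1 - x ^ Suc r)))"

lemma lambert_log_sums:
  assumes "0 < x" "x < 1"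
  shows "(\<lambda>r. x ^ Suc r / (real (Suc r) * (1 - x ^ Suc r))) sums lambert_log x"
proof -
  have p: "x ^ Suc r \<le> x" "x ^ Suc r < 1" for r
    using assms power_le_one[of x r] by (auto simp: mult_le_cancel_left1 mult_left_le power_Suc_less_one simp del: power_Suc intro: power_Suc_le_self)
  have "summable (\<lambda>r. x ^ Suc r / (real (Suc r) * (1 - x ^ Suc r)))"
  proof (rule summable_comparison_test')
    show "summable (\<lambda>r. x ^ Suc r / (1 - x))"
      using assms by (intro summable_divide) (subst summable_Suc_iff, auto intro: summable_geometric)
    fix r :: nat
    have "x ^ Suc r / (real (Suc r) * (1 - x ^ Suc r)) \<le> x ^ Suc r / (1 * (1 - x))"
      using assms p[of r] by (intro divide_left_mono mult_mono mult_pos_pos) auto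
    thus "norm (x ^ Suc r / (real (Suc r) * (1 - x ^ Suc r))) \<le> x ^ Suc r / (1 - x)"
      using assms p[of r] by (simp del: power_Suc add: abs_mult)
  qed
  thus ?thesis unfolding lambert_log_def by (rule summable_sums)
qed

text \<open>The double series of \<open>x ^ (m * r) / r\<close> over positive \<open>m\<close> and
  \<open>r\<close> is a geometric series in \<open>m\<close> and the series of
  \<open>- ln (1 - x ^ m)\<close> in \<open>r\<close>.\<close>

lemma euler_phi_of_real:
  assumes x: "0 < x" "x < 1"
  shows "euler_phi (of_real x) = of_real (exp (- lambert_log x))"
proof -
  have p: "0 < x ^ Suc r" "x ^ Suc r < 1" for r
    using x by (auto simp del: power_Suc simp: power_Suc_less_one)
  have "(\<lambda>m. - ln (1 - x ^ Suc m)) sums lambert_log x"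
  proof (rule nonneg_sums_swap[where a = "\<lambda>r m. x ^ (Suc m * Suc r) / real (Suc r)"])
    show "x ^ (Suc m * Suc r) / real (Suc r) \<ge> 0" for r m using x by simp
    show "(\<lambda>m. x ^ (Suc m * Suc r) / real (Suc r)) sums (x ^ Suc r / (real (Suc r) * (1 - x ^ Suc r)))" for r
    proof -
      have "(\<lambda>m. x ^ Suc r / real (Suc r) * (x ^ Suc r) ^ m) sums (x ^ Suc r / real (Suc r) * (1 / (1 - x ^ Suc r)))"
        using p[of r] by (intro sums_mult geometric_sums) (auto simp del: power_Suc)
      moreover have "x ^ Suc r / real (Suc r) * (x ^ Suc r) ^ m = x ^ (Suc m * Suc r) / real (Suc r)" for m
        by (simp flip: power_mult power_add add: algebra_simps del: power_Suc) 
      ultimately show ?thesis by (simp del: power_Suc)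
    qed
    show "(\<lambda>r. x ^ Suc r / (real (Suc r) * (1 - x ^ Suc r))) sums lambert_log x"
      using x by (rule lambert_log_sums)
    show "(\<lambda>r. x ^ (Suc m * Suc r) / real (Suc r)) sums - ln (1 - x ^ Suc m)" for m
    proof -
      define y where "y = x ^ Suc m"
      have y: "0 < y" "y < 1" using p[of m] by (auto simp: y_def)
      have "(\<lambda>n. - ((-(-y)) ^ n) / real n) sums ln (1 + (-y))"
        using ln_series'[of "-y"] y by simp
      hence "(\<lambda>n. y ^ n / real n) sums (- ln (1 - y))"
        using sums_minus by fastforce
      hence "(\<lambda>n. y ^ Suc n / real (Suc n)) sums (- ln (1 - y))"
        by (subst sums_Suc_iff) simp
      thus ?thesis unfolding y_def power_mult .
    qed
  qed
  hence "(\<lambda>m. ln (1 - x ^ Suc m)) sums (- lambert_log x)"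
    using sums_minus by fastforce
  hence "(\<lambda>N. exp (\<Sum>m<N. ln (1 - x ^ Suc m))) \<longlonglongrightarrow> exp (- lambert_log x)"
    unfolding sums_def by (rule tendsto_exp)
  also have "(\<lambda>N. exp (\<Sum>m<N. ln (1 - x ^ Suc m))) = (\<lambda>N. \<Prod>m<N. 1 - x ^ Suc m)"
    using p by (simp add: exp_sum del: power_Suc)
  finally have "(\<lambda>N. complex_of_real (\<Prod>m<N. 1 - x ^ Suc m)) \<longlonglongrightarrow> of_real (exp (- lambert_log x))"
    by (rule tendsto_of_real)
  moreover have "(\<lambda>N. complex_of_real (\<Prod>m<N. 1 - x ^ Suc m)) \<longlonglongrightarrow> euler_phi (of_real x)"
    using euler_phi_tendsto[of "of_real x"] x by (simp del: power_Suc)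
  ultimately show ?thesis using LIMSEQ_unique by blast
qed

section \<open>Partial fractions of the hyperbolic cotangent\<close>

text \<open>Logarithmic derivative of the sine product at the point i y. The product is taken on a
  disc of radius \<open>y + 1\<close>, so that i y is an interior point; differentiating pi z P(z) =
  sin(pi z) gives the closed form.\<close>

lemma coth_partial_fractions:
  assumes y: "y > (0::real)"
  shows "(\<lambda>n. 1 / (real (Suc n) ^ 2 + y ^ 2)) sums ((pi * y * (cosh (pi * y) / sinh (pi * y)) - 1) / (2 * y ^ 2))"
proof -
  define f where "f = (\<lambda>k (z::complex). 1 - z ^ 2 / of_nat (Suc k) ^ 2)"
  define A where "A = ball (0::complex) (y + 1)"
  have "uniformly_convergent_on (cball 0 (y+1)) (\<lambda>N z. \<Prod>k<N. f k z)"
  proof (rule uniformly_convergent_on_prod')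
    show "uniformly_convergent_on (cball 0 (y+1)) (\<lambda>N z. \<Sum>k<N. norm (f k z - 1))"
    proof (rule Weierstrass_m_test'[of _ _ "\<lambda>k. (y+1)^2 / real (Suc k) ^ 2"])
      show "summable (\<lambda>k. (y+1)^2 / real (Suc k) ^ 2)"
        using summable_mult[OF sums_summable[OF inverse_squares_sums], of "(y+1)^2"] by (simp add: add_ac)
    qed (auto simp: f_def norm_divide norm_power simp del: of_nat_Suc intro!: divide_right_mono power_mono)
  qed (auto simp: f_def simp del: of_nat_Suc intro!: continuous_intros)
  then obtain P where P: "uniform_limit (cball 0 (y+1)) (\<lambda>N z. \<Prod>k<N. f k z) P sequentially"
    by (auto simp: uniformly_convergent_on_def)
  hence P': "uniform_limit A (\<lambda>N z. \<Prod>k<N. f k z) P sequentially"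
    by (rule uniform_limit_on_subset) (auto simp: A_def)
  have Peq: "of_real pi * z * P z = sin (of_real pi * z)" if "z \<in> A" for z
  proof -
    have "(\<lambda>N. of_real pi * z * (\<Prod>k<N. f k z)) \<longlonglongrightarrow> of_real pi * z * P z"
      using that by (intro tendsto_intros tendsto_uniform_limitI[OF P'])
    moreover have "(\<Prod>k<N. f k z) = (\<Prod>k=1..N. 1 - z^2 / of_nat k^2)" for N
      unfolding f_def by (rule prod.reindex_bij_witness[of _ "\<lambda>k. k - 1" Suc]) auto
    ultimately show ?thesis
      using sin_product_formula_complex[of z] LIMSEQ_unique by force
  qed
  define z where "z = \<i> * complex_of_real y"
  have z: "z \<in> A" "z \<noteq> 0" using y by (auto simp: z_def A_def norm_mult)
  have zs: "z\<^sup>2 = - complex_of_real (y\<^sup>2)" by (simp add: z_def power_mult_distrib)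
  have sin_z: "sin (of_real pi * z) = \<i> * of_real (sinh (pi * y))"
    using sinh_conv_sin[of "of_real (pi * y)"]
    by (simp add: z_def mult.left_commute sinh_field_def exp_of_real[symmetric] exp_minus)
  have cos_z: "cos (of_real pi * z) = of_real (cosh (pi * y))"
    using cosh_conv_cos[of "of_real (pi * y)"]
    by (simp add: z_def mult.left_commute cosh_field_def exp_of_real[symmetric] exp_minus)
  have sh: "sinh (pi * y) > 0" using y by simp
  have Pz: "P z \<noteq> 0" using Peq[OF z(1)] sh by (auto simp: sin_z)
  have *: "(\<lambda>k. deriv (f k) z / f k z) sums (deriv P z / P z)"
    by (rule logderiv_prodinf_complex_uniform_limit[OF P'])
       (use z Pz in \<open>auto simp: f_def A_def intro!: holomorphic_intros\<close>)
  have "P holomorphic_on A"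
  proof (rule holomorphic_uniform_sequence[of A "\<lambda>N z. \<Prod>k<N. f k z"])
    fix x assume "x \<in> A"
    moreover have "open A" by (simp add: A_def)
    ultimately obtain d where d: "d > 0" "cball x d \<subseteq> A"
      using open_contains_cball by blast
    thus "\<exists>d>0. cball x d \<subseteq> A \<and> uniform_limit (cball x d) (\<lambda>N z. \<Prod>k<N. f k z) P sequentially"
      using uniform_limit_on_subset[OF P'] by blast
  qed (auto simp: A_def f_def intro!: holomorphic_intros)
  hence dP: "(P has_field_derivative deriv P z) (at z)"
    using z by (intro holomorphic_derivI[of _ A]) (auto simp: A_def)
  have "((\<lambda>z. of_real pi * z * P z) has_field_derivative (of_real pi * P z + of_real pi * z * deriv P z)) (at z)"
    by (auto intro!: derivative_eq_intros dP simp: algebra_simps)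
  hence "((\<lambda>z. sin (of_real pi * z)) has_field_derivative (of_real pi * P z + of_real pi * z * deriv P z)) (at z)"
    by (rule has_field_derivative_transform_within_open[of _ _ _ A]) (use z Peq in \<open>auto simp: A_def\<close>)
  moreover have "((\<lambda>z. sin (of_real pi * z)) has_field_derivative (of_real pi * cos (of_real pi * z))) (at z)"
    by (auto intro!: derivative_eq_intros)
  ultimately have "of_real pi * P z + of_real pi * z * deriv P z = of_real pi * cos (of_real pi * z)"
    by (rule DERIV_unique)
  hence "of_real pi * (P z + z * deriv P z) = of_real pi * cos (of_real pi * z)"
    by (simp add: algebra_simps)
  hence "cos (of_real pi * z) = P z + z * deriv P z"
    by simp
  hence "deriv P z / P z = of_real pi * cos (of_real pi * z) / sin (of_real pi * z) - 1 / z"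
    unfolding Peq[OF z(1), symmetric] using z Pz by (simp add: divide_simps)
  also have "\<dots> = - \<i> * of_real (pi * (cosh (pi * y) / sinh (pi * y)) - 1 / y)"
    unfolding sin_z cos_z using y by (simp add: z_def field_simps)
  finally have 1: "deriv P z / P z = - \<i> * of_real (pi * (cosh (pi * y) / sinh (pi * y)) - 1 / y)" .
  have 2: "deriv (f k) z / f k z = - \<i> * of_real (2 * y / (real (Suc k) ^ 2 + y ^ 2))" for k
  proof -
    have "(f k has_field_derivative (- 2 * z / of_nat (Suc k) ^ 2)) (at z)"
    proof -
      have "((\<lambda>z. 1 - inverse (c ^ 2) * z ^ 2) has_field_derivative (- 2 * z / c ^ 2)) (at z)" for c
        by (auto intro!: derivative_eq_intros simp: divide_inverse mult_ac)
      from this[of "of_nat (Suc k)"] show ?thesis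
        unfolding f_def by (simp only: divide_inverse mult_ac)
    qed
    hence "deriv (f k) z = - 2 * z / of_nat (Suc k) ^ 2" by (rule DERIV_imp_deriv)
    moreover have "f k z = of_real ((real (Suc k) ^ 2 + y ^ 2) / real (Suc k) ^ 2)"
      by (simp add: f_def zs field_simps del: of_nat_Suc)
    moreover have "real (Suc k) ^ 2 + y ^ 2 > 0" using y by (auto intro: add_pos_pos)
    moreover have "(of_nat (Suc k)) ^ 2 = complex_of_real (real (Suc k) ^ 2)" "real (Suc k) ^ 2 > 0"
      by (simp_all only: of_real_power of_real_of_nat_eq) simp
    ultimately show ?thesis
      by (simp add: z_def del: of_nat_Suc of_real_add of_real_power)
  qed
  have "(\<lambda>k. \<i> * (- \<i> * of_real (2 * y / (real (Suc k) ^ 2 + y ^ 2)))) sums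
      (\<i> * (- \<i> * of_real (pi * (cosh (pi * y) / sinh (pi * y)) - 1 / y)))"
    using * unfolding 1 2 by (rule sums_mult)
  hence "(\<lambda>k. complex_of_real (2 * y / (real (Suc k) ^ 2 + y ^ 2))) sums
      of_real (pi * (cosh (pi * y) / sinh (pi * y)) - 1 / y)"
    by (simp del: of_nat_Suc of_real_add of_real_power)
  hence "(\<lambda>k. 2 * y / (real (Suc k) ^ 2 + y ^ 2)) sums (pi * (cosh (pi * y) / sinh (pi * y)) - 1 / y)"
    by (simp only: sums_of_real_iff)
  moreover have "2 * y / c / (2 * y) = 1 / c" for c :: real
    using y by simp
  moreover have "(pi * (cosh (pi * y) / sinh (pi * y)) - 1 / y) / (2 * y)
      = (pi * y * (cosh (pi * y) / sinh (pi * y)) - 1) / (2 * y ^ 2)"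
    using y by (simp add: field_simps power2_eq_square)
  ultimately show ?thesis
    using sums_divide[of _ _ "2 * y"] by (metis (no_types, lifting) sums_cong)
qed

section \<open>The inversion formula on the imaginary axis\<close>

text \<open>Grouping consecutive terms gives the sum of \<open>d (2*k) + d (2*k+1)\<close>; removing
  the odd-indexed subseries twice flips its sign.\<close>

lemma sums_alternate:
  fixes d :: "nat \<Rightarrow> real"
  assumes "d sums D" "(\<lambda>k. d (2 * k + 1)) sums E"
  shows "(\<lambda>k. d (2 * k) - d (2 * k + 1)) sums (D - 2 * E)"
proof -
  have "(\<lambda>k. sum d {k * 2..<k * 2 + 2}) sums D"
    using assms(1) by (rule sums_group) simp
  moreover have "sum d {k * 2..<k * 2 + 2} = d (2 * k) + d (2 * k + 1)" for k
    by (simp add: numeral_2_eq_2 mult.commute)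
  ultimately have "(\<lambda>k. d (2 * k) + d (2 * k + 1)) sums D" by simp
  from sums_diff[OF this sums_mult[OF assms(2), of 2]] show ?thesis by simp
qed

text \<open>Alternating partial fractions produce coth at a full and at a half argument. Their
  difference collapses to 1/sinh, which expands into two Lambert terms.\<close>

lemma coth_minus_coth_half:
  fixes x :: real
  assumes "x > 0"
  shows "cosh (x / 2) / sinh (x / 2) - cosh x / sinh x = 1 / sinh x"
proof -
  have s: "sinh (x/2) > 0" "sinh x = 2 * sinh (x/2) * cosh (x/2)" "cosh x = 2 * cosh (x/2)^2 - 1"
    using assms sinh_double[of "x/2"] cosh_double_cosh[of "x/2"] by auto
  have "cosh (x/2) > 0" by simp
  with s(1) show ?thesis unfolding s(2,3)
    by (simp add: field_simps power2_eq_square)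
qed

text \<open>This is the logarithm of f1(i/t) = f2(i t). Both sides come from the alternating double
  series of 1/(r^2 + (n t)^2): summing over n first gives the Lambert series in exp(-pi/t), summing
  over r first gives those in exp(-2 pi t).\<close>

lemma lambert_log_inversion:
  assumes t: "t > 0"
  shows "pi / (24 * t) - lambert_log (exp (- pi / t)) + lambert_log (exp (- 2 * pi / t)) =
    ln 2 / 2 - pi * t / 12 + lambert_log (exp (- 2 * pi * t)) - lambert_log (exp (- 4 * pi * t))"
proof -
  \<comment> \<open>The terms for n = 2k+1 and n = 2k+2 are combined into one entry. The difference
    is nonnegative, which is what allows the order of summation to be exchanged.\<close>
  define b where "b = (\<lambda>r k. 1 / (real (Suc r) ^ 2 + (real (2*k+1) * t) ^ 2)
      - 1 / (real (Suc r) ^ 2 + (real (2*k+2) * t) ^ 2))"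
  define y where "y = exp (- pi / t)"
  define q where "q = exp (- 2 * pi * t)"
  have y: "0 < y" "y < 1" "0 < y^2" "y^2 < 1" using t by (auto simp: y_def abs_square_less_1)
  have q: "0 < q" "q < 1" "0 < q^2" "q^2 < 1" using t by (auto simp: q_def abs_square_less_1)
  have y2: "exp (- 2 * pi / t) = y ^ 2" by (simp add: y_def flip: exp_of_nat_mult)
  have q2: "exp (- 4 * pi * t) = q ^ 2" by (simp add: q_def flip: exp_of_nat_mult)
  have pi6: "(\<lambda>n. 1 / real (Suc n) ^ 2) sums (pi\<^sup>2 / 6)"
    using inverse_squares_sums by (simp add: add_ac)
  define f where "f = (\<lambda>r. (1 / 2) * (1 / real (Suc r) ^ 2) - pi / (2 * real (Suc r) * t * sinh (pi * real (Suc r) / t)))"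
  define s where "s = (1/2) * (pi\<^sup>2 / 6) - (pi / t) * (lambert_log y - lambert_log (y^2))"
  \<comment> \<open>For positive \<open>n\<close> this is the sum of 1/(r^2 + (n t)^2) over all
    positive r, by the partial fractions of coth.\<close>
  define c where "c = (\<lambda>n. (pi * (real n * t) * (cosh (pi * (real n * t)) / sinh (pi * (real n * t))) - 1) / (2 * (real n * t) ^ 2))"
  have "(\<lambda>k. c (2*k+1) - c (2*k+2)) sums s"
  proof (rule nonneg_sums_swap[where a = b and f = f])
    show "b r k \<ge> 0" for r k
    proof -
      have "(real (2*k+1) * t) ^ 2 \<le> (real (2*k+2) * t) ^ 2"
        using t by (intro power_mono mult_right_mono) auto
      moreover have "real (Suc r) ^ 2 + (real (2*k+1) * t) ^ 2 > 0" by (intro add_pos_nonneg) auto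
      ultimately show ?thesis unfolding b_def by (simp add: frac_le)
    qed
    show "b r sums f r" for r
    proof -
      define x where "x = real (Suc r) / t"
      have x: "x > 0" using t by (simp add: x_def)
      define d where "d = (\<lambda>n. 1 / (real (Suc r) ^ 2 + (real (Suc n) * t) ^ 2))"
      have e1: "1 / t^2 * (1 / (real (Suc n) ^ 2 + x ^ 2)) = d n" for n
      proof -
        have "t^2 * (real (Suc n) ^ 2 + x ^ 2) = real (Suc r) ^ 2 + (real (Suc n) * t) ^ 2"
          using t by (simp add: x_def power_mult_distrib power_divide distrib_left del: of_nat_Suc)
        thus ?thesis by (simp add: d_def)
      qed
      \<comment> \<open>Odd indices of \<open>d\<close> belong to even multiples of \<open>t\<close>
        because of the shift in \<open>Suc n\<close>; the factor 2 is absorbed by halving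
        \<open>x\<close>.\<close>
      have e2: "1 / (4 * t^2) * (1 / (real (Suc k) ^ 2 + (x/2) ^ 2)) = d (2 * k + 1)" for k
      proof -
        have "4 * t^2 * (real (Suc k) ^ 2 + (x/2) ^ 2) = real (Suc r) ^ 2 + (real (Suc (2*k+1)) * t) ^ 2"
          using t by (simp add: x_def field_simps power2_eq_square)
        thus ?thesis by (simp add: d_def)
      qed
      define C where "C = cosh (pi * x) / sinh (pi * x)"
      define C' where "C' = cosh (pi * x / 2) / sinh (pi * x / 2)"
      have "d sums (1 / t^2 * ((pi * x * C - 1) / (2 * x^2)))"
        using sums_mult[OF coth_partial_fractions[OF x], of "1 / t^2"] unfolding e1 C_def .
      moreover have "(\<lambda>k. d (2*k+1)) sums (1 / (4*t^2) * ((pi * (x/2) * C' - 1) / (2 * (x/2)^2)))"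
        using sums_mult[OF coth_partial_fractions[of "x/2"], of "1 / (4*t^2)"] x unfolding e2 C'_def by simp
      ultimately have "(\<lambda>k. d (2*k) - d (2*k+1)) sums (1 / t^2 * ((pi * x * C - 1) / (2 * x^2))
          - 2 * (1 / (4*t^2) * ((pi * (x/2) * C' - 1) / (2 * (x/2)^2))))"
        by (rule sums_alternate)
      also have "(1 / t^2 * ((pi * x * C - 1) / (2 * x^2))
          - 2 * (1 / (4*t^2) * ((pi * (x/2) * C' - 1) / (2 * (x/2)^2)))) = (1 - pi * x * (C' - C)) / (2 * x^2 * t^2)"
        using x t by (simp add: field_simps power2_eq_square)
      also have "C' - C = 1 / sinh (pi * x)"
        using coth_minus_coth_half[of "pi * x"] x by (simp add: C_def C'_def)
      also have "(1 - pi * x * (1 / sinh (pi * x))) / (2 * x^2 * t^2) = f r"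
      proof -
        have "x * t = real (Suc r)" using t by (simp add: x_def)
        moreover have "sinh (pi * x) \<noteq> 0" using x by simp
        moreover have "pi * real (Suc r) / t = pi * x" by (simp add: x_def)
        ultimately show ?thesis unfolding f_def using t x
          by (simp add: field_simps power2_eq_square flip: \<open>x * t = real (Suc r)\<close> del: of_nat_Suc)
      qed
      finally show ?thesis by (simp add: d_def b_def add_ac)
    qed
    show "f sums s"
    proof -
      have "(\<lambda>r. y ^ Suc r / (real (Suc r) * (1 - y ^ Suc r)) - (y^2) ^ Suc r / (real (Suc r) * (1 - (y^2) ^ Suc r)))
          sums (lambert_log y - lambert_log (y^2))"
        using y by (intro sums_diff lambert_log_sums) auto
      from sums_mult[OF this, of "pi/t"]
      have "(\<lambda>r. pi / t * (y ^ Suc r / (real (Suc r) * (1 - y ^ Suc r)) - (y^2) ^ Suc r / (real (Suc r) * (1 - (y^2) ^ Suc r))))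
          sums (pi / t * (lambert_log y - lambert_log (y^2)))" .
      moreover have "pi / t * (y ^ Suc r / (real (Suc r) * (1 - y ^ Suc r)) - (y^2) ^ Suc r / (real (Suc r) * (1 - (y^2) ^ Suc r)))
          = pi / (2 * real (Suc r) * t * sinh (pi * real (Suc r) / t))" for r
      proof -
        define Y where "Y = y ^ Suc r"
        have Y: "0 < Y" "Y < 1" using y by (auto simp: Y_def power_Suc_less_one simp del: power_Suc)
        have Ye: "Y = exp (- (pi * real (Suc r) / t))"
          by (simp add: Y_def y_def flip: exp_of_nat_mult del: power_Suc of_nat_Suc)
        have sh: "sinh (pi * real (Suc r) / t) = (1 / Y - Y) / 2"
          by (simp add: sinh_def Ye exp_minus field_simps)
        have "(y^2) ^ Suc r = Y^2" by (simp add: Y_def flip: power_mult add: mult.commute del: power_Suc)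
        moreover have "1 - Y^2 = (1 - Y) * (1 + Y)" by (simp add: power2_eq_square algebra_simps)
        moreover have "1 / Y - Y = (1 - Y) * (1 + Y) / Y" using Y by (simp add: field_simps)
        moreover have "Y / (N * a) - Y\<^sup>2 / (N * (a * b)) = Y / (N * (a * b))"
          if "N > 0" "a > 0" "b = 1 + Y" for N a b :: real
          using that Y by (simp add: divide_simps) (simp add: algebra_simps power2_eq_square)
        ultimately show ?thesis unfolding Y_def[symmetric] sh using Y t
          by (simp del: of_nat_Suc power_Suc)
      qed
      ultimately show ?thesis unfolding f_def s_def
        by (intro sums_diff sums_mult pi6) (simp only:)
    qed
    show "(\<lambda>r. b r k) sums (c (2*k+1) - c (2*k+2))" for k
      unfolding b_def c_def using t by (intro sums_diff coth_partial_fractions) auto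
  qed
  moreover have "(\<lambda>k. c (2*k+1) - c (2*k+2)) sums
      (pi / (2*t) * (ln 2 + 2 * (lambert_log q - lambert_log (q^2))) - 1 / (2*t^2) * (pi\<^sup>2 / 12))"
  proof -
    \<comment> \<open>The constant ln 2 is the alternating harmonic series, contributed by the limit
      1 of coth in the terms \<open>c n\<close>.\<close>
    have "(\<lambda>k. sum (\<lambda>k. (-1)^k / real_of_nat (Suc k)) {k*2..<k*2+2}) sums ln 2"
      using alternating_harmonic_series_sums by (rule sums_group) simp
    hence 1: "(\<lambda>k. 1 / real (2*k+1) - 1 / real (2*k+2)) sums ln 2"
    proof (rule sums_cong[THEN iffD1, rotated])
      fix k :: nat
      have "{k*2..<k*2+2} = {2*k, 2*k+1}" by auto
      thus "(\<Sum>k\<in>{k*2..<k*2+2}. (-1)^k / real_of_nat (Suc k)) = 1 / real (2*k+1) - 1 / real (2*k+2)"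
        by simp
    qed
    define d where "d = (\<lambda>n. q ^ Suc n / (real (Suc n) * (1 - q ^ Suc n)))"
    have "(\<lambda>k. 1/2 * ((q^2) ^ Suc k / (real (Suc k) * (1 - (q^2) ^ Suc k)))) sums (1/2 * lambert_log (q^2))"
      using q by (intro sums_mult lambert_log_sums) auto
    moreover have "1/2 * ((q^2) ^ Suc k / (real (Suc k) * (1 - (q^2) ^ Suc k))) = d (2*k+1)" for k
    proof -
      have "(q^2) ^ Suc k = q ^ Suc (2*k+1)"
        unfolding power_mult[symmetric] by (rule arg_cong[of _ _ "\<lambda>k. q ^ k"]) simp
      moreover have "real (Suc (2*k+1)) = 2 * real (Suc k)" by simp
      ultimately show ?thesis unfolding d_def by (simp del: power_Suc of_nat_Suc)
    qed
    ultimately have 2: "(\<lambda>k. d (2*k) - d (2*k+1)) sums (lambert_log q - 2 * (1/2 * lambert_log (q^2)))"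
      using q lambert_log_sums[of q]
      by (simp only:, intro sums_alternate) (auto simp: d_def simp del: power_Suc of_nat_Suc)
    define e where "e = (\<lambda>n. 1 / real (Suc n) ^ 2)"
    have "(\<lambda>k. 1/4 * (1 / real (Suc k) ^ 2)) sums (1/4 * (pi\<^sup>2 / 6))"
      by (intro sums_mult pi6)
    moreover have "1/4 * (1 / real (Suc k) ^ 2) = e (2*k+1)" for k
    proof -
      have "real (Suc (2*k+1)) = 2 * real (Suc k)" by simp
      thus ?thesis unfolding e_def by (simp only:) (simp add: power_mult_distrib del: of_nat_Suc)
    qed
    ultimately have 3: "(\<lambda>k. e (2*k) - e (2*k+1)) sums (pi\<^sup>2 / 6 - 2 * (1/4 * (pi\<^sup>2 / 6)))"
      using pi6 by (simp only:, intro sums_alternate) (auto simp: e_def)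
    \<comment> \<open>With Q = exp(-2 pi n t) one has coth(pi n t) = 1 + 2 Q/(1 - Q). The summand 1
      yields a harmonic term, the rest a Lambert term, and the -1 in \<open>c\<close> an inverse
      square.\<close>
    have c_eq: "c (Suc n) = pi / (2*t) * (1 / real (Suc n) + 2 * d n) - 1 / (2 * t^2) * e n" for n
    proof -
      define Q where "Q = q ^ Suc n"
      have Q: "0 < Q" "Q < 1" using q by (auto simp: Q_def power_Suc_less_one simp del: power_Suc)
      define u where "u = exp (pi * (real (Suc n) * t))"
      have "Q = exp (- (2 * (pi * (real (Suc n) * t))))"
        unfolding Q_def q_def exp_of_nat_mult[symmetric] by (simp add: algebra_simps)
      moreover have "u ^ 2 = exp (2 * (pi * (real (Suc n) * t)))"
        by (simp add: u_def exp_double)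
      ultimately have u: "u > 0" "Q = 1 / u^2"
        by (simp_all add: u_def exp_minus divide_inverse del: of_nat_Suc)
      have u1: "u^2 > 1" using u Q by (simp add: divide_less_eq)
      have "cosh (pi * (real (Suc n) * t)) / sinh (pi * (real (Suc n) * t)) = ((u + 1/u)/2) / ((u - 1/u)/2)"
        by (simp only: sinh_field_def cosh_field_def u_def exp_minus inverse_eq_divide)
      also have "\<dots> = (u^2 + 1) / (u^2 - 1)"
        using u u1 by (simp add: divide_simps power2_eq_square) 
      also have "\<dots> = 1 + 2 * Q / (1 - Q)"
        unfolding u(2) using u u1 by (simp add: divide_simps)
      finally have C: "cosh (pi * (real (Suc n) * t)) / sinh (pi * (real (Suc n) * t)) = 1 + 2 * (Q / (1 - Q))" by simp
      define N where "N = real (Suc n)"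
      have N: "N > 0" by (simp add: N_def)
      define R where "R = Q / (1 - Q)"
      have d: "d n = R / N" by (simp add: d_def Q_def N_def R_def)
      show ?thesis unfolding c_def C d e_def unfolding N_def[symmetric] R_def[symmetric] using t N
        by (simp add: field_simps power2_eq_square)
    qed
    have "c (2*k+1) - c (2*k+2) = pi / (2*t) * ((1 / real (2*k+1) - 1 / real (2*k+2)) + 2 * (d (2*k) - d (2*k+1)))
        - 1 / (2*t^2) * (e (2*k) - e (2*k+1))" for k
      using c_eq[of "2*k"] c_eq[of "2*k+1"] by (simp add: algebra_simps)
    moreover have "lambert_log q - 2 * (1/2 * lambert_log (q^2)) = lambert_log q - lambert_log (q^2)"
      "pi\<^sup>2 / 6 - 2 * (1/4 * (pi\<^sup>2 / 6)) = pi\<^sup>2 / 12"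
      by simp_all
    ultimately show ?thesis
      using sums_diff[OF sums_mult[OF sums_add[OF 1 sums_mult[OF 2, of 2]], of "pi / (2*t)"] sums_mult[OF 3, of "1/(2*t^2)"]]
      by (simp only:)
  qed
  ultimately have "s = pi / (2*t) * (ln 2 + 2 * (lambert_log q - lambert_log (q^2))) - 1 / (2*t^2) * (pi\<^sup>2 / 12)"
    by (rule sums_unique2)
  \<comment> \<open>The factor \<open>t / pi\<close> brings both Lambert differences to coefficient
    1; the elementary terms left are pi t/12, ln 2/2 and pi/(24 t).\<close>
  hence "t / pi * s = t / pi * (pi / (2*t) * (ln 2 + 2 * (lambert_log q - lambert_log (q^2))) - 1 / (2*t^2) * (pi\<^sup>2 / 12))"
    by simp
  moreover have "t / pi * s = pi * t / 12 - (lambert_log y - lambert_log (y^2))"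
    unfolding s_def using t by (simp add: field_simps power2_eq_square)
  moreover have "t / pi * (pi / (2*t) * (ln 2 + 2 * (lambert_log q - lambert_log (q^2))) - 1 / (2*t^2) * (pi\<^sup>2 / 12))
      = ln 2 / 2 + (lambert_log q - lambert_log (q^2)) - pi / (24 * t)"
    using t by (simp add: field_simps power2_eq_square)
  ultimately have "pi * t / 12 - (lambert_log y - lambert_log (y^2)) =
      ln 2 / 2 + (lambert_log q - lambert_log (q^2)) - pi / (24 * t)"
    by presburger
  thus ?thesis unfolding y2 q2 y_def[symmetric] q_def[symmetric]
    by (simp add: algebra_simps)
qed

section \<open>The Weber functions\<close>

lemma open_upper_half_plane: "open upper_half_plane"
  using open_halfspace_Im_gt[of 0] by simp

lemma connected_upper_half_plane: "connected upper_half_plane"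
  using convex_halfspace_Im_gt[of 0] by (intro convex_connected) simp

lemma norm_exp_ii_less_1:
  assumes "Im t > 0" "c > 0"
  shows "norm (exp (of_real (c * pi) * \<i> * t)) < 1"
  using assms by (simp add: norm_exp_eq_Re)

text \<open>The usual q is \<open>nome t ^ 2\<close>. With this half-period variable the products in
  f, f1 and f2 have the arguments \<open>- nome t\<close>, \<open>nome t\<close> and
  \<open>nome t ^ 4\<close>.\<close>

definition nome :: "complex \<Rightarrow> complex" where
  "nome t = exp (of_real pi * \<i> * t)"

lemma norm_nome: "Im t > 0 \<Longrightarrow> norm (nome t) < 1"
  using norm_exp_ii_less_1[of t 1] by (simp add: nome_def)

lemma norm_nome_power: "Im t > 0 \<Longrightarrow> k > 0 \<Longrightarrow> norm (nome t ^ k) < 1"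
  by (simp add: norm_power power_less_one_iff norm_nome)

lemma norm_minus_nome: "Im t > 0 \<Longrightarrow> norm (- nome t) < 1"
  by (simp add: norm_nome)

lemma dedekind_eta_conv_euler_phi:
  "dedekind_eta t = exp (of_real pi * \<i> * t / 12) * euler_phi (nome t ^ 2)"
  unfolding dedekind_eta_def euler_phi_def nome_def
  by (simp flip: exp_of_nat_mult add: mult_ac)

text \<open>The factor \<open>inverse (zeta_root 48)\<close> cancels the phase exp(pi i/24) that the
  shifted argument (t+1)/2 puts into the exponential prefactor of eta.\<close>

lemma weber_f_conv:
  "weber_f t = exp (- of_real pi * \<i> * t / 24) * (euler_phi (- nome t) / euler_phi (nome t ^ 2))"
proof -
  have "nome ((t + 1) / 2) ^ 2 = exp (of_real pi * \<i> * t + of_real pi * \<i>)"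
    by (simp add: nome_def algebra_simps add_divide_distrib flip: exp_of_nat_mult)
  hence 1: "nome ((t + 1) / 2) ^ 2 = - nome t"
    by (simp add: exp_add nome_def)
  have "inverse (zeta_root 48) * (exp (of_real pi * \<i> * ((t + 1) / 2) / 12) / exp (of_real pi * \<i> * t / 12)) =
      exp (- of_real pi * \<i> * t / 24)"
    by (simp add: zeta_root_def flip: exp_minus exp_add exp_diff) (simp add: field_simps)
  moreover have "z * (a * b / (c * d)) = z * (a / c) * (b / d)" for z a b c d :: complex
    by simp
  ultimately show ?thesis
    unfolding weber_f_def dedekind_eta_conv_euler_phi 1 by (simp only:)
qed

lemma weber_f1_conv:
  "weber_f1 t = exp (- of_real pi * \<i> * t / 24) * (euler_phi (nome t) / euler_phi (nome t ^ 2))"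
proof -
  have 1: "nome (t / 2) ^ 2 = nome t"
    by (simp add: nome_def flip: exp_of_nat_mult)
  have "exp (of_real pi * \<i> * (t / 2) / 12) / exp (of_real pi * \<i> * t / 12) = exp (- of_real pi * \<i> * t / 24)"
    by (simp flip: exp_diff) (simp add: field_simps)
  thus ?thesis
    unfolding weber_f1_def dedekind_eta_conv_euler_phi 1 by (simp flip: times_divide_times_eq)
qed

lemma weber_f2_conv:
  "weber_f2 t = of_real (sqrt 2) * exp (of_real pi * \<i> * t / 12) * (euler_phi (nome t ^ 4) / euler_phi (nome t ^ 2))"
proof -
  have 1: "nome (2 * t) ^ 2 = nome t ^ 4"
    by (simp add: nome_def mult_ac flip: exp_of_nat_mult)
  have "exp (of_real pi * \<i> * (2 * t) / 12) / exp (of_real pi * \<i> * t / 12) = exp (of_real pi * \<i> * t / 12)"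
    by (simp flip: exp_diff) (simp add: field_simps)
  moreover have "z * (a * b / (c * d)) = z * (a / c) * (b / d)" for z a b c d :: complex
    by simp
  ultimately show ?thesis
    unfolding weber_f2_def dedekind_eta_conv_euler_phi 1 by (simp only:)
qed

lemma nome_holomorphic [holomorphic_intros]: "f holomorphic_on A \<Longrightarrow> (\<lambda>z. nome (f z)) holomorphic_on A"
  unfolding nome_def by (intro holomorphic_intros)

lemma euler_phi_holomorphic':
  assumes "f holomorphic_on A" "\<And>z. z \<in> A \<Longrightarrow> norm (f z) < 1"
  shows "(\<lambda>z. euler_phi (f z)) holomorphic_on A"
proof -
  have "f ` A \<subseteq> ball 0 1" using assms(2) by auto
  from holomorphic_on_compose_gen[OF assms(1) euler_phi_holomorphic this] show ?thesis
    by (simp add: o_def)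
qed

lemma weber_f_holomorphic: "weber_f holomorphic_on upper_half_plane"
  and weber_f1_holomorphic: "weber_f1 holomorphic_on upper_half_plane"
  and weber_f2_holomorphic: "weber_f2 holomorphic_on upper_half_plane"
  unfolding weber_f_conv weber_f1_conv weber_f2_conv
  by (intro holomorphic_intros euler_phi_holomorphic';
      use norm_nome norm_nome_power norm_minus_nome euler_phi_nonzero in auto)+

lemma weber_f_nonzero:
  assumes "Im t > 0"
  shows "weber_f t \<noteq> 0" "weber_f1 t \<noteq> 0" "weber_f2 t \<noteq> 0"
  using assms norm_nome norm_nome_power norm_minus_nome euler_phi_nonzero
  by (auto simp: weber_f_conv weber_f1_conv weber_f2_conv)

text \<open>The exponential prefactors have exponents -1/24, -1/24 and 1/12 and cancel; the Euler
  products cancel by duplication.\<close>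

lemma weber_product:
  assumes "Im t > 0"
  shows "weber_f t * weber_f1 t * weber_f2 t = of_real (sqrt 2)"
proof -
  define e where "e = exp (- of_real pi * \<i> * t / 24)"
  have "exp (of_real pi * \<i> * t / 12) * e ^ 2 = 1"
    by (simp add: e_def flip: exp_of_nat_mult exp_add)
  moreover have "euler_phi (nome t ^ 2) ^ 3 \<noteq> 0"
    using assms euler_phi_nonzero[OF norm_nome_power[of t 2]] by simp
  moreover have "e * (b / p) * (e * (a / p)) * (s * E * (c / p)) = s * (E * e ^ 2) * ((a * b * c) / p ^ 3)"
    for a b c p s E :: complex
    by (simp add: power2_eq_square power3_eq_cube mult_ac)
  ultimately show ?thesis
    using euler_phi_duplication[OF norm_nome[OF assms]]
    unfolding weber_f_conv weber_f1_conv weber_f2_conv e_def[symmetric] by simp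
qed

text \<open>\<open>nome\<close> changes sign, which exchanges the numerators of f and f1; f2
  contains only even powers of it and picks up just the phase of its prefactor.\<close>

lemma weber_translation:
  shows "weber_f (t + 1) = inverse (zeta_root 48) * weber_f1 t"
    and "weber_f1 (t + 1) = inverse (zeta_root 48) * weber_f t"
    and "weber_f2 (t + 1) = zeta_root 24 * weber_f2 t"
proof -
  have 1: "nome (t + 1) = - nome t"
    by (simp add: nome_def distrib_left exp_add)
  have 2: "exp (- of_real pi * \<i> * (t + 1) / 24) = inverse (zeta_root 48) * exp (- of_real pi * \<i> * t / 24)"
    unfolding zeta_root_def exp_minus[symmetric] exp_add[symmetric]
    by (rule arg_cong[of _ _ exp]) (simp add: field_simps)
  have 3: "exp (of_real pi * \<i> * (t + 1) / 12) = zeta_root 24 * exp (of_real pi * \<i> * t / 12)"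
    by (simp add: zeta_root_def flip: exp_add) (simp add: field_simps)
  show "weber_f (t + 1) = inverse (zeta_root 48) * weber_f1 t"
    and "weber_f1 (t + 1) = inverse (zeta_root 48) * weber_f t"
    and "weber_f2 (t + 1) = zeta_root 24 * weber_f2 t"
    unfolding weber_f_conv weber_f1_conv weber_f2_conv 1 2 3 by simp_all
qed

lemma weber_f1_inversion_imaginary:
  assumes t: "t > 0"
  shows "weber_f1 (\<i> / of_real t) = weber_f2 (\<i> * of_real t)"
proof -
  have n1: "nome (\<i> / of_real t) = of_real (exp (- pi / t))"
    unfolding nome_def exp_of_real[symmetric] using t
    by (intro arg_cong[of _ _ exp]) (simp add: field_simps)
  have n2: "nome (\<i> * of_real t) = of_real (exp (- pi * t))"
    unfolding nome_def exp_of_real[symmetric]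
    by (intro arg_cong[of _ _ exp]) (simp add: algebra_simps)
  have p1: "exp (- pi / t) ^ 2 = exp (- 2 * pi / t)" "exp (- pi * t) ^ 2 = exp (- 2 * pi * t)"
     "exp (- pi * t) ^ 4 = exp (- 4 * pi * t)"
    by (simp_all flip: exp_of_nat_mult)
  have e1: "exp (- of_real pi * \<i> * (\<i> / of_real t) / 24) = of_real (exp (pi / (24 * t)))"
    unfolding exp_of_real[symmetric] using t
    by (intro arg_cong[of _ _ exp]) (simp add: field_simps)
  have e2: "exp (of_real pi * \<i> * (\<i> * of_real t) / 12) = of_real (exp (- pi * t / 12))"
    unfolding exp_of_real[symmetric]
    by (intro arg_cong[of _ _ exp]) (simp add: algebra_simps)
  have l: "euler_phi (of_real (exp (- pi / t))) = of_real (exp (- lambert_log (exp (- pi / t))))"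
    "euler_phi (of_real (exp (- 2 * pi / t))) = of_real (exp (- lambert_log (exp (- 2 * pi / t))))"
    "euler_phi (of_real (exp (- 2 * pi * t))) = of_real (exp (- lambert_log (exp (- 2 * pi * t))))"
    "euler_phi (of_real (exp (- 4 * pi * t))) = of_real (exp (- lambert_log (exp (- 4 * pi * t))))"
    using t by (auto intro!: euler_phi_of_real)
  have s: "sqrt 2 = exp (ln 2 / 2)"
    by (simp add: powr_def flip: powr_half_sqrt)
  have "weber_f1 (\<i> / of_real t) =
      of_real (exp (pi / (24 * t) - lambert_log (exp (- pi / t)) + lambert_log (exp (- 2 * pi / t))))"
    unfolding weber_f1_conv e1 n1 of_real_power[symmetric] p1 l
      of_real_mult[symmetric] of_real_divide[symmetric] exp_diff[symmetric] exp_add[symmetric]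
    by (simp add: algebra_simps)
  also have "\<dots> = of_real (exp (ln 2 / 2 - pi * t / 12 + lambert_log (exp (- 2 * pi * t)) - lambert_log (exp (- 4 * pi * t))))"
    unfolding lambert_log_inversion[OF t] ..
  also have "\<dots> = weber_f2 (\<i> * of_real t)"
    unfolding weber_f2_conv e2 n2 of_real_power[symmetric] p1 s l
      of_real_mult[symmetric] of_real_divide[symmetric] exp_diff[symmetric] exp_add[symmetric]
    by (simp add: algebra_simps)
  finally show ?thesis .
qed

lemma Im_minus_inverse_pos: "Im t > 0 \<Longrightarrow> Im (- 1 / t) > 0"
  by (simp add: Im_divide) (metis sum_power2_gt_zero_iff less_numeral_extra(3) zero_less_divide_iff)

text \<open>The identity theorem extends the formula for f1 from the imaginary axis to the half
  plane. Applying it at -1/t gives f2, and the constant product of the three functions then gives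
  f.\<close>

lemma weber_inversion:
  assumes "Im t > 0"
  shows "weber_f (- 1 / t) = weber_f t"
    and "weber_f1 (- 1 / t) = weber_f2 t"
    and "weber_f2 (- 1 / t) = weber_f1 t"
proof -
  have main: "weber_f1 (- 1 / t) - weber_f2 t = 0" if "Im t > 0" for t
  proof (rule analytic_continuation[of "\<lambda>t. weber_f1 (- 1 / t) - weber_f2 t" upper_half_plane
        "(\<lambda>y. \<i> * of_real y) ` {0<..}" \<i>])
    have "(\<lambda>t. - 1 / t) holomorphic_on upper_half_plane"
      by (intro holomorphic_intros) auto
    hence "(weber_f1 \<circ> (\<lambda>t. - 1 / t)) holomorphic_on upper_half_plane"
      by (rule holomorphic_on_compose_gen[OF _ weber_f1_holomorphic]) (use Im_minus_inverse_pos in auto)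
    thus "(\<lambda>t. weber_f1 (- 1 / t) - weber_f2 t) holomorphic_on upper_half_plane"
      unfolding o_def by (intro holomorphic_intros weber_f2_holomorphic)
    show "\<i> islimpt (\<lambda>y. \<i> * of_real y) ` {0<..}"
      unfolding islimpt_approachable
    proof safe
      fix e :: real assume "e > 0"
      thus "\<exists>x'\<in>(\<lambda>y. \<i> * of_real y) ` {0<..}. x' \<noteq> \<i> \<and> dist x' \<i> < e"
        by (intro bexI[of _ "\<i> * of_real (1 + e / 2)"] image_eqI[of _ _ "1 + e / 2"]) (auto simp: dist_norm cmod_def)
    qed
    fix z assume "z \<in> (\<lambda>y. \<i> * complex_of_real y) ` {0<..}"
    then obtain y where "z = \<i> * of_real y" "y > 0" by auto
    thus "weber_f1 (- 1 / z) - weber_f2 z = 0"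
      using weber_f1_inversion_imaginary[of y] by (simp add: divide_inverse)
  qed (use that open_upper_half_plane connected_upper_half_plane in auto)
  show 1: "weber_f1 (- 1 / t) = weber_f2 t"
    using main[OF assms] by simp
  show 2: "weber_f2 (- 1 / t) = weber_f1 t"
    using main[OF Im_minus_inverse_pos[OF assms]] by simp
  \<comment> \<open>The inversion exchanges f1 and f2, hence preserves their product, and the total
    product is constant; cancelling leaves f.\<close>
  have "weber_f (- 1 / t) * (weber_f2 t * weber_f1 t) = weber_f t * (weber_f2 t * weber_f1 t)"
    using weber_product[OF assms] weber_product[OF Im_minus_inverse_pos[OF assms]]
    unfolding 1 2 by (simp only: mult_ac)
  thus "weber_f (- 1 / t) = weber_f t"
    using weber_f_nonzero[OF assms] by simp
qed

section \<open>Sixth powers of the Weber functions under translation and inversion\<close>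

definition weber_x0 :: "complex \<Rightarrow> complex" where "weber_x0 t = weber_u0 t ^ 6"
definition weber_x1 :: "complex \<Rightarrow> complex" where "weber_x1 t = weber_u1 t ^ 6"
definition weber_x2 :: "complex \<Rightarrow> complex" where "weber_x2 t = weber_u2 t ^ 6"

lemma weber_param_4: "weber_param 4 t = vector [weber_x0 t, weber_x1 t, weber_x2 t, 1]"
  by (simp add: weber_param_def weber_x0_def weber_x1_def weber_x2_def)

lemma weber_x_holomorphic:
  "weber_x0 holomorphic_on upper_half_plane"
  "weber_x1 holomorphic_on upper_half_plane"
  "weber_x2 holomorphic_on upper_half_plane"
  unfolding weber_x0_def weber_x1_def weber_x2_def weber_u0_def weber_u1_def weber_u2_def
  by (intro holomorphic_intros weber_f_holomorphic weber_f1_holomorphic weber_f2_holomorphic)+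

lemma zeta_root_nonzero [simp]: "zeta_root k \<noteq> 0"
  by (simp add: zeta_root_def)

lemma weber_x_nonzero:
  assumes "Im t > 0"
  shows "weber_x0 t \<noteq> 0" "weber_x1 t \<noteq> 0" "weber_x2 t \<noteq> 0"
  using weber_f_nonzero[OF assms]
  by (auto simp: weber_x0_def weber_x1_def weber_x2_def weber_u0_def weber_u1_def weber_u2_def)

lemma zeta_root_power: "m > 0 \<Longrightarrow> zeta_root (m * k) ^ m = zeta_root k"
  unfolding zeta_root_def exp_of_nat_mult[symmetric] by (simp add: field_simps)

lemma zeta_root_values:
  "zeta_root 48 ^ 6 = zeta_root 8" "zeta_root 24 ^ 6 = \<i>" "zeta_root 16 ^ 6 = zeta_root 8 ^ 3"
  "zeta_root 8 ^ 2 = \<i>"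
proof -
  have 4: "zeta_root 4 = \<i>"
    using cis_pi_half by (simp add: zeta_root_def cis_conv_exp mult_ac)
  show "zeta_root 48 ^ 6 = zeta_root 8" "zeta_root 24 ^ 6 = \<i>" "zeta_root 8 ^ 2 = \<i>"
    using zeta_root_power[of 6 8] zeta_root_power[of 6 4] zeta_root_power[of 2 4] by (simp_all add: 4)
  have "zeta_root 16 ^ 6 = (zeta_root 16 ^ 2) ^ 3" unfolding power_mult[symmetric] by simp
  thus "zeta_root 16 ^ 6 = zeta_root 8 ^ 3"
    using zeta_root_power[of 2 8] by (simp del: power_mult_numeral)
qed

text \<open>Each multiplier is a priori an eighth root of unity; the normalization of u1 by zeta_16,
  with zeta_16^6 = zeta_8^3, improves it to a fourth root. For instance x0(t+1) = zeta_8^(-1) f1^6 =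
  zeta_8^(-4) x1.\<close>

lemma weber_x_translation:
  "weber_x0 (t + 1) = - weber_x1 t"
  "weber_x1 (t + 1) = \<i> * weber_x0 t"
  "weber_x2 (t + 1) = \<i> * weber_x2 t"
proof -
  define z where "z = zeta_root 8"
  have z: "z \<noteq> 0" "z ^ 2 = \<i>" by (simp_all add: z_def zeta_root_values)
  have z3: "z ^ 3 = \<i> * z" and z4: "z * z = \<i>"
    using z by (simp_all add: power3_eq_cube power2_eq_square)
  note d = weber_x0_def weber_x1_def weber_x2_def weber_u0_def weber_u1_def weber_u2_def
     weber_translation power_mult_distrib power_inverse zeta_root_values z_def[symmetric]
  show "weber_x0 (t + 1) = - weber_x1 t"
  proof -
    have "z * (- (\<i> * z)) = 1" using z4 by (simp add: mult.left_commute)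
    hence "inverse z = - (\<i> * z)" by (rule inverse_unique)
    thus ?thesis unfolding d z3 by simp
  qed
  show "weber_x1 (t + 1) = \<i> * weber_x0 t"
    unfolding d z3 using z(1) by simp
  show "weber_x2 (t + 1) = \<i> * weber_x2 t"
    unfolding d z3 by simp
qed

text \<open>Exchanging f1 and f2 exchanges the normalizing factors zeta_8^3 and zeta_8^(-3), hence
  the multipliers zeta_8^6 = -i and zeta_8^(-6) = i.\<close>

lemma weber_x_inversion:
  assumes "Im t > 0"
  shows "weber_x0 (- 1 / t) = weber_x0 t"
  "weber_x1 (- 1 / t) = - \<i> * weber_x2 t"
  "weber_x2 (- 1 / t) = \<i> * weber_x1 t"
proof -
  define z where "z = zeta_root 8"
  have z: "z \<noteq> 0" "z ^ 2 = \<i>" by (simp_all add: z_def zeta_root_values)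
  have z3: "z ^ 3 = \<i> * z" and z4: "z * z = \<i>"
    using z by (simp_all add: power3_eq_cube power2_eq_square)
  note d = weber_x0_def weber_x1_def weber_x2_def weber_u0_def weber_u1_def weber_u2_def
     weber_inversion[OF assms] power_mult_distrib power_inverse zeta_root_values z_def[symmetric]
  show "weber_x0 (- 1 / t) = weber_x0 t"
    unfolding d ..
  have "(\<i> * z) * (\<i> * (\<i> * z)) = - (\<i> * (z * z))" by simp
  also have "\<dots> = 1" unfolding z4 by simp
  finally have "(\<i> * z) * (\<i> * (\<i> * z)) = 1" .
  hence *: "inverse (\<i> * z) = \<i> * (\<i> * z)" by (rule inverse_unique)
  show "weber_x1 (- 1 / t) = - \<i> * weber_x2 t"
    unfolding d z3 * by simp
  show "weber_x2 (- 1 / t) = \<i> * weber_x1 t"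
    unfolding d z3 * by (simp only: mult_ac)
qed

section \<open>Expansions at the cusp\<close>

text \<open>The local parameter q^(1/N) at infinity, where q = exp(2 pi i t).\<close>

definition cusp_param :: "nat \<Rightarrow> complex \<Rightarrow> complex" where
  "cusp_param N t = exp (2 * of_real pi * \<i> * t / of_nat N)"

text \<open>Expansions of the x_i in w = q^(1/8). Here \<open>nome\<close> is w^4, the sixth powers
  of the prefactors are w^(-1), w^(-1) and w^2, and 8 is the sixth power of sqrt 2.\<close>

definition weber_g0 :: "complex \<Rightarrow> complex" where
  "weber_g0 w = inverse w * (euler_phi (- (w ^ 4)) / euler_phi (w ^ 8)) ^ 6"
definition weber_g1 :: "complex \<Rightarrow> complex" where
  "weber_g1 w = zeta_root 8 ^ 3 * inverse w * (euler_phi (w ^ 4) / euler_phi (w ^ 8)) ^ 6"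
definition weber_g2 :: "complex \<Rightarrow> complex" where
  "weber_g2 w = inverse (zeta_root 8 ^ 3) * 8 * w ^ 2 * (euler_phi (w ^ 16) / euler_phi (w ^ 8)) ^ 6"

lemma weber_x_expansion:
  "weber_x0 t = weber_g0 (cusp_param 8 t)"
  "weber_x1 t = weber_g1 (cusp_param 8 t)"
  "weber_x2 t = weber_g2 (cusp_param 8 t)"
proof -
  have n: "nome t = cusp_param 8 t ^ 4" "nome t ^ 2 = cusp_param 8 t ^ 8" "nome t ^ 4 = cusp_param 8 t ^ 16"
    unfolding nome_def cusp_param_def exp_of_nat_mult[symmetric]
    by (rule arg_cong[of _ _ exp], simp)+
  have e1: "exp (- of_real pi * \<i> * t / 24) ^ 6 = inverse (cusp_param 8 t)"
    by (simp add: cusp_param_def flip: exp_of_nat_mult exp_minus)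
  have e2: "exp (of_real pi * \<i> * t / 12) ^ 6 = cusp_param 8 t ^ 2"
    by (simp add: cusp_param_def flip: exp_of_nat_mult exp_minus)
  have s: "complex_of_real (sqrt 2) ^ 6 = 8"
  proof -
    have "sqrt 2 ^ 6 = (sqrt 2 ^ 2) ^ 3" unfolding power_mult[symmetric] by simp
    hence "sqrt 2 ^ 6 = 8" by (simp del: power_mult_numeral)
    thus ?thesis by (metis of_real_numeral of_real_power)
  qed
  show "weber_x0 t = weber_g0 (cusp_param 8 t)"
    unfolding weber_x0_def weber_u0_def weber_f_conv weber_g0_def power_mult_distrib e1 n(2) by (simp add: n(1))
  show "weber_x1 t = weber_g1 (cusp_param 8 t)"
    unfolding weber_x1_def weber_u1_def weber_f1_conv weber_g1_def power_mult_distrib e1 n(2) zeta_root_values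
    by (simp add: n(1))
  show "weber_x2 t = weber_g2 (cusp_param 8 t)"
    unfolding weber_x2_def weber_u2_def weber_f2_conv weber_g2_def power_mult_distrib e2 n s zeta_root_values power_inverse
    by simp
qed

lemma euler_phi_power_analytic:
  assumes "k > 0" "norm c = 1"
  shows "(\<lambda>w. euler_phi (c * w ^ k)) analytic_on {0}"
proof -
  have "(\<lambda>w. euler_phi (c * w ^ k)) holomorphic_on ball 0 1"
    using assms by (intro euler_phi_holomorphic' holomorphic_intros)
      (auto simp: norm_mult norm_power power_less_one_iff)
  thus ?thesis
    using analytic_at by (metis centre_in_ball open_ball zero_less_one)
qed

lemma euler_phi_powers_analytic:
  "(\<lambda>w. euler_phi (- (w ^ 4))) analytic_on {0}" "(\<lambda>w. euler_phi (w ^ 4)) analytic_on {0}"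
  "(\<lambda>w. euler_phi (w ^ 8)) analytic_on {0}" "(\<lambda>w. euler_phi (w ^ 16)) analytic_on {0}"
  using euler_phi_power_analytic[of 4 "-1"] euler_phi_power_analytic[of 4 1]
    euler_phi_power_analytic[of 8 1] euler_phi_power_analytic[of 16 1] by simp_all

lemma weber_g_meromorphic:
  "weber_g0 meromorphic_on {0}" "weber_g1 meromorphic_on {0}" "weber_g2 meromorphic_on {0}"
  unfolding weber_g0_def weber_g1_def weber_g2_def
  by (intro meromorphic_intros analytic_on_imp_meromorphic_on euler_phi_powers_analytic)+

text \<open>
  Written with \<open>a = u\<^sub>0\<^sup>8\<close>, \<open>b = u\<^sub>1\<^sup>8\<close>, \<open>c = u\<^sub>2\<^sup>8\<close>, where \<open>a + b + c = 0\<close> and \<open>abc = 16\<close>, this is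
  \<open>- (ab + bc + ca)\<^sup>3 - 768\<close>, that is \<open>j - 768\<close> for Klein's invariant \<open>j\<close>.
\<close>
definition weber_j :: "complex \<Rightarrow> complex" where
  "weber_j t = - (weber_x0 t ^ 4 * weber_x1 t ^ 4 + weber_x1 t ^ 4 * weber_x2 t ^ 4 + weber_x2 t ^ 4 * weber_x0 t ^ 4)"

text \<open>The pole comes from -x0^4 x1^4 alone: its order is w^(-8) = q^(-1) and its coefficient
  -zeta_8^12 = 1. The other two products have order w^4, which multiplication by q turns into the
  \<open>w ^ 12\<close> of \<open>G\<close>.\<close>

lemma weber_j_expansion:
  obtains G where "G analytic_on {0}" "G 0 = 1"
    "\<And>t. weber_j t * cusp_param 1 t = G (cusp_param 8 t)"
proof -
  define A where "A = (\<lambda>w. (euler_phi (- (w ^ 4)) / euler_phi (w ^ 8)) ^ 6)"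
  define B where "B = (\<lambda>w. zeta_root 8 ^ 3 * (euler_phi (w ^ 4) / euler_phi (w ^ 8)) ^ 6)"
  define C where "C = (\<lambda>w. inverse (zeta_root 8 ^ 3) * 8 * (euler_phi (w ^ 16) / euler_phi (w ^ 8)) ^ 6)"
  define G where "G = (\<lambda>w. - (A w ^ 4 * B w ^ 4 + B w ^ 4 * C w ^ 4 * w ^ 12 + C w ^ 4 * A w ^ 4 * w ^ 12))"
  have an: "A analytic_on {0}" "B analytic_on {0}" "C analytic_on {0}"
    unfolding A_def B_def C_def
    by (intro analytic_intros euler_phi_powers_analytic; simp)+
  have "zeta_root 8 ^ 12 = (zeta_root 8 ^ 2) ^ 6" by (simp flip: power_mult)
  also have "\<dots> = -1" unfolding zeta_root_values by (simp add: eval_nat_numeral)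
  finally have "zeta_root 8 ^ 12 = -1" .
  hence G0: "G 0 = 1" by (simp add: G_def A_def B_def flip: power_mult)
  have g: "weber_g0 w = inverse w * A w" "weber_g1 w = inverse w * B w" "weber_g2 w = w ^ 2 * C w" for w
    by (simp_all add: weber_g0_def weber_g1_def weber_g2_def A_def B_def C_def)
  have "weber_j t * cusp_param 1 t = G (cusp_param 8 t)" for t
  proof -
    define w where "w = cusp_param 8 t"
    have w: "w \<noteq> 0" "cusp_param 1 t = w ^ 8"
      unfolding w_def cusp_param_def exp_of_nat_mult[symmetric] by (simp_all add: mult_ac)
    have wp: "inverse w ^ 4 * inverse w ^ 4 * w ^ 8 = 1" "inverse w ^ 4 * (w ^ 2) ^ 4 * w ^ 8 = w ^ 12"
      using w(1) by (simp_all add: field_simps flip: power_mult power_add)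
    have "weber_j t * cusp_param 1 t =
      - (A w ^ 4 * B w ^ 4 * (inverse w ^ 4 * inverse w ^ 4 * w ^ 8)
       + B w ^ 4 * C w ^ 4 * (inverse w ^ 4 * (w ^ 2) ^ 4 * w ^ 8)
       + C w ^ 4 * A w ^ 4 * (inverse w ^ 4 * (w ^ 2) ^ 4 * w ^ 8))"
      unfolding weber_j_def weber_x_expansion w(2) w_def[symmetric] g power_mult_distrib
      by (simp only: algebra_simps mult_minus_right)
    thus ?thesis unfolding wp w_def[symmetric] by (simp add: G_def)
  qed
  thus thesis using that[of G] G0 an unfolding G_def by (fastforce intro: analytic_intros)
qed

section \<open>The modular group\<close>

definition mat2 :: "int \<Rightarrow> int \<Rightarrow> int \<Rightarrow> int \<Rightarrow> int ^ 2 ^ 2" where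
  "mat2 a b c d = vector [vector [a, b], vector [c, d]]"

lemma mat2_nth [simp]:
  "mat2 a b c d $ 1 $ 1 = a" "mat2 a b c d $ 1 $ 2 = b"
  "mat2 a b c d $ 2 $ 1 = c" "mat2 a b c d $ 2 $ 2 = d"
  by (simp_all add: mat2_def)

lemma mat2_eta: "mat2 (A $ 1 $ 1) (A $ 1 $ 2) (A $ 2 $ 1) (A $ 2 $ 2) = A"
  by (simp add: vec_eq_iff forall_2)

lemma mat2_mult:
  "mat2 a b c d ** mat2 a' b' c' d' =
     mat2 (a * a' + b * c') (a * b' + b * d') (c * a' + d * c') (c * b' + d * d')"
  by (simp add: vec_eq_iff forall_2 matrix_matrix_mult_def sum_2)

lemma uminus_mat2: "- mat2 a b c d = mat2 (- a) (- b) (- c) (- d)"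
  by (simp add: vec_eq_iff forall_2)

lemma mat_1_mat2: "mat 1 = mat2 1 0 0 1"
  by (simp add: vec_eq_iff forall_2 mat_def)

abbreviation SL2 :: "(int ^ 2 ^ 2) set" where "SL2 \<equiv> carrier SL2Z"

lemma SL2_iff: "A \<in> SL2 \<longleftrightarrow> A $ 1 $ 1 * A $ 2 $ 2 - A $ 1 $ 2 * A $ 2 $ 1 = 1"
  by (simp add: SL2Z_def det_2)

lemma mat2_in_SL2: "mat2 a b c d \<in> SL2 \<longleftrightarrow> a * d - b * c = 1"
  by (simp add: SL2_iff)

lemma SL2_cases:
  assumes "A \<in> SL2"
  obtains a b c d where "A = mat2 a b c d" "a * d - b * c = 1"
  using assms mat2_eta[of A] by (metis SL2_iff)

lemma SL2_mult: "A \<in> SL2 \<Longrightarrow> B \<in> SL2 \<Longrightarrow> A ** B \<in> SL2"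
  by (simp add: SL2Z_def det_mul)

lemma SL2_one: "mat 1 \<in> SL2"
  by (simp add: SL2Z_def)

definition adj2 :: "int ^ 2 ^ 2 \<Rightarrow> int ^ 2 ^ 2" where
  "adj2 A = mat2 (A $ 2 $ 2) (- A $ 1 $ 2) (- A $ 2 $ 1) (A $ 1 $ 1)"

lemma adj2_mat2 [simp]: "adj2 (mat2 a b c d) = mat2 d (- b) (- c) a"
  by (simp add: adj2_def)

lemma SL2_adj: "A \<in> SL2 \<Longrightarrow> adj2 A \<in> SL2"
  by (erule SL2_cases) (simp add: mat2_in_SL2 mult.commute)

lemma SL2_adj_mult: "A \<in> SL2 \<Longrightarrow> A ** adj2 A = mat 1" "A \<in> SL2 \<Longrightarrow> adj2 A ** A = mat 1"
  by (erule SL2_cases; simp add: mat2_mult mat_1_mat2 mult.commute)+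

lemma moebius_mat2: "moebius (mat2 a b c d) t = (of_int a * t + of_int b) / (of_int c * t + of_int d)"
  by (simp add: moebius_def)

lemma moebius_one [simp]: "moebius (mat 1) t = t"
  by (simp add: mat_1_mat2 moebius_mat2)

lemma moebius_uminus: "moebius (- A) t = moebius A t"
proof -
  have "moebius (- A) t = (- (of_int (A $ 1 $ 1) * t + of_int (A $ 1 $ 2))) / (- (of_int (A $ 2 $ 1) * t + of_int (A $ 2 $ 2)))"
    by (simp add: moebius_def)
  thus ?thesis unfolding minus_divide_divide by (simp add: moebius_def)
qed

lemma moebius_denom_nonzero:
  assumes "Im t > 0" "c \<noteq> 0 \<or> d \<noteq> 0"
  shows "of_int c * t + of_int d \<noteq> (0::complex)"
  using assms by (auto simp: complex_eq_iff)

lemma Im_moebius: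
  assumes "a * d - b * c = 1"
  shows "Im (moebius (mat2 a b c d) t) = Im t / norm (of_int c * t + of_int d) ^ 2"
proof -
  have "Im (moebius (mat2 a b c d) t) = (of_int a * of_int d - of_int b * of_int c) * Im t / norm (of_int c * t + of_int d) ^ 2"
    unfolding moebius_mat2 Im_divide cmod_power2 by (simp add: algebra_simps)
  also have "of_int a * of_int d - of_int b * of_int c = (1::real)"
    using assms by (metis of_int_1 of_int_diff of_int_mult)
  finally show ?thesis by simp
qed

lemma moebius_in_upper_half_plane:
  assumes "A \<in> SL2" "Im t > 0"
  shows "Im (moebius A t) > 0"
  using assms(1)
proof (rule SL2_cases)
  fix a b c d assume A: "A = mat2 a b c d" "a * d - b * c = 1"
  hence "c \<noteq> 0 \<or> d \<noteq> 0" by auto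
  from moebius_denom_nonzero[OF assms(2) this] show ?thesis
    unfolding A(1) Im_moebius[OF A(2)] using assms(2) by simp
qed

lemma moebius_mult:
  assumes "A \<in> SL2" "B \<in> SL2" "Im t > 0"
  shows "moebius (A ** B) t = moebius A (moebius B t)"
proof -
  obtain a b c d where A: "A = mat2 a b c d" "a * d - b * c = 1" using assms(1) by (rule SL2_cases)
  obtain a' b' c' d' where B: "B = mat2 a' b' c' d'" "a' * d' - b' * c' = 1" using assms(2) by (rule SL2_cases)
  have "c' \<noteq> 0 \<or> d' \<noteq> 0" using B by auto
  hence nz: "of_int c' * t + of_int d' \<noteq> 0" using assms(3) by (intro moebius_denom_nonzero)
  define n where "n = of_int a' * t + of_int b'"
  define m where "m = of_int c' * t + of_int d'"
  have m: "m \<noteq> 0" using nz by (simp add: m_def)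
  have "moebius A (moebius B t) = ((of_int a * n + of_int b * m) / m) / ((of_int c * n + of_int d * m) / m)"
    using m by (simp add: A B moebius_mat2 n_def[symmetric] m_def[symmetric] add_divide_distrib)
  also have "\<dots> = (of_int a * n + of_int b * m) / (of_int c * n + of_int d * m)"
    using m by simp
  also have "\<dots> = moebius (A ** B) t"
    by (simp add: A B mat2_mult moebius_mat2 n_def m_def algebra_simps)
  finally show ?thesis ..
qed

lemma moebius_adj:
  assumes "A \<in> SL2" "Im t > 0"
  shows "moebius (adj2 A) (moebius A t) = t" "moebius A (moebius (adj2 A) t) = t"
  using moebius_mult[of "adj2 A" A t] moebius_mult[of A "adj2 A" t] assms SL2_adj SL2_adj_mult by auto

lemma moebius_holomorphic:
  assumes "A \<in> SL2"
  shows "moebius A holomorphic_on upper_half_plane"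
  using assms
proof (rule SL2_cases)
  fix a b c d assume A: "A = mat2 a b c d" "a * d - b * c = 1"
  hence "c \<noteq> 0 \<or> d \<noteq> 0" by auto
  thus ?thesis
    unfolding A moebius_mat2[abs_def] using moebius_denom_nonzero by (intro holomorphic_intros) auto
qed

abbreviation "matS \<equiv> mat2 0 (- 1) 1 0"
abbreviation "matT \<equiv> mat2 1 1 0 1"

lemma matS_SL2: "matS \<in> SL2" and matT_SL2: "matT \<in> SL2"
  by (simp_all add: mat2_in_SL2)

lemma moebius_matS: "moebius matS t = - 1 / t" and moebius_matT: "moebius matT t = t + 1"
  by (simp_all add: moebius_mat2)

section \<open>The action on the Weber functions\<close>

lemma powi_ii_cong:
  assumes "m = n + 4 * k"
  shows "\<i> powi m = \<i> powi n"
proof -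
  have "\<i> powi (4 * k) = (\<i> powi 4) powi k" by (simp add: power_int_mult)
  also have "\<i> powi 4 = 1" by (simp add: power_int_def nat_eq_iff eval_nat_numeral) 
  finally show ?thesis using assms by (simp add: power_int_add)
qed

lemma powi_ii_eq_1:
  assumes "\<i> powi m = 1"
  shows "4 dvd m"
proof -
  have m: "m = m mod 4 + 4 * (m div 4)" by simp
  have "\<i> powi (m mod 4) = 1" using powi_ii_cong[OF m] assms by simp
  moreover have "m mod 4 \<in> {0, 1, 2, 3}" by auto
  ultimately have "m mod 4 = 0"
    by (auto simp: power_int_def nat_eq_iff eval_nat_numeral complex_eq_iff)
  thus ?thesis by auto
qed

lemma shift_law:
  assumes "\<And>t. Im t > 0 \<Longrightarrow> f (t + 2) = \<i> powi m * f t" "Im t > 0"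
  shows "f (t + of_int (2 * k)) = \<i> powi (m * k) * f t"
proof (induction k rule: int_induct[of _ 0])
  case (step1 k)
  have "f (t + of_int (2 * (k + 1))) = f (t + of_int (2 * k) + 2)"
    by (simp add: algebra_simps)
  also have "\<dots> = \<i> powi m * f (t + of_int (2 * k))"
    using assms by (intro assms) auto
  finally show ?case using step1 by (simp add: power_int_add distrib_left)
next
  case (step2 k)
  have "f (t + of_int (2 * k)) = f (t + of_int (2 * (k - 1)) + 2)"
    by (simp add: algebra_simps)
  also have "\<dots> = \<i> powi m * f (t + of_int (2 * (k - 1)))"
    using assms by (intro assms) auto
  finally have "\<i> powi m * f (t + of_int (2 * (k - 1))) = \<i> powi m * (\<i> powi (m * (k - 1)) * f t)"
    using step2 by (simp add: power_int_add[symmetric] algebra_simps)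
  thus ?case by simp
qed simp

lemma weber_x_shift:
  assumes "Im t > 0"
  shows "weber_x0 (t + of_int (2 * k)) = \<i> powi (- k) * weber_x0 t"
    "weber_x1 (t + of_int (2 * k)) = \<i> powi (- k) * weber_x1 t"
    "weber_x2 (t + of_int (2 * k)) = \<i> powi (2 * k) * weber_x2 t"
proof -
  have 2: "weber_x0 (t + 2) = \<i> powi (- 1) * weber_x0 t" "weber_x1 (t + 2) = \<i> powi (- 1) * weber_x1 t"
    "weber_x2 (t + 2) = \<i> powi 2 * weber_x2 t" for t
    using weber_x_translation[of t] weber_x_translation[of "t + 1"] by (simp_all add: add.assoc power_int_minus)
  show "weber_x0 (t + of_int (2 * k)) = \<i> powi (- k) * weber_x0 t"
    using shift_law[of weber_x0 "-1", OF 2(1) assms, of k] by simp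
  show "weber_x1 (t + of_int (2 * k)) = \<i> powi (- k) * weber_x1 t"
    using shift_law[of weber_x1 "-1", OF 2(2) assms, of k] by simp
  show "weber_x2 (t + of_int (2 * k)) = \<i> powi (2 * k) * weber_x2 t"
    using shift_law[of weber_x2 2, OF 2(3) assms, of k] by simp
qed

text \<open>The substitution is the inversion, then a translation by -2k, then the inversion. The
  multipliers of the shift are conjugated accordingly: those of x1 and x2 trade places and the
  factors i and -i cancel.\<close>

lemma weber_x_lower_shift:
  assumes "Im t > 0"
  shows "weber_x0 (t / (of_int (2 * k) * t + 1)) = \<i> powi k * weber_x0 t"
    "weber_x1 (t / (of_int (2 * k) * t + 1)) = \<i> powi (2 * k) * weber_x1 t"
    "weber_x2 (t / (of_int (2 * k) * t + 1)) = \<i> powi k * weber_x2 t"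
proof -
  define s where "s = - 1 / t"
  have s: "Im s > 0" using Im_minus_inverse_pos[OF assms] by (simp add: s_def)
  hence s': "Im (s + of_int (2 * (- k))) > 0" by simp
  have "t \<noteq> 0" using assms by auto
  hence "s + of_int (2 * (- k)) = - ((of_int (2 * k) * t + 1) / t)"
    by (simp add: s_def field_simps)
  hence e: "t / (of_int (2 * k) * t + 1) = - 1 / (s + of_int (2 * (- k)))"
    by simp
  note inv = weber_x_inversion[OF s'] weber_x_inversion[OF assms] weber_x_shift[OF s, of "- k"]
  show "weber_x0 (t / (of_int (2 * k) * t + 1)) = \<i> powi k * weber_x0 t"
    unfolding e inv unfolding s_def inv by simp
  show "weber_x1 (t / (of_int (2 * k) * t + 1)) = \<i> powi (2 * k) * weber_x1 t"
  proof -
    have "- \<i> * (p * (\<i> * x)) = p * x" for p x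
      using mult.left_commute[of \<i> p "\<i> * x"] by simp
    thus ?thesis
      unfolding e inv unfolding s_def inv using powi_ii_cong[of "2 * k" "2 * - k" k] by simp
  qed
  show "weber_x2 (t / (of_int (2 * k) * t + 1)) = \<i> powi k * weber_x2 t"
  proof -
    have "\<i> * (p * (- \<i> * x)) = p * x" for p x
      using mult.left_commute[of \<i> p "- \<i> * x"] by simp
    thus ?thesis unfolding e inv unfolding s_def inv by simp
  qed
qed

text \<open>\<open>\<gamma>\<close> counts lower and \<open>\<beta>\<close> upper unipotent
  generators modulo 4. The three linear combinations are read off from the laws for t/(2t+1) and t +
  2.\<close>

definition weber_law :: "int ^ 2 ^ 2 \<Rightarrow> int \<Rightarrow> int \<Rightarrow> bool" where
  "weber_law A \<gamma> \<beta> \<longleftrightarrow> (\<forall>t\<in>upper_half_plane.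
     weber_x0 (moebius A t) = \<i> powi (\<gamma> - \<beta>) * weber_x0 t \<and>
     weber_x1 (moebius A t) = \<i> powi (2 * \<gamma> - \<beta>) * weber_x1 t \<and>
     weber_x2 (moebius A t) = \<i> powi (\<gamma> + 2 * \<beta>) * weber_x2 t)"

lemma weber_law_cong:
  assumes "weber_law A \<gamma> \<beta>" "\<gamma>' = \<gamma> + 4 * k" "\<beta>' = \<beta> + 4 * l"
  shows "weber_law A \<gamma>' \<beta>'"
  using assms(1) powi_ii_cong[of "\<gamma>' - \<beta>'" "\<gamma> - \<beta>" "k - l"] powi_ii_cong[of "2 * \<gamma>' - \<beta>'" "2 * \<gamma> - \<beta>" "2 * k - l"]
    powi_ii_cong[of "\<gamma>' + 2 * \<beta>'" "\<gamma> + 2 * \<beta>" "k + 2 * l"]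
  by (simp add: weber_law_def assms(2,3))

lemma weber_law_mult:
  assumes "weber_law A \<gamma> \<beta>" "weber_law B \<gamma>' \<beta>'" "A \<in> SL2" "B \<in> SL2"
  shows "weber_law (A ** B) (\<gamma> + \<gamma>') (\<beta> + \<beta>')"
  unfolding weber_law_def
proof safe
  fix t assume t: "0 < Im t"
  note m = moebius_mult[OF assms(3,4) t]
  have B: "Im (moebius B t) > 0" using assms(4) t by (rule moebius_in_upper_half_plane)
  have i: "\<i> powi a * (\<i> powi b * z) = \<i> powi (a + b) * z" for a b z
    by (simp add: power_int_add)
  have e: "\<gamma> - \<beta> + (\<gamma>' - \<beta>') = \<gamma> + \<gamma>' - (\<beta> + \<beta>')" "2 * \<gamma> - \<beta> + (2 * \<gamma>' - \<beta>') = 2 * (\<gamma> + \<gamma>') - (\<beta> + \<beta>')"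
    "\<gamma> + 2 * \<beta> + (\<gamma>' + 2 * \<beta>') = \<gamma> + \<gamma>' + 2 * (\<beta> + \<beta>')" by simp_all
  show "weber_x0 (moebius (A ** B) t) = \<i> powi (\<gamma> + \<gamma>' - (\<beta> + \<beta>')) * weber_x0 t"
    "weber_x1 (moebius (A ** B) t) = \<i> powi (2 * (\<gamma> + \<gamma>') - (\<beta> + \<beta>')) * weber_x1 t"
    "weber_x2 (moebius (A ** B) t) = \<i> powi (\<gamma> + \<gamma>' + 2 * (\<beta> + \<beta>')) * weber_x2 t"
    using assms(1,2) t B unfolding weber_law_def m
    by (simp_all add: i e)
qed

lemma weber_law_upper: "weber_law (mat2 1 (2 * k) 0 1) 0 k"
  using weber_x_shift[of _ k] by (simp add: weber_law_def moebius_mat2)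

lemma weber_law_lower: "weber_law (mat2 1 0 (2 * k) 1) k 0"
  using weber_x_lower_shift[of _ k] by (simp add: weber_law_def moebius_mat2)

text \<open>
  The exponents are additive modulo 4 on \<open>\<Gamma>(2)\<close>, so the Euclidean algorithm with even quotients
  reduces everything to the two generators.
\<close>
lemma weber_law_Gamma2:
  assumes "a * d - 4 * B * C = 1"
  shows "weber_law (mat2 a (2 * B) (2 * C) d) (a * C) (B * d)"
  using assms
proof (induction "nat (\<bar>a\<bar> + \<bar>2 * C\<bar>)" arbitrary: a B C d rule: less_induct)
  case less
  have "a * d = 1 + 2 * (2 * B * C)" using less.prems by simp
  hence "odd (a * d)" by simp
  hence odd: "odd a" "odd d" by auto
  obtain m where m: "a = 2 * m + 1" using odd(1) by (rule oddE)
  obtain n where n: "d = 2 * n + 1" using odd(2) by (rule oddE)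
  \<comment> \<open>Since \<open>a\<close> is odd there is no tie, so in every case with
    \<open>C\<close> nonzero one of the two row operations strictly decreases the measure.\<close>
  have ne: "\<bar>a\<bar> \<noteq> \<bar>2 * C\<bar>" using odd(1) by presburger
  consider "C = 0" | "C \<noteq> 0" "\<bar>2 * C\<bar> < \<bar>a\<bar>" | "\<bar>a\<bar> < \<bar>2 * C\<bar>"
    using ne by linarith
  thus ?case
  proof cases
    case 1
    hence "a * d = 1" using less.prems by simp
    hence ad: "a = d" "d = 1 \<or> d = -1" by (auto simp: zmult_eq_1_iff)
    \<comment> \<open>For \<open>C = 0\<close> the matrix is this upper unipotent up to a sign; the
      factor \<open>d\<close> in the entry accounts for the sign.\<close>
    have "weber_law (mat2 1 (2 * (B * d)) 0 1) 0 (B * d)" by (rule weber_law_upper)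
    thus ?thesis
      using ad moebius_uminus[of "mat2 1 (2 * (B * d)) 0 1"]
      by (auto simp: 1 weber_law_def uminus_mat2)
  next
    case 2
    \<comment> \<open>Adding \<open>2 * k\<close> times the second row changes \<open>a\<close> by
      4|C| towards zero. As 4|C| < 2|a|, the absolute value drops even if the sign changes.\<close>
    define k where "k = - sgn (a * C)"
    have "\<bar>a + 4 * k * C\<bar> < \<bar>a\<bar>"
      using 2 odd(1) by (auto simp: k_def sgn_if zero_less_mult_iff mult_less_0_iff abs_if split: if_splits)
    moreover have eq: "(a + 4 * k * C) * d - 4 * (B + k * d) * C = 1"
      using less.prems by (simp add: algebra_simps)
    ultimately have IH: "weber_law (mat2 (a + 4 * k * C) (2 * (B + k * d)) (2 * C) d) ((a + 4 * k * C) * C) ((B + k * d) * d)"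
      by (intro less.hyps) auto
    have "weber_law (mat2 1 (2 * (- k)) 0 1 ** mat2 (a + 4 * k * C) (2 * (B + k * d)) (2 * C) d)
        (0 + (a + 4 * k * C) * C) (- k + (B + k * d) * d)"
      using weber_law_mult[OF weber_law_upper[of "- k"] IH] eq by (simp add: mat2_in_SL2 algebra_simps)
    hence "weber_law (mat2 a (2 * B) (2 * C) d) (0 + (a + 4 * k * C) * C) (- k + (B + k * d) * d)"
      by (simp add: mat2_mult algebra_simps)
    thus ?thesis
      \<comment> \<open>The exponents agree only modulo 4: \<open>- k + (B + k * d) * d\<close> is
        \<open>B * d + k * (d^2 - 1)\<close>, and with d = 2n + 1 the last factor is 4(n^2 +
        n).\<close>
      by (rule weber_law_cong[where k = "- (k * C * C)" and l = "- k * (n * n + n)"]) (simp_all add: n algebra_simps)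
  next
    case 3
    define k where "k = - sgn (a * C)"
    have "\<bar>2 * (C + k * a)\<bar> < \<bar>2 * C\<bar>"
      using 3 odd(1) by (auto simp: k_def sgn_if zero_less_mult_iff mult_less_0_iff abs_if split: if_splits)
    moreover have eq: "a * (d + 4 * k * B) - 4 * B * (C + k * a) = 1"
      using less.prems by (simp add: algebra_simps)
    ultimately have IH: "weber_law (mat2 a (2 * B) (2 * (C + k * a)) (d + 4 * k * B)) (a * (C + k * a)) (B * (d + 4 * k * B))"
      by (intro less.hyps) auto
    have "weber_law (mat2 1 0 (2 * (- k)) 1 ** mat2 a (2 * B) (2 * (C + k * a)) (d + 4 * k * B))
        (- k + a * (C + k * a)) (0 + B * (d + 4 * k * B))"
      using weber_law_mult[OF weber_law_lower[of "- k"] IH] eq by (simp add: mat2_in_SL2 algebra_simps)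
    hence "weber_law (mat2 a (2 * B) (2 * C) d) (- k + a * (C + k * a)) (0 + B * (d + 4 * k * B))"
      by (simp add: mat2_mult algebra_simps)
    thus ?thesis
      by (rule weber_law_cong[where l = "- (k * B * B)" and k = "- k * (m * m + m)"]) (simp_all add: m algebra_simps)
  qed
qed

text \<open>The principal congruence subgroup of level 2: determinant one forces the diagonal to be
  odd.\<close>

definition Gamma2 :: "(int ^ 2 ^ 2) set" where
  "Gamma2 = {A \<in> SL2. even (A $ 1 $ 2) \<and> even (A $ 2 $ 1)}"

lemma Gamma2_weber_law:
  assumes "A \<in> Gamma2"
  shows "weber_law A (A $ 1 $ 1 * (A $ 2 $ 1 div 2)) (A $ 1 $ 2 div 2 * A $ 2 $ 2)"
proof -
  obtain B C where BC: "A $ 1 $ 2 = 2 * B" "A $ 2 $ 1 = 2 * C"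
    using assms by (auto simp: Gamma2_def elim!: evenE)
  hence "A $ 1 $ 1 * A $ 2 $ 2 - 4 * B * C = 1"
    using assms by (simp add: Gamma2_def SL2_iff)
  from weber_law_Gamma2[OF this] show ?thesis
    using mat2_eta[of A] by (simp add: BC)
qed

lemma Gamma2_lawE:
  assumes "A \<in> Gamma2"
  obtains c0 c1 c2 where "c0 ^ 4 = 1" "c1 ^ 4 = 1" "c2 ^ 4 = 1"
    "\<forall>t. Im t > 0 \<longrightarrow> weber_x0 (moebius A t) = c0 * weber_x0 t"
    "\<forall>t. Im t > 0 \<longrightarrow> weber_x1 (moebius A t) = c1 * weber_x1 t"
    "\<forall>t. Im t > 0 \<longrightarrow> weber_x2 (moebius A t) = c2 * weber_x2 t"
proof -
  have "(\<i> powi m) ^ 4 = 1" for m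
    using powi_ii_cong[of "m * 4" 0 m] by (simp add: power_int_mult)
  thus thesis
    using that Gamma2_weber_law[OF assms] unfolding weber_law_def by blast
qed

text \<open>The six representatives realize the six elements of SL2(Z/2). The disjunct for
  \<open>mat 1\<close> also records that the trivial representative is used only for elements of
  Gamma(2), which is needed to recognize the identity permutation later.\<close>

lemma SL2_Gamma2_decomposition:
  assumes "A \<in> SL2"
  obtains G R where "G \<in> Gamma2" "R \<in> SL2" "A = G ** R" "(R = mat 1 \<and> A \<in> Gamma2) \<or>
    R \<in> {matS, matT, matT ** matS, matS ** matT, matS ** matT ** matS}"
proof -
  note result = that
  obtain a b c d where A: "A = mat2 a b c d" "a * d - b * c = 1" using assms by (rule SL2_cases)
  have R: "mat 1 \<in> SL2" "matS \<in> SL2" "matT \<in> SL2" "matT ** matS \<in> SL2" "matS ** matT \<in> SL2" "matS ** matT ** matS \<in> SL2"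
    by (simp_all add: mat2_mult mat2_in_SL2 SL2_one)
  have par: "odd (a * d - b * c)" using A by simp
  have *: thesis if "R \<in> SL2" "A ** adj2 R \<in> Gamma2" "(R = mat 1 \<and> A \<in> Gamma2) \<or>
    R \<in> {matS, matT, matT ** matS, matS ** matT, matS ** matT ** matS}" for R
  proof (rule result[of "A ** adj2 R" R])
    show "A = (A ** adj2 R) ** R"
      using SL2_adj_mult(2)[OF that(1)] by (simp flip: matrix_mul_assoc)
  qed (use that in auto)
  have G: "mat2 a' b' c' d' \<in> Gamma2 \<longleftrightarrow> a' * d' - b' * c' = 1 \<and> even b' \<and> even c'" for a' b' c' d'
    by (auto simp: Gamma2_def mat2_in_SL2)
  \<comment> \<open>These are the six parity patterns of an odd determinant, that is, the invertible
    matrices modulo 2.\<close>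
  consider "even b" "even c" | "even a" "even d" | "odd a" "odd b" "even c" "odd d" | "odd a" "even b" "odd c" "odd d"
    | "odd a" "odd b" "odd c" "even d" | "even a" "odd b" "odd c" "odd d"
    using par by auto
  thus thesis
  proof cases
    case 1 thus ?thesis using *[of "mat 1"] R A by (simp add: mat2_mult mat_1_mat2 G)
  next
    case 2 thus ?thesis using *[of matS] R A by (simp add: mat2_mult G algebra_simps)
  next
    case 3 thus ?thesis using *[of matT] R A by (simp add: mat2_mult G algebra_simps)
  next
    case 4 thus ?thesis using *[of "matS ** matT ** matS"] R A by (simp add: mat2_mult G algebra_simps)
  next
    case 5 thus ?thesis using *[of "matT ** matS"] R A by (simp add: mat2_mult G algebra_simps)
  next
    case 6 thus ?thesis using *[of "matS ** matT"] R A by (simp add: mat2_mult G algebra_simps)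
  qed
qed

section \<open>Permutation of the three functions by the whole modular group\<close>

lemma weber_x_matS:
  assumes "Im t > 0"
  shows "weber_x0 (moebius matS t) = weber_x0 t" "weber_x1 (moebius matS t) = - \<i> * weber_x2 t"
    "weber_x2 (moebius matS t) = \<i> * weber_x1 t"
  using weber_x_inversion[OF assms] by (simp_all add: moebius_matS)

lemma weber_x_matT:
  shows "weber_x0 (moebius matT t) = - weber_x1 t" "weber_x1 (moebius matT t) = \<i> * weber_x0 t"
    "weber_x2 (moebius matT t) = \<i> * weber_x2 t"
  using weber_x_translation[of t] by (simp_all add: moebius_matT)

text \<open>Proportional functions would have equal multipliers. On (x0, x1, x2) these are (-i, -i,
  -1) for t + 2 and (i, -1, i) for t/(2t+1), so each pair is told apart by one of the two, evaluated
  at i.\<close>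

lemma weber_x_not_proportional:
  assumes "f \<in> {weber_x0, weber_x1, weber_x2}" "g \<in> {weber_x0, weber_x1, weber_x2}" "f \<noteq> g"
  obtains t where "Im t > 0" "f t \<noteq> c * g t"
proof (rule ccontr)
  assume "\<not> thesis"
  hence eq: "f t = c * g t" if "Im t > 0" for t using that \<open>\<And>t. 0 < Im t \<Longrightarrow> f t \<noteq> c * g t \<Longrightarrow> thesis\<close> by blast
  have i: "Im \<i> > 0" "Im (\<i> + 2) > 0" "Im (\<i> / (2 * \<i> + 1)) > 0"
    by (simp_all add: Im_divide power2_eq_square)
  have nz: "f \<i> \<noteq> 0" "g \<i> \<noteq> 0" using assms weber_x_nonzero[OF i(1)] by auto
  have c: "c \<noteq> 0" using nz eq[OF i(1)] by auto
  have 1: "weber_x0 (\<i> + 2) = - \<i> * weber_x0 \<i>" "weber_x1 (\<i> + 2) = - \<i> * weber_x1 \<i>" "weber_x2 (\<i> + 2) = - weber_x2 \<i>"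
    using weber_x_shift[OF i(1), of 1] by (simp_all add: power_int_minus)
  have 2: "weber_x0 (\<i> / (2 * \<i> + 1)) = \<i> * weber_x0 \<i>" "weber_x1 (\<i> / (2 * \<i> + 1)) = - weber_x1 \<i>"
    "weber_x2 (\<i> / (2 * \<i> + 1)) = \<i> * weber_x2 \<i>"
    using weber_x_lower_shift[OF i(1), of 1] by simp_all
  have key: "a = a'" if "Im t > 0" "f t = a * f \<i>" "g t = a' * g \<i>" for a a' t
    using that eq[OF i(1)] eq[OF that(1)] nz c by simp
  have "(f, g) \<in> {(weber_x0, weber_x1), (weber_x1, weber_x0), (weber_x0, weber_x2), (weber_x2, weber_x0),
      (weber_x1, weber_x2), (weber_x2, weber_x1)}"
    using assms by blast
  thus False
    using key[OF i(2), of "- \<i>" "-1"] key[OF i(2), of "-1" "- \<i>"]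
      key[OF i(3), of \<i> "-1"] key[OF i(3), of "-1" \<i>] 1 2
    by (auto simp: complex_eq_iff)
qed

lemma weber_x_distinct: "weber_x0 \<noteq> weber_x1" "weber_x0 \<noteq> weber_x2" "weber_x1 \<noteq> weber_x2"
proof -
  have i: "Im \<i> > 0" by simp
  have 1: "weber_x0 (\<i> + 2) = - \<i> * weber_x0 \<i>" "weber_x1 (\<i> + 2) = - \<i> * weber_x1 \<i>" "weber_x2 (\<i> + 2) = - weber_x2 \<i>"
    using weber_x_shift[OF i, of 1] by (simp_all add: power_int_minus)
  have 2: "weber_x0 (\<i> / (2 * \<i> + 1)) = \<i> * weber_x0 \<i>" "weber_x1 (\<i> / (2 * \<i> + 1)) = - weber_x1 \<i>"
    using weber_x_lower_shift[OF i, of 1] by simp_all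
  have key: "a = a'" if "f = g" "f t = a * f \<i>" "g t = a' * g \<i>" "f \<i> \<noteq> 0"
    for a a' t and f g :: "complex \<Rightarrow> complex"
    using that by simp
  show "weber_x0 \<noteq> weber_x1"
    using key[where f = weber_x0 and g = weber_x1 and t = "\<i> / (2 * \<i> + 1)" and a = \<i> and a' = "-1"] 2 weber_x_nonzero[OF i] by (auto simp: complex_eq_iff)
  show "weber_x0 \<noteq> weber_x2"
    using key[where f = weber_x0 and g = weber_x2 and t = "\<i> + 2" and a = "- \<i>" and a' = "-1"] 1 weber_x_nonzero[OF i] by (auto simp: complex_eq_iff)
  show "weber_x1 \<noteq> weber_x2"
    using key[where f = weber_x1 and g = weber_x2 and t = "\<i> + 2" and a = "- \<i>" and a' = "-1"] 1 weber_x_nonzero[OF i] by (auto simp: complex_eq_iff)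
qed

text \<open>The last clause ties the identity permutation to Gamma(2); through it the kernel
  computation is reduced to the explicit characters.\<close>

definition weber_permutes where
  "weber_permutes A f0 f1 f2 c0 c1 c2 \<longleftrightarrow>
    (\<forall>t. Im t > 0 \<longrightarrow> weber_x0 (moebius A t) = c0 * f0 t) \<and>
    (\<forall>t. Im t > 0 \<longrightarrow> weber_x1 (moebius A t) = c1 * f1 t) \<and>
    (\<forall>t. Im t > 0 \<longrightarrow> weber_x2 (moebius A t) = c2 * f2 t) \<and>
    c0 ^ 4 = 1 \<and> c1 ^ 4 = 1 \<and> c2 ^ 4 = 1 \<and>
    (f0, f1, f2) \<in> {(weber_x0, weber_x1, weber_x2), (weber_x0, weber_x2, weber_x1), (weber_x1, weber_x0, weber_x2),
        (weber_x1, weber_x2, weber_x0), (weber_x2, weber_x0, weber_x1), (weber_x2, weber_x1, weber_x0)} \<and>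
    ((f0, f1, f2) = (weber_x0, weber_x1, weber_x2) \<longrightarrow> A \<in> Gamma2)"

lemma weber_permutesD:
  assumes "weber_permutes A f0 f1 f2 c0 c1 c2"
  shows
    "\<forall>t. Im t > 0 \<longrightarrow> weber_x0 (moebius A t) = c0 * f0 t"
    "\<forall>t. Im t > 0 \<longrightarrow> weber_x1 (moebius A t) = c1 * f1 t"
    "\<forall>t. Im t > 0 \<longrightarrow> weber_x2 (moebius A t) = c2 * f2 t"
    "c0 ^ 4 = 1" "c1 ^ 4 = 1" "c2 ^ 4 = 1"
    "(f0, f1, f2) \<in> {(weber_x0, weber_x1, weber_x2), (weber_x0, weber_x2, weber_x1), (weber_x1, weber_x0, weber_x2),
        (weber_x1, weber_x2, weber_x0), (weber_x2, weber_x0, weber_x1), (weber_x2, weber_x1, weber_x0)}"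
    "(f0, f1, f2) = (weber_x0, weber_x1, weber_x2) \<longrightarrow> A \<in> Gamma2"
  using assms unfolding weber_permutes_def by simp_all

text \<open>In A = G R the factor from Gamma(2) contributes only scalars, while the representative R
  determines the permutation.\<close>

lemma weber_x_SL2:
  assumes "A \<in> SL2"
  obtains f0 f1 f2 c0 c1 c2 where "weber_permutes A f0 f1 f2 c0 c1 c2"
proof -
  note result = that
  obtain G R where GR: "G \<in> Gamma2" "R \<in> SL2" "A = G ** R" and R: "(R = mat 1 \<and> A \<in> Gamma2) \<or>
    R \<in> {matS, matT, matT ** matS, matS ** matT, matS ** matT ** matS}"
    using assms by (rule SL2_Gamma2_decomposition)
  have G: "G \<in> SL2" using GR by (simp add: Gamma2_def)
  obtain k0 k1 k2 where k: "k0 ^ 4 = 1" "k1 ^ 4 = 1" "k2 ^ 4 = 1"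
    "\<forall>t. Im t > 0 \<longrightarrow> weber_x0 (moebius G t) = k0 * weber_x0 t"
    "\<forall>t. Im t > 0 \<longrightarrow> weber_x1 (moebius G t) = k1 * weber_x1 t"
    "\<forall>t. Im t > 0 \<longrightarrow> weber_x2 (moebius G t) = k2 * weber_x2 t"
    using GR(1) by (rule Gamma2_lawE)
  have A: "weber_x0 (moebius A t) = k0 * weber_x0 (moebius R t)" "weber_x1 (moebius A t) = k1 * weber_x1 (moebius R t)"
    "weber_x2 (moebius A t) = k2 * weber_x2 (moebius R t)" if "Im t > 0" for t
    using k moebius_in_upper_half_plane[OF GR(2) that] by (simp_all add: GR(3) moebius_mult[OF G GR(2) that])
  have S: "Im (moebius matS t) > 0" and T: "Im (moebius matT t) > 0" if "Im t > 0" for t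
    using that by (auto intro!: moebius_in_upper_half_plane matS_SL2 matT_SL2)
  have ST: "moebius (matS ** matT) t = moebius matS (moebius matT t)"
    "moebius (matT ** matS) t = moebius matT (moebius matS t)"
    "moebius (matS ** matT ** matS) t = moebius matS (moebius matT (moebius matS t))" if "Im t > 0" for t
    using that matS_SL2 matT_SL2 S T SL2_mult by (simp_all add: moebius_mult)
  have *: thesis if "(\<forall>t. Im t > 0 \<longrightarrow> weber_x0 (moebius R t) = c0 * f0 t \<and> weber_x1 (moebius R t) = c1 * f1 t \<and>
      weber_x2 (moebius R t) = c2 * f2 t)" "c0 ^ 4 = 1" "c1 ^ 4 = 1" "c2 ^ 4 = 1"
    "(f0, f1, f2) \<in> {(weber_x0, weber_x1, weber_x2), (weber_x0, weber_x2, weber_x1), (weber_x1, weber_x0, weber_x2),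
        (weber_x1, weber_x2, weber_x0), (weber_x2, weber_x0, weber_x1), (weber_x2, weber_x1, weber_x0)}"
    "(f0, f1, f2) = (weber_x0, weber_x1, weber_x2) \<Longrightarrow> A \<in> Gamma2"
    for c0 c1 c2 f0 f1 f2
  proof (rule result[of f0 f1 f2 "k0 * c0" "k1 * c1" "k2 * c2"])
    show "weber_permutes A f0 f1 f2 (k0 * c0) (k1 * c1) (k2 * c2)"
      unfolding weber_permutes_def using A that k by (auto simp: power_mult_distrib)
  qed
  note ne = weber_x_distinct
  have i4: "\<i> ^ 4 = 1" "(- \<i>) ^ 4 = 1" "(-1::complex) ^ 4 = 1" "(1::complex) ^ 4 = 1" by (simp_all add: eval_nat_numeral)
  from R show thesis
  proof (elim disjE insertE emptyE conjE)
    assume "R = mat 1" "A \<in> Gamma2"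
    thus thesis by (intro *[of 1 weber_x0 1 weber_x1 1 weber_x2]) auto
  next
    assume "R = matS"
    thus thesis using ne i4 by (intro *[of 1 weber_x0 "- \<i>" weber_x2 \<i> weber_x1]) (auto simp: weber_x_matS)
  next
    assume "R = matT"
    thus thesis using ne i4 by (intro *[of "- 1" weber_x1 \<i> weber_x0 \<i> weber_x2]) (auto simp: weber_x_matT)
  next
    assume "R = matT ** matS"
    thus thesis using ne i4 by (intro *[of \<i> weber_x2 \<i> weber_x0 "- 1" weber_x1]) (auto simp: ST weber_x_matT weber_x_matS)
  next
    assume "R = matS ** matT"
    thus thesis using ne i4 T by (intro *[of "- 1" weber_x1 1 weber_x2 "- 1" weber_x0]) (auto simp: ST weber_x_matT weber_x_matS)
  next
    assume "R = matS ** matT ** matS"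
    thus thesis using ne i4 S T by (intro *[of \<i> weber_x2 \<i> weber_x1 "- 1" weber_x0]) (auto simp: ST weber_x_matT weber_x_matS)
  qed
qed

text \<open>The expression is symmetric in the fourth powers of the x_i, and fourth powers kill the
  multipliers.\<close>

lemma weber_j_invariant:
  assumes "A \<in> SL2" "Im t > 0"
  shows "weber_j (moebius A t) = weber_j t"
  using assms(1)
proof (rule weber_x_SL2)
  fix f0 f1 f2 c0 c1 c2
  assume "weber_permutes A f0 f1 f2 c0 c1 c2"
  note * = weber_permutesD[OF this]
  show ?thesis
    using *(7) unfolding weber_j_def *(1-3)[rule_format, OF assms(2)] power_mult_distrib *(4-6)
    by (auto simp: algebra_simps)
qed

section \<open>The Weber kernel group\<close>

definition weber_fixes :: "int ^ 2 ^ 2 \<Rightarrow> bool" where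
  "weber_fixes A \<longleftrightarrow> (\<forall>t. Im t > 0 \<longrightarrow> weber_x0 (moebius A t) = weber_x0 t \<and>
     weber_x1 (moebius A t) = weber_x1 t \<and> weber_x2 (moebius A t) = weber_x2 t)"

text \<open>If all x_i are fixed, non-proportionality excludes a nontrivial permutation, so the
  matrix lies in Gamma(2). The multipliers then force both characters to vanish modulo 4, and the
  odd diagonal entries can be cancelled.\<close>

lemma weber_fixes_iff:
  assumes "A \<in> SL2"
  shows "weber_fixes A \<longleftrightarrow> A \<in> split_cartan 8"
proof
  assume "A \<in> split_cartan 8"
  then obtain B C where BC: "A $ 1 $ 2 = 8 * B" "A $ 2 $ 1 = 8 * C"
    by (auto simp: split_cartan_def elim!: dvdE)
  hence "A \<in> Gamma2" using assms by (auto simp: Gamma2_def)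
  hence "weber_law A (A $ 1 $ 1 * (4 * C)) ((4 * B) * A $ 2 $ 2)"
    using Gamma2_weber_law[of A] by (simp add: BC)
  hence "weber_law A 0 0"
    by (rule weber_law_cong[where k = "- (A $ 1 $ 1 * C)" and l = "- (B * A $ 2 $ 2)"]) simp_all
  thus "weber_fixes A" by (simp add: weber_law_def weber_fixes_def)
next
  assume fixes_A: "weber_fixes A"
  obtain f0 f1 f2 c0 c1 c2 where "weber_permutes A f0 f1 f2 c0 c1 c2"
    using assms by (rule weber_x_SL2)
  note * = weber_permutesD[OF this]
  have f: "weber_x0 t = c0 * f0 t" "weber_x1 t = c1 * f1 t" if "Im t > 0" for t
    using fixes_A *(1,2) that by (auto simp: weber_fixes_def)
  have "f0 = weber_x0"
    using weber_x_not_proportional[of weber_x0 f0 c0] f(1) *(7) by fastforce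
  moreover have "f1 = weber_x1"
    using weber_x_not_proportional[of weber_x1 f1 c1] f(2) *(7) by fastforce
  ultimately have G: "A \<in> Gamma2" using *(7,8) weber_x_distinct by auto
  then obtain B C where BC: "A $ 1 $ 2 = 2 * B" "A $ 2 $ 1 = 2 * C"
    by (auto simp: Gamma2_def elim!: evenE)
  have i: "Im \<i> > 0" by simp
  have "weber_law A (A $ 1 $ 1 * C) (B * A $ 2 $ 2)"
    using Gamma2_weber_law[OF G] by (simp add: BC)
  hence "weber_x0 \<i> = \<i> powi (A $ 1 $ 1 * C - B * A $ 2 $ 2) * weber_x0 \<i>"
    "weber_x1 \<i> = \<i> powi (2 * (A $ 1 $ 1 * C) - B * A $ 2 $ 2) * weber_x1 \<i>"
    using fixes_A i unfolding weber_law_def weber_fixes_def by auto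
  hence "4 dvd A $ 1 $ 1 * C - B * A $ 2 $ 2" "4 dvd 2 * (A $ 1 $ 1 * C) - B * A $ 2 $ 2"
    using weber_x_nonzero[OF i] by (auto intro!: powi_ii_eq_1)
  \<comment> \<open>The exponents for x0 and x1 suffice: their difference is X, the character of the
    lower left entry.\<close>
  moreover have "4 dvd X \<and> 4 dvd Y" if "4 dvd X - Y" "4 dvd 2 * X - Y" for X Y :: int
    using that by presburger
  ultimately have "4 dvd A $ 1 $ 1 * C \<and> 4 dvd B * A $ 2 $ 2" by blast
  hence "4 dvd A $ 1 $ 1 * C" "4 dvd A $ 2 $ 2 * B" by (simp_all only: mult.commute[of B])
  moreover have "A $ 1 $ 1 * A $ 2 $ 2 = 1 + 2 * (2 * B * C)" using assms by (simp add: SL2_iff BC)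
  hence "odd (A $ 1 $ 1 * A $ 2 $ 2)" by simp
  moreover have "coprime (4::int) x" if "odd x" for x
  proof -
    have "coprime (2 * 2) x" using that unfolding coprime_mult_left_iff by simp
    thus ?thesis by simp
  qed
  ultimately have "4 dvd C" "4 dvd B"
    using coprime_dvd_mult_right_iff[of 4 "A $ 1 $ 1" C] coprime_dvd_mult_right_iff[of 4 "A $ 2 $ 2" B]
      even_mult_iff by blast+
  thus "A \<in> split_cartan 8"
    using assms by (auto simp: split_cartan_def BC)
qed

lemma to_PSL2Z_eq: "to_PSL2Z A = {A, - A}"
proof -
  have "- mat 1 ** A = - A"
    by (subst (1 2) mat2_eta[of A, symmetric]) (simp add: mat_1_mat2 uminus_mat2 mat2_mult)
  thus ?thesis by (auto simp add: to_PSL2Z_def r_coset_def SL2Z_def)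
qed

lemma carrier_PSL2Z: "carrier PSL2Z = to_PSL2Z ` SL2"
  by (auto simp: PSL2Z_def FactGroup_def RCOSETS_def to_PSL2Z_def)

lemma invariant_under_to_PSL2Z:
  "invariant_under (to_PSL2Z A) f \<longleftrightarrow> (\<forall>t. Im t > 0 \<longrightarrow> f (moebius A t) = f t)"
  by (auto simp: invariant_under_def to_PSL2Z_eq moebius_uminus)

lemma weber_kernel_group_4: "weber_kernel_group 4 = Gamma_s 8"
proof -
  have "weber_kernel_group 4 = to_PSL2Z ` {A \<in> SL2. weber_fixes A}"
    unfolding weber_kernel_group_def carrier_PSL2Z
    by (auto simp: invariant_under_to_PSL2Z weber_fixes_def weber_x0_def weber_x1_def weber_x2_def)
  also have "{A \<in> SL2. weber_fixes A} = split_cartan 8"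
    using weber_fixes_iff by (auto simp: split_cartan_def)
  finally show ?thesis by (simp add: Gamma_s_def)
qed

section \<open>Meromorphic functions and Moebius transformations\<close>

text \<open>A local homeomorphism carries punctured neighbourhoods to punctured neighbourhoods. In
  this form it moves limits, and with them removed singularities, along a modular substitution
  without regard to the value at the point.\<close>

lemma filtermap_at_local_inverse:
  assumes "isCont f z" "isCont g (f z)"
    and gf: "eventually (\<lambda>w. g (f w) = w) (nhds z)" and fg: "eventually (\<lambda>w. f (g w) = w) (nhds (f z))"
  shows "filtermap f (at z) = at (f z)"
proof (rule antisym)
  have gfz: "g (f z) = z" using gf by (rule eventually_nhds_x_imp_x)
  have "eventually (\<lambda>w. f w \<noteq> f z) (at z)"
    using gf unfolding eventually_at_filter by eventually_elim (metis gfz)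
  thus "filtermap f (at z) \<le> at (f z)"
    using assms(1) unfolding filterlim_def[symmetric] filterlim_at isCont_def by auto
  have "eventually (\<lambda>w. g w \<noteq> z) (at (f z))"
    using fg unfolding eventually_at_filter by eventually_elim metis
  moreover have "g \<midarrow>f z\<rightarrow> z" using assms(2) by (simp add: isCont_def gfz)
  ultimately have "filterlim g (at z) (at (f z))"
    by (simp add: filterlim_at)
  hence ev: "eventually (\<lambda>w. P (g w)) (at (f z))" if "eventually P (at z)" for P
    using that by (simp add: filterlim_iff)
  have fg': "eventually (\<lambda>w. f (g w) = w) (at (f z))"
    using fg by (auto simp: eventually_at_filter elim: eventually_mono)
  show "at (f z) \<le> filtermap f (at z)"
  proof (rule filter_leI)
    fix P assume "eventually P (filtermap f (at z))"
    hence "eventually (\<lambda>w. P (f (g w))) (at (f z))" by (intro ev) (simp add: eventually_filtermap)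
    with fg' show "eventually P (at (f z))" by eventually_elim simp
  qed
qed

lemma isCont_moebius:
  assumes "A \<in> SL2" "Im z > 0"
  shows "isCont (moebius A) z"
  using holomorphic_on_imp_continuous_on[OF moebius_holomorphic[OF assms(1)]] assms(2) open_upper_half_plane
  by (simp add: continuous_on_eq_continuous_at)

lemma eventually_upper_half_plane: "Im z > 0 \<Longrightarrow> eventually (\<lambda>w. Im w > 0) (nhds z)"
  using eventually_nhds_in_open[OF open_upper_half_plane, of z] by simp

lemma eventually_upper_half_plane_at: "Im z > 0 \<Longrightarrow> eventually (\<lambda>w. Im w > 0) (at z)"
  using eventually_upper_half_plane[of z] by (auto simp: eventually_at_filter elim: eventually_mono)

lemma filtermap_moebius:
  assumes "A \<in> SL2" "Im z > 0"
  shows "filtermap (moebius A) (at z) = at (moebius A z)"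
proof (rule filtermap_at_local_inverse[of _ _ "moebius (adj2 A)"])
  have A: "Im (moebius A z) > 0" "adj2 A \<in> SL2"
    using assms by (auto intro: moebius_in_upper_half_plane SL2_adj)
  show "isCont (moebius A) z" "isCont (moebius (adj2 A)) (moebius A z)"
    using assms A by (auto intro: isCont_moebius)
  show "eventually (\<lambda>w. moebius (adj2 A) (moebius A w) = w) (nhds z)"
    using eventually_upper_half_plane[OF assms(2)] by eventually_elim (simp add: moebius_adj assms)
  show "eventually (\<lambda>w. moebius A (moebius (adj2 A) w) = w) (nhds (moebius A z))"
    using eventually_upper_half_plane[OF A(1)] by eventually_elim (simp add: moebius_adj assms)
qed

lemma tendsto_moebius_iff:
  assumes "A \<in> SL2" "Im z > 0"
  shows "(\<lambda>w. f (moebius A w)) \<midarrow>z\<rightarrow> c \<longleftrightarrow> f \<midarrow>moebius A z\<rightarrow> c"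
  unfolding filterlim_def filtermap_moebius[OF assms, symmetric] filtermap_filtermap ..

lemma remove_sings_moebius:
  assumes "A \<in> SL2" "Im z > 0" "\<And>w. Im w > 0 \<Longrightarrow> f (moebius A w) = f w"
  shows "remove_sings f (moebius A z) = remove_sings f z"
proof -
  have "remove_sings (f \<circ> moebius A) z = remove_sings f (moebius A z)"
    using filtermap_moebius[OF assms(1,2)] by (rule remove_sings_compose)
  moreover have "remove_sings (f \<circ> moebius A) z = remove_sings f z"
    using eventually_upper_half_plane_at[OF assms(2)]
    by (intro remove_sings_cong) (auto elim!: eventually_mono simp: assms(3))
  ultimately show ?thesis by simp
qed

lemma meromorphic_on_moebius:
  assumes "f meromorphic_on upper_half_plane" "A \<in> SL2"
  shows "(\<lambda>t. f (moebius A t)) meromorphic_on upper_half_plane"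
proof (rule meromorphic_on_compose[OF assms(1)])
  show "moebius A analytic_on upper_half_plane"
    using moebius_holomorphic[OF assms(2)] open_upper_half_plane by (simp add: analytic_on_open)
qed (use moebius_in_upper_half_plane[OF assms(2)] in auto)

lemma remove_sings_analytic_at':
  assumes "f meromorphic_on A" "z \<in> A" "f \<midarrow>z\<rightarrow> c"
  shows "remove_sings f analytic_on {z}"
  using assms by (intro remove_sings_analytic_at[of _ _ c]) (auto simp: meromorphic_on_altdef)

section \<open>Clearing a pole by a power of a function that vanishes there\<close>

lemma meromorphic_times_power_tendsto:
  assumes "f meromorphic_on {z}"
  shows "\<exists>m c. (\<lambda>w. f w * (w - z) ^ m) \<midarrow>z\<rightarrow> c"
proof (cases "is_pole f z")
  case False
  then obtain c where "f \<midarrow>z\<rightarrow> c"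
    using assms by (auto simp: meromorphic_at_iff not_essential_def)
  thus ?thesis by (intro exI[of _ "0::nat"] exI[of _ c]) simp
next
  case True
  obtain S where S: "open S" "z \<in> S" "f holomorphic_on S - {z}"
    using assms unfolding meromorphic_at_iff
    using analytic_imp_holomorphic isolated_singularity_at_iff_analytic_nhd by metis
  define m where "m = nat (- zorder f z)"
  obtain r where r: "r > 0" "zor_poly f z holomorphic_on cball z r"
    "\<And>w. w \<in> cball z r - {z} \<Longrightarrow> f w = zor_poly f z w / (w - z) ^ m"
    using zorder_exist_pole[OF S(3,1,2) True] unfolding m_def by blast
  have "continuous_on (ball z r) (zor_poly f z)"
    using r(2) by (meson ball_subset_cball continuous_on_subset holomorphic_on_imp_continuous_on)
  hence "zor_poly f z \<midarrow>z\<rightarrow> zor_poly f z z"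
    using r(1) by (simp add: continuous_on_eq_continuous_at isCont_def)
  moreover have "eventually (\<lambda>w. zor_poly f z w = f w * (w - z) ^ m) (at z)"
    using eventually_at_ball'[OF r(1), of z UNIV] by eventually_elim (auto simp: r(3))
  ultimately have "(\<lambda>w. f w * (w - z) ^ m) \<midarrow>z\<rightarrow> zor_poly f z z"
    by (rule Lim_transform_eventually)
  thus ?thesis by blast
qed

lemma meromorphic_divide_by_zero_tendsto:
  assumes "f meromorphic_on {z}" "f \<midarrow>z\<rightarrow> 0"
  shows "\<exists>c. (\<lambda>w. f w / (w - z)) \<midarrow>z\<rightarrow> c"
proof -
  have "remove_sings f analytic_on {z}"
    using assms by (intro remove_sings_analytic_at'[of _ "{z}"]) auto
  then obtain D where D: "(remove_sings f has_field_derivative D) (at z)"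
    using analytic_on_imp_differentiable_at field_differentiable_def by (metis singletonI)
  have "remove_sings f z = 0" using assms(2) by (rule remove_sings_eqI)
  hence "(\<lambda>w. remove_sings f w / (w - z)) \<midarrow>z\<rightarrow> D"
    using D by (simp add: has_field_derivative_iff)
  moreover have "eventually (\<lambda>w. remove_sings f w / (w - z) = f w / (w - z)) (at z)"
    using eventually_remove_sings_eq_at[of f z] assms(1) by (auto simp: meromorphic_at_iff elim: eventually_mono)
  ultimately have "(\<lambda>w. f w / (w - z)) \<midarrow>z\<rightarrow> D" by (rule Lim_transform_eventually)
  thus ?thesis ..
qed

text \<open>Written as (u/(w - z))^m times f (w - z)^m, both factors have limits. It is applied to u
  = j - j(z), whose order of vanishing at an elliptic point then need not be known.\<close>

lemma meromorphic_times_zero_power_tendsto: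
  assumes "f meromorphic_on {z}" "u analytic_on {z}" "u z = 0"
  shows "\<exists>k c. (\<lambda>w. u w ^ k * f w) \<midarrow>z\<rightarrow> c"
proof -
  obtain m c where m: "(\<lambda>w. f w * (w - z) ^ m) \<midarrow>z\<rightarrow> c"
    using meromorphic_times_power_tendsto[OF assms(1)] by blast
  have "u \<midarrow>z\<rightarrow> 0" using assms(2,3) analytic_at_imp_isCont[of u z] by (simp add: isCont_def)
  then obtain D where D: "(\<lambda>w. u w / (w - z)) \<midarrow>z\<rightarrow> D"
    using meromorphic_divide_by_zero_tendsto analytic_on_imp_meromorphic_on[OF assms(2)] by blast
  have "(\<lambda>w. (u w / (w - z)) ^ m * (f w * (w - z) ^ m)) \<midarrow>z\<rightarrow> D ^ m * c"
    by (intro tendsto_intros D m)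
  moreover have "eventually (\<lambda>w. (u w / (w - z)) ^ m * (f w * (w - z) ^ m) = u w ^ m * f w) (at z)"
    unfolding eventually_at_filter by (auto simp: power_divide intro: always_eventually)
  ultimately have "(\<lambda>w. u w ^ m * f w) \<midarrow>z\<rightarrow> D ^ m * c" by (rule Lim_transform_eventually)
  thus ?thesis by blast
qed

section \<open>Reduction to a strip\<close>

text \<open>The imaginary part of c t + d bounds c, and then the triangle inequality bounds
  d.\<close>

lemma finite_small_denominators:
  assumes "Im t > 0"
  shows "finite {(c, d). norm (of_int c * t + of_int d) \<le> 1}"
proof -
  define K where "K = 1 / Im t"
  define L where "L = 1 + K * norm t"
  have "{(c, d). norm (of_int c * t + of_int d) \<le> 1} \<subseteq> {-\<lceil>K\<rceil>..\<lceil>K\<rceil>} \<times> {-\<lceil>L\<rceil>..\<lceil>L\<rceil>}"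
  proof safe
    fix c d :: int assume n: "norm (of_int c * t + of_int d) \<le> 1"
    have "\<bar>of_int c\<bar> * Im t = \<bar>Im (of_int c * t + of_int d)\<bar>" using assms by (simp add: abs_mult)
    also have "\<dots> \<le> 1" using n abs_Im_le_cmod order_trans by blast
    finally have c: "\<bar>of_int c\<bar> \<le> K" using assms by (simp add: K_def field_simps)
    have "\<bar>of_int d :: real\<bar> = norm ((of_int c * t + of_int d) - of_int c * t)" by simp
    also have "\<dots> \<le> 1 + \<bar>of_int c\<bar> * norm t"
      using n by (intro order_trans[OF norm_triangle_ineq4] add_mono) (auto simp: norm_mult)
    also have "\<dots> \<le> L" unfolding L_def using c by (intro add_mono mult_right_mono) auto
    finally have d: "\<bar>of_int d\<bar> \<le> L" .
    have "\<bar>x\<bar> \<le> \<lceil>B\<rceil>" if "\<bar>of_int x\<bar> \<le> B" for x :: int and B :: real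
      using le_of_int_ceiling[of B] that by linarith
    from this[OF c] this[OF d] show "c \<in> {-\<lceil>K\<rceil>..\<lceil>K\<rceil>}" "d \<in> {-\<lceil>L\<rceil>..\<lceil>L\<rceil>}"
      by (simp_all add: abs_le_iff)
  qed
  thus ?thesis by (rule finite_subset) auto
qed

text \<open>Choose the matrix with smallest |c t + d|, hence largest imaginary part, and translate.
  The inversion cannot raise the imaginary part further, so |z| is at least 1.\<close>

lemma SL2_reduction:
  assumes "Im t > 0"
  shows "\<exists>A\<in>SL2. Im (moebius A t) \<ge> 1 / 2 \<and> \<bar>Re (moebius A t)\<bar> \<le> 1 / 2"
proof -
  define N where "N = (\<lambda>A::int^2^2. norm (of_int (A $ 2 $ 1) * t + of_int (A $ 2 $ 2)))"
  \<comment> \<open>The restriction to values at most 1 makes the set finite; the identity keeps it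
    nonempty.\<close>
  define V where "V = N ` {A \<in> SL2. N A \<le> 1}"
  have "V \<subseteq> (\<lambda>(c, d). norm (of_int c * t + of_int d)) ` {(c, d). norm (of_int c * t + of_int d) \<le> 1}"
    by (auto simp: V_def N_def)
  hence finV: "finite V" using finite_small_denominators[OF assms] finite_surj by blast
  have "N (mat 1) = 1" by (simp add: N_def mat_1_mat2)
  hence "V \<noteq> {}" using SL2_one by (auto simp: V_def)
  hence "Min V \<in> V" using finV by simp
  then obtain A where A: "A \<in> SL2" "N A \<le> 1" "N A = Min V" by (auto simp: V_def)
  have min: "N A \<le> N B" if "B \<in> SL2" for B
  proof (cases "N B \<le> 1")
    case True
    hence "N B \<in> V" using that by (auto simp: V_def)
    thus ?thesis using finV A by simp
  qed (use A in auto)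
  have ImN: "Im (moebius B t) = Im t / N B ^ 2" if "B \<in> SL2" for B
    using that by (elim SL2_cases) (simp add: Im_moebius N_def)
  have Npos: "N B > 0" if "B \<in> SL2" for B
  proof -
    have "Im t / N B ^ 2 > 0" using ImN[OF that] moebius_in_upper_half_plane[OF that assms] by simp
    thus ?thesis by (auto simp: N_def)
  qed
  have max: "Im (moebius B t) \<le> Im (moebius A t)" if "B \<in> SL2" for B
    unfolding ImN[OF that] ImN[OF A(1)] using min[OF that] Npos[OF A(1)] assms
    by (intro divide_left_mono power_mono mult_pos_pos) (auto intro: less_le_trans)
  define n where "n = round (Re (moebius A t))"
  define B where "B = mat2 1 (- n) 0 1 ** A"
  have T: "mat2 1 (- n) 0 1 \<in> SL2" by (simp add: mat2_in_SL2)
  have B: "B \<in> SL2" unfolding B_def by (intro SL2_mult T A)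
  define z where "z = moebius B t"
  have z: "z = moebius A t - of_int n"
    unfolding z_def B_def moebius_mult[OF T A(1) assms] by (simp add: moebius_mat2)
  have Re: "\<bar>Re z\<bar> \<le> 1 / 2"
    using of_int_round_abs_le[of "Re (moebius A t)"] by (simp add: z n_def abs_minus_commute)
  have Imz: "Im z > 0" unfolding z_def using B assms by (rule moebius_in_upper_half_plane)
  have "Im (moebius matS z) = Im (moebius (matS ** B) t)"
    unfolding z_def moebius_mult[OF matS_SL2 B assms] ..
  also have "\<dots> \<le> Im z"
    using max[of "matS ** B"] SL2_mult[OF matS_SL2 B] by (simp add: z)
  also have "Im (moebius matS z) = Im z / norm z ^ 2"
    using Im_moebius[of 0 0 "- 1" 1 z] by simp
  finally have "1 \<le> norm z ^ 2"
    using Imz by (simp add: divide_le_eq mult_le_cancel_left2 split: if_splits)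
  moreover have "(Re z)\<^sup>2 \<le> (1 / 2)\<^sup>2" using Re by (simp add: abs_le_square_iff[symmetric])
  \<comment> \<open>In fact 3/4 is a lower bound for the square; 1/4 is enough for a strip bounded
    away from the real axis.\<close>
  ultimately have "(1 / 2)\<^sup>2 \<le> (Im z)\<^sup>2" unfolding cmod_power2 by (simp add: power_divide)
  hence "1 / 2 \<le> Im z" using Imz by (simp add: power2_le_iff_abs_le abs_le_square_iff[symmetric])
  thus ?thesis using B Re by (auto simp: z_def)
qed

section \<open>Functions of level one\<close>

abbreviation at_cusp :: "complex filter" where "at_cusp \<equiv> filtercomap Im at_top"

lemma at_cusp_neq_bot: "at_cusp \<noteq> bot"
proof
  assume "at_cusp = bot"
  hence "eventually (\<lambda>_. False) at_cusp" by simp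
  then obtain N where "\<And>x. Im x \<ge> N \<Longrightarrow> False"
    by (auto simp only: eventually_filtercomap_at_top_linorder)
  from this[of "Complex 0 N"] show False by simp
qed

lemma filterlim_cusp_param:
  assumes "N > 0"
  shows "filterlim (cusp_param N) (at 0) at_cusp"
proof -
  have "norm (cusp_param N t) = exp (- (2 * pi / N) * Im t)" for t
    by (simp add: cusp_param_def norm_exp_eq_Re)
  moreover have "((\<lambda>x. exp (- (2 * pi / N) * x)) \<longlongrightarrow> 0) at_top"
  proof -
    have "filterlim (\<lambda>x. - (2 * pi / N) * x) at_bot at_top"
      using assms by (intro filterlim_tendsto_neg_mult_at_bot[OF tendsto_const] filterlim_ident) auto
    thus ?thesis by (rule filterlim_compose[OF exp_at_bot])
  qed
  ultimately have "((\<lambda>t. norm (cusp_param N t)) \<longlongrightarrow> 0) at_cusp"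
    using filterlim_filtercomapI[of "\<lambda>x. exp (- (2 * pi / N) * x)" "nhds 0" at_top Im] by simp
  hence "(cusp_param N \<longlongrightarrow> 0) at_cusp" by (rule tendsto_norm_zero_cancel)
  thus ?thesis by (auto simp: filterlim_at cusp_param_def)
qed

lemma cusp_param_nonzero: "cusp_param N t \<noteq> 0"
  by (simp add: cusp_param_def)

lemma analytic_at_zero_compose_power:
  fixes G :: "complex \<Rightarrow> complex"
  assumes "G analytic_on {0}" "N > 0"
  shows "(\<lambda>w. G (w ^ N)) analytic_on {0}"
proof -
  have "(\<lambda>w. w ^ N) analytic_on {0::complex}" by (intro analytic_intros)
  from analytic_on_compose_gen[OF this assms(1)] assms(2) show ?thesis
    by (simp add: o_def)
qed

text \<open>If \<psi>(t) differs from L, then \<psi> - L is smaller than its value at t near the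
  cusp. By invariance its modulus therefore attains a global maximum on a compact piece of the
  strip, and a nonzero constant would contradict the limit at the cusp.\<close>

lemma level_one_constant:
  assumes holo: "\<psi> holomorphic_on upper_half_plane"
    and inv: "\<And>A t. A \<in> SL2 \<Longrightarrow> Im t > 0 \<Longrightarrow> \<psi> (moebius A t) = \<psi> t"
    and lim: "(\<psi> \<longlongrightarrow> L) at_cusp" and t: "Im t > 0"
  shows "\<psi> t = L"
proof (rule ccontr)
  assume "\<psi> t \<noteq> L"
  define h where "h = (\<lambda>t. \<psi> t - L)"
  have ht: "norm (h t) > 0" using \<open>\<psi> t \<noteq> L\<close> by (simp add: h_def)
  have holoh: "h holomorphic_on upper_half_plane" unfolding h_def by (intro holomorphic_intros holo)
  have limh: "(h \<longlongrightarrow> 0) at_cusp" unfolding h_def using lim LIM_zero by (metis tendsto_cong LIM_zero_iff Lim_null)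
  from tendstoD[OF this ht] obtain Y where Y: "\<And>z. Im z \<ge> Y \<Longrightarrow> norm (h z) < norm (h t)"
    by (auto simp: eventually_filtercomap_at_top_linorder)
  define C where "C = cbox (Complex (-1/2) (1/2)) (Complex (1/2) (max Y 1))"
  have C: "z \<in> C \<longleftrightarrow> \<bar>Re z\<bar> \<le> 1/2 \<and> 1/2 \<le> Im z \<and> Im z \<le> max Y 1" for z
    by (auto simp: C_def in_cbox_complex_iff abs_le_iff)
  have "compact C" by (simp add: C_def)
  moreover have "continuous_on C (\<lambda>z. norm (h z))"
    by (intro continuous_on_norm holomorphic_on_imp_continuous_on holomorphic_on_subset[OF holoh]) (auto simp: C)
  moreover have "Complex 0 1 \<in> C" by (simp add: C)
  ultimately obtain p where p: "p \<in> C" "\<And>z. z \<in> C \<Longrightarrow> norm (h z) \<le> norm (h p)"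
    using continuous_attains_sup[of C "\<lambda>z. norm (h z)"] by blast
  \<comment> \<open>After reduction to the strip a point is either above height \<open>Y\<close>,
    where \<open>h\<close> is small, or in the compact set \<open>C\<close>.\<close>
  have red: "norm (h z) < norm (h t) \<or> norm (h z) \<le> norm (h p)" if z: "Im z > 0" for z
  proof -
    obtain A where A: "A \<in> SL2" "Im (moebius A z) \<ge> 1 / 2" "\<bar>Re (moebius A z)\<bar> \<le> 1 / 2"
      using SL2_reduction[OF z] by blast
    have "h z = h (moebius A z)" using inv[OF A(1) z] by (simp add: h_def)
    thus ?thesis using Y[of "moebius A z"] p(2)[of "moebius A z"] A C by (cases "Im (moebius A z) \<le> max Y 1") auto
  qed
  have hp: "norm (h t) \<le> norm (h p)" using red[OF t] by auto
  have "h constant_on upper_half_plane"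
  proof (rule maximum_modulus_principle[OF holoh open_upper_half_plane connected_upper_half_plane
        open_upper_half_plane order_refl])
    show "p \<in> upper_half_plane" using p by (auto simp: C)
    show "norm (h z) \<le> norm (h p)" if "z \<in> upper_half_plane" for z
      using red[of z] that hp by auto
  qed
  then obtain k where k: "\<And>z. Im z > 0 \<Longrightarrow> h z = k" by (auto simp: constant_on_def)
  have "norm (h (Complex 0 (max Y 1))) < norm (h t)" by (intro Y) auto
  thus False using k[OF t] k[of "Complex 0 (max Y 1)"] by simp
qed

lemma weber_j_holomorphic: "weber_j holomorphic_on upper_half_plane"
  unfolding weber_j_def by (intro holomorphic_intros weber_x_holomorphic)

lemma weber_j_at_infinity: "filterlim weber_j at_infinity at_cusp"
proof -
  obtain G where G: "G analytic_on {0}" "G 0 = 1"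
    "\<And>t. weber_j t * cusp_param 1 t = G (cusp_param 8 t)"
    using weber_j_expansion by blast
  have "G \<midarrow>0\<rightarrow> 1" using analytic_at_imp_isCont[OF G(1)] G(2) by (simp add: isCont_def)
  hence "((\<lambda>t. G (cusp_param 8 t)) \<longlongrightarrow> 1) at_cusp"
    by (rule filterlim_compose) (simp add: filterlim_cusp_param)
  hence "filterlim (\<lambda>t. G (cusp_param 8 t) / cusp_param 1 t) at_infinity at_cusp"
    by (rule filterlim_divide_at_infinity) (simp_all add: filterlim_cusp_param)
  also have "(\<lambda>t. G (cusp_param 8 t) / cusp_param 1 t) = weber_j"
    unfolding G(3)[symmetric] by (simp add: cusp_param_nonzero)
  finally show ?thesis .
qed

text \<open>j is unbounded at the cusp, whereas the zeros of the polynomial are bounded.\<close>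

lemma poly_weber_j_nonzero:
  assumes "q \<noteq> 0"
  obtains t where "Im t > 0" "poly q (weber_j t) \<noteq> 0"
proof -
  have "bounded {x. poly q x = 0}" using poly_roots_finite[OF assms] by (rule finite_imp_bounded)
  then obtain b where b: "\<And>x. poly q x = 0 \<Longrightarrow> norm x \<le> b" by (auto simp: bounded_iff)
  have "eventually (\<lambda>t. b + 1 \<le> norm (weber_j t)) at_cusp"
    using weber_j_at_infinity unfolding filterlim_at_infinity_conv_norm_at_top filterlim_at_top by blast
  then obtain Y where Y: "\<And>t. Im t \<ge> Y \<Longrightarrow> b + 1 \<le> norm (weber_j t)"
    by (auto simp: eventually_filtercomap_at_top_linorder)
  show thesis using that[of "Complex 0 (max Y 1)"] Y[of "Complex 0 (max Y 1)"] b by fastforce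
qed

lemma cusp_param_mult: "n > 0 \<Longrightarrow> cusp_param (n * N) t ^ n = cusp_param N t"
  unfolding cusp_param_def exp_of_nat_mult[symmetric] by (cases "N = 0") (simp_all add: field_simps)

text \<open>Induction on a bound m for the pole order in w = q^(1/(8M)); L is the coefficient of
  w^(-m) and may be zero. Width 8M makes the parameter of width 8, in which j is expanded, a power
  of w. Invariance under t + 1 forces a nonzero leading term to be an integral power of q, so a
  power of j cancels it.\<close>

lemma level_one_holomorphic:
  assumes "\<psi> holomorphic_on upper_half_plane"
    and "\<And>A t. A \<in> SL2 \<Longrightarrow> Im t > 0 \<Longrightarrow> \<psi> (moebius A t) = \<psi> t"
    and M: "M > 0" and "g meromorphic_on {0}"
    and "eventually (\<lambda>t. \<psi> t = g (cusp_param (8 * M) t)) at_cusp"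
    and "(\<lambda>w. g w * w ^ m) \<midarrow>0\<rightarrow> L"
  shows "\<exists>p. \<forall>t. Im t > 0 \<longrightarrow> \<psi> t = poly p (weber_j t)"
  using assms(1,2,4,5,6)
proof (induction m arbitrary: \<psi> g L)
  case 0
  have "((\<lambda>t. g (cusp_param (8 * M) t)) \<longlongrightarrow> L) at_cusp"
    using 0(5) M by (intro filterlim_compose[OF _ filterlim_cusp_param]) auto
  hence "(\<psi> \<longlongrightarrow> L) at_cusp"
    by (rule Lim_transform_eventually) (use 0(4) in \<open>auto elim: eventually_mono\<close>)
  hence "\<forall>t. Im t > 0 \<longrightarrow> \<psi> t = poly [:L:] (weber_j t)"
    using level_one_constant[OF 0(1,2)] by simp
  thus ?case by blast
next
  case (Suc m)
  \<comment> \<open>A vanishing leading coefficient allows one division by w, which lowers the bound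
    for the induction hypothesis.\<close>
  have descend: "\<exists>p. \<forall>t. Im t > 0 \<longrightarrow> \<psi>' t = poly p (weber_j t)"
    if "\<psi>' holomorphic_on upper_half_plane" "\<And>A t. A \<in> SL2 \<Longrightarrow> Im t > 0 \<Longrightarrow> \<psi>' (moebius A t) = \<psi>' t"
      and g': "g' meromorphic_on {0}" and "eventually (\<lambda>t. \<psi>' t = g' (cusp_param (8 * M) t)) at_cusp"
      and lim: "(\<lambda>w. g' w * w ^ Suc m) \<midarrow>0\<rightarrow> 0" for \<psi>' g'
  proof -
    have "(\<lambda>w. g' w * w ^ Suc m) meromorphic_on {0}" by (intro meromorphic_intros g')
    from meromorphic_divide_by_zero_tendsto[OF this lim]
    obtain c where c: "(\<lambda>w. g' w * w ^ Suc m / (w - 0)) \<midarrow>0\<rightarrow> c" by blast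
    have "eventually (\<lambda>w. g' w * w ^ Suc m / (w - 0) = g' w * w ^ m) (at 0)"
      unfolding eventually_at_filter by (auto intro: always_eventually)
    with c have "(\<lambda>w. g' w * w ^ m) \<midarrow>0\<rightarrow> c" by (rule Lim_transform_eventually)
    thus ?thesis using Suc.IH[of \<psi>' g' c] that by blast
  qed
  show ?case
  proof (cases "L = 0")
    case True
    thus ?thesis using descend[OF Suc.prems(1-4)] Suc.prems(5) by simp
  next
    case False
    define N where "N = 8 * M"
    define w where "w = cusp_param N"
    have N: "N > 0" using M by (simp add: N_def)
    have w: "filterlim w (at 0) at_cusp" unfolding w_def using N by (rule filterlim_cusp_param)
    have "((\<lambda>t. g (w t) * w t ^ Suc m) \<longlongrightarrow> L) at_cusp"
      using filterlim_compose[OF Suc.prems(5) w] .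
    hence lim: "((\<lambda>t. \<psi> t * w t ^ Suc m) \<longlongrightarrow> L) at_cusp"
      by (rule Lim_transform_eventually) (use Suc.prems(4) in \<open>auto elim: eventually_mono simp: w_def N_def\<close>)
    have shift: "filterlim (\<lambda>t. t + 1) at_cusp at_cusp"
      unfolding filterlim_filtercomap_iff o_def by (simp add: filterlim_filtercomap)
    define \<zeta> where "\<zeta> = exp (2 * of_real pi * \<i> / of_nat N)"
    have ws: "w (t + 1) = \<zeta> * w t" for t
      by (simp add: w_def cusp_param_def \<zeta>_def distrib_left add_divide_distrib exp_add)
    have "((\<lambda>t. \<psi> (t + 1) * w (t + 1) ^ Suc m) \<longlongrightarrow> L) at_cusp"
      using filterlim_compose[OF lim shift] .
    moreover have "eventually (\<lambda>t. \<psi> (t + 1) * w (t + 1) ^ Suc m = \<zeta> ^ Suc m * (\<psi> t * w t ^ Suc m)) at_cusp"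
    proof -
      have "eventually (\<lambda>t. Im t > 0) at_cusp"
        by (auto simp: eventually_filtercomap_at_top_dense)
      thus ?thesis
      proof eventually_elim
        case (elim t)
        have "\<psi> (t + 1) = \<psi> t" using Suc.prems(2)[OF matT_SL2 elim] by (simp add: moebius_matT)
        thus ?case by (simp only: ws power_mult_distrib mult_ac)
      qed
    qed
    ultimately have "((\<lambda>t. \<zeta> ^ Suc m * (\<psi> t * w t ^ Suc m)) \<longlongrightarrow> L) at_cusp"
      by (rule Lim_transform_eventually)
    moreover have "((\<lambda>t. \<zeta> ^ Suc m * (\<psi> t * w t ^ Suc m)) \<longlongrightarrow> \<zeta> ^ Suc m * L) at_cusp"
      by (intro tendsto_intros lim)
    \<comment> \<open>The same limit taken along t and along t + 1 differs by a root of unity, which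
      must therefore be 1; this makes \<open>N\<close> divide \<open>Suc m\<close>.\<close>
    ultimately have "L = \<zeta> ^ Suc m * L"
      using tendsto_unique at_cusp_neq_bot by blast
    hence "\<zeta> ^ Suc m = 1" using False by simp
    hence "exp (of_nat (Suc m) * (2 * of_real pi * \<i> / of_nat N)) = 1"
      unfolding \<zeta>_def exp_of_nat_mult .
    then obtain n :: int where "Im (of_nat (Suc m) * (2 * of_real pi * \<i> / of_nat N)) = of_int (2 * n) * pi"
      unfolding exp_eq_1 by blast
    moreover have "of_nat (Suc m) * (2 * complex_of_real pi * \<i> / of_nat N) = \<i> * of_real (real (Suc m) * (2 * pi) / real N)"
      by simp
    ultimately have "real (Suc m) * (2 * pi) / real N = of_int (2 * n) * pi"
      by (simp only: Im_i_times Re_complex_of_real)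
    hence "real (Suc m) = of_int n * real N"
      using N by (simp add: field_simps del: of_nat_Suc)
    hence "of_int (int (Suc m)) = (of_int (n * int N) :: real)" by simp
    hence "int (Suc m) = n * int N" by (simp only: of_int_eq_iff)
    hence "int N dvd int (Suc m)" by simp
    hence "N dvd Suc m" by (simp only: of_nat_dvd_iff)
    then obtain k where k: "Suc m = N * k" by (rule dvdE)
    obtain G where G: "G analytic_on {0}" "G 0 = 1"
      "\<And>t. weber_j t * cusp_param 1 t = G (cusp_param 8 t)"
      using weber_j_expansion by blast
    have cG: "isCont G 0" using analytic_at_imp_isCont[OF G(1)] .
    \<comment> \<open>The expansion of j in w: \<open>w ^ M\<close> is the parameter of width 8 and
      \<open>w ^ N\<close> is q.\<close>
    define J where "J = (\<lambda>w. G (w ^ M) / w ^ N)"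
    have GM: "(\<lambda>w. G (w ^ M)) analytic_on {0}"
      using G(1) M by (rule analytic_at_zero_compose_power)
    hence J: "J meromorphic_on {0}"
      unfolding J_def by (intro meromorphic_intros analytic_on_imp_meromorphic_on)
    have jJ: "weber_j t = J (w t)" for t
    proof -
      have "w t ^ M = cusp_param 8 t" "w t ^ N = cusp_param 1 t"
        using cusp_param_mult[of M 8 t] cusp_param_mult[of N 1 t] M N by (simp_all add: w_def N_def mult.commute)
      thus ?thesis using G(3)[of t] by (simp add: J_def cusp_param_def field_simps)
    qed
    have "\<exists>p. \<forall>t. Im t > 0 \<longrightarrow> \<psi> t - L * weber_j t ^ k = poly p (weber_j t)"
    proof (rule descend[of _ "\<lambda>w. g w - L * J w ^ k"])
      show "(\<lambda>t. \<psi> t - L * weber_j t ^ k) holomorphic_on upper_half_plane"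
        by (intro holomorphic_intros Suc.prems(1) weber_j_holomorphic)
      show "\<psi> (moebius A t) - L * weber_j (moebius A t) ^ k = \<psi> t - L * weber_j t ^ k"
        if "A \<in> SL2" "Im t > 0" for A t
        using that by (simp add: Suc.prems(2) weber_j_invariant)
      show "(\<lambda>w. g w - L * J w ^ k) meromorphic_on {0}"
        by (intro meromorphic_intros J Suc.prems(3))
      show "eventually (\<lambda>t. \<psi> t - L * weber_j t ^ k =
          g (cusp_param (8 * M) t) - L * J (cusp_param (8 * M) t) ^ k) at_cusp"
        using Suc.prems(4) by eventually_elim (simp add: jJ w_def N_def)
      \<comment> \<open>Because \<open>G 0 = 1\<close>, the power of j scaled by \<open>L\<close>
        has exactly the leading coefficient that is to be removed.\<close>
      have "(\<lambda>w. g w * w ^ Suc m - L * G (w ^ M) ^ k) \<midarrow>0\<rightarrow> L - L * G (0 ^ M) ^ k"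
        using analytic_at_imp_isCont[OF GM] by (intro tendsto_intros Suc.prems(5)) (simp add: isCont_def)
      moreover have "eventually (\<lambda>w. g w * w ^ Suc m - L * G (w ^ M) ^ k = (g w - L * J w ^ k) * w ^ Suc m) (at 0)"
        unfolding eventually_at_filter
        by (intro always_eventually) (auto simp: J_def k power_divide power_mult field_simps simp del: power_Suc)
      ultimately have "(\<lambda>w. (g w - L * J w ^ k) * w ^ Suc m) \<midarrow>0\<rightarrow> L - L * G (0 ^ M) ^ k"
        by (rule Lim_transform_eventually)
      moreover have "L - L * G (0 ^ M) ^ k = 0" using M G(2) by (auto simp: power_0_left)
      ultimately show "(\<lambda>w. (g w - L * J w ^ k) * w ^ Suc m) \<midarrow>0\<rightarrow> 0" by (simp only:)
    qed
    then obtain p where p: "\<And>t. Im t > 0 \<Longrightarrow> \<psi> t - L * weber_j t ^ k = poly p (weber_j t)" by blast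
    have "\<forall>t. Im t > 0 \<longrightarrow> \<psi> t = poly (p + monom L k) (weber_j t)"
      using p by (auto simp: poly_monom algebra_simps)
    thus ?thesis by blast
  qed
qed

text \<open>Above some height the function is analytic, since \<open>g\<close> has no singularity in
  a punctured disc. The rest of the strip is compact and contains finitely many singularities, and
  invariance carries the clearing of poles from the strip to the whole half plane.\<close>

lemma level_one_meromorphic:
  assumes mero: "\<phi> meromorphic_on upper_half_plane"
    and inv: "\<And>A t. A \<in> SL2 \<Longrightarrow> Im t > 0 \<Longrightarrow> \<phi> (moebius A t) = \<phi> t"
    and N: "N > 0" and g: "g meromorphic_on {0}"
    and cusp: "eventually (\<lambda>t. \<phi> t = g (cusp_param N t)) at_cusp"
  shows "\<exists>p q. q \<noteq> 0 \<and> (\<forall>z. Im z > 0 \<longrightarrow> eventually (\<lambda>t. poly q (weber_j t) * \<phi> t = poly p (weber_j t)) (at z))"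
proof -
  have jan: "weber_j analytic_on {z}" if "Im z > 0" for z
    using weber_j_holomorphic open_upper_half_plane that by (simp add: analytic_at) blast
  have "isolated_singularity_at g 0" using g by (simp add: meromorphic_at_iff)
  then obtain r where r: "r > 0" "g analytic_on ball 0 r - {0}" by (auto simp: isolated_singularity_at_def)
  have "eventually (\<lambda>w. w \<in> ball 0 r - {0}) (at (0::complex))"
    using r by (intro eventually_at_in_open) auto
  hence "eventually (\<lambda>t. cusp_param N t \<in> ball 0 r - {0}) at_cusp"
    using filterlim_cusp_param[OF N] unfolding filterlim_iff by blast
  with cusp have "eventually (\<lambda>t. \<phi> t = g (cusp_param N t) \<and> cusp_param N t \<in> ball 0 r - {0}) at_cusp"
    by eventually_elim auto
  then obtain Y0 where Y0: "\<And>t. Im t > Y0 \<Longrightarrow> \<phi> t = g (cusp_param N t) \<and> cusp_param N t \<in> ball 0 r - {0}"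
    unfolding eventually_filtercomap_at_top_dense by blast
  \<comment> \<open>The maximum with 1 keeps the region above \<open>Y\<close> inside the upper half
    plane.\<close>
  define Y where "Y = max Y0 1"
  have an: "\<phi> analytic_on {z}" if "Im z > Y" for z
  proof -
    have op: "open {z. Im z > Y}" by (rule open_halfspace_Im_gt)
    have "(g \<circ> cusp_param N) analytic_on {z. Im z > Y}"
    proof (rule analytic_on_compose_gen[OF _ r(2)])
      show "cusp_param N analytic_on {z. Im z > Y}"
        unfolding cusp_param_def using N by (intro analytic_intros) auto
    qed (use Y0 in \<open>auto simp: Y_def\<close>)
    hence "g \<circ> cusp_param N holomorphic_on {z. Im z > Y}" by (rule analytic_imp_holomorphic)
    hence "\<phi> holomorphic_on {z. Im z > Y}"
      by (rule holomorphic_transform) (use Y0 in \<open>auto simp: Y_def\<close>)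
    thus ?thesis using op that by (simp add: analytic_at) blast
  qed
  define C where "C = cbox (Complex (-1/2) (1/2)) (Complex (1/2) Y)"
  have C: "z \<in> C \<longleftrightarrow> \<bar>Re z\<bar> \<le> 1/2 \<and> 1/2 \<le> Im z \<and> Im z \<le> Y" for z
    by (auto simp: C_def in_cbox_complex_iff abs_le_iff)
  define S where "S = C \<inter> {w. \<not> \<phi> analytic_on {w}}"
  have "{w. \<not> \<phi> analytic_on {w}} sparse_in C"
    using meromorphic_on_imp_sparse_singularities[OF mero] by (rule sparse_in_subset) (auto simp: C)
  hence finS: "finite S" unfolding S_def by (rule sparse_in_compact_finite) (simp add: C_def)
  have "\<exists>k c. (\<lambda>w. (weber_j w - weber_j z) ^ k * \<phi> w) \<midarrow>z\<rightarrow> c" if "z \<in> S" for z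
  proof (rule meromorphic_times_zero_power_tendsto)
    have z: "Im z > 0" using that by (auto simp: S_def C)
    show "\<phi> meromorphic_on {z}" using mero by (rule meromorphic_on_subset) (use z in auto)
    show "(\<lambda>w. weber_j w - weber_j z) analytic_on {z}" by (intro analytic_intros jan z)
  qed auto
  then obtain k where k: "\<And>z. z \<in> S \<Longrightarrow> \<exists>c. (\<lambda>w. (weber_j w - weber_j z) ^ k z * \<phi> w) \<midarrow>z\<rightarrow> c" by metis
  \<comment> \<open>One factor X - j(z) for each singularity in the strip, with an exponent large
    enough for a finite limit there.\<close>
  define q where "q = (\<Prod>z\<in>S. [:- weber_j z, 1:] ^ k z)"
  define D where "D = (\<lambda>t. poly q (weber_j t))"
  have D: "D t = (\<Prod>z\<in>S. (weber_j t - weber_j z) ^ k z)" for t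
    by (simp add: D_def q_def poly_prod)
  have q0: "q \<noteq> 0" using finS by (auto simp: q_def)
  define \<psi>0 where "\<psi>0 = (\<lambda>t. D t * \<phi> t)"
  have Dan: "D analytic_on {z}" if "Im z > 0" for z
    unfolding D by (intro analytic_intros jan that)
  have D_holo: "D holomorphic_on upper_half_plane"
    unfolding D by (intro holomorphic_intros weber_j_holomorphic)
  have mero0: "\<psi>0 meromorphic_on upper_half_plane"
    unfolding \<psi>0_def using D_holo open_upper_half_plane
    by (intro meromorphic_intros mero analytic_on_imp_meromorphic_on) (simp add: analytic_on_open)
  have inv0: "\<psi>0 (moebius A t) = \<psi>0 t" if "A \<in> SL2" "Im t > 0" for A t
    using that by (simp add: \<psi>0_def D_def inv weber_j_invariant)
  have lim_strip: "\<exists>c. \<psi>0 \<midarrow>z\<rightarrow> c" if z: "1/2 \<le> Im z" "\<bar>Re z\<bar> \<le> 1/2" for z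
  proof (cases "z \<in> S")
    case True
    then obtain c where c: "(\<lambda>w. (weber_j w - weber_j z) ^ k z * \<phi> w) \<midarrow>z\<rightarrow> c" using k by blast
    define E where "E = (\<lambda>t. \<Prod>y\<in>S - {z}. (weber_j t - weber_j y) ^ k y)"
    have "E analytic_on {z}" unfolding E_def using z by (intro analytic_intros jan) auto
    hence "E \<midarrow>z\<rightarrow> E z" using analytic_at_imp_isCont by (simp add: isCont_def)
    hence "(\<lambda>w. E w * ((weber_j w - weber_j z) ^ k z * \<phi> w)) \<midarrow>z\<rightarrow> E z * c" by (intro tendsto_intros c)
    also have "(\<lambda>w. E w * ((weber_j w - weber_j z) ^ k z * \<phi> w)) = \<psi>0"
      unfolding \<psi>0_def D E_def using finS True by (simp add: prod.remove[of S z] mult_ac fun_eq_iff)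
    finally show ?thesis by blast
  next
    case False
    hence "\<phi> analytic_on {z}" using an[of z] z by (cases "Im z \<le> Y") (auto simp: S_def C)
    hence "\<psi>0 analytic_on {z}" unfolding \<psi>0_def using z by (intro analytic_intros Dan) auto
    thus ?thesis using analytic_at_imp_isCont unfolding isCont_def by blast
  qed
  have lim0: "\<exists>c. \<psi>0 \<midarrow>z\<rightarrow> c" if z: "Im z > 0" for z
  proof -
    obtain A where A: "A \<in> SL2" "Im (moebius A z) \<ge> 1 / 2" "\<bar>Re (moebius A z)\<bar> \<le> 1 / 2"
      using SL2_reduction[OF z] by blast
    then obtain c where "\<psi>0 \<midarrow>moebius A z\<rightarrow> c" using lim_strip by blast
    hence "(\<lambda>w. \<psi>0 (moebius A w)) \<midarrow>z\<rightarrow> c" using tendsto_moebius_iff[OF A(1) z] by blast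
    moreover have "eventually (\<lambda>w. \<psi>0 (moebius A w) = \<psi>0 w) (at z)"
      using eventually_upper_half_plane_at[OF z] by eventually_elim (simp add: inv0 A(1))
    ultimately have "\<psi>0 \<midarrow>z\<rightarrow> c" by (rule Lim_transform_eventually)
    thus ?thesis ..
  qed
  define \<psi> where "\<psi> = remove_sings \<psi>0"
  have \<psi>_an: "\<psi> analytic_on {z}" if "Im z > 0" for z
    using lim0[OF that] remove_sings_analytic_at'[OF mero0] that unfolding \<psi>_def by blast
  obtain G where G: "G analytic_on {0}" "G 0 = 1"
    "\<And>t. weber_j t * cusp_param 1 t = G (cusp_param 8 t)"
    using weber_j_expansion by blast
  \<comment> \<open>Expansion of j in the parameter of width \<open>8 * N\<close>, the common
    refinement of the width 8 of j and the width \<open>N\<close> of the given function.\<close>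
  define gJ where "gJ = (\<lambda>w. G (w ^ N) / w ^ (8 * N))"
  define g' where "g' = (\<lambda>w. (\<Prod>z\<in>S. (gJ w - weber_j z) ^ k z) * g (w ^ 8))"
  have "(\<lambda>w. G (w ^ N)) analytic_on {0}"
    using G(1) N by (rule analytic_at_zero_compose_power)
  hence gJ: "gJ meromorphic_on {0}"
    unfolding gJ_def by (intro meromorphic_intros analytic_on_imp_meromorphic_on)
  have "(\<lambda>w. g (w ^ 8)) meromorphic_on {0}"
    by (rule meromorphic_on_compose[OF g]) (auto intro!: analytic_intros)
  hence g': "g' meromorphic_on {0}"
    unfolding g'_def by (intro meromorphic_intros gJ)
  obtain m c where mc: "(\<lambda>w. g' w * (w - 0) ^ m) \<midarrow>0\<rightarrow> c"
    using meromorphic_times_power_tendsto[OF g'] by blast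
  have "\<exists>p. \<forall>t. Im t > 0 \<longrightarrow> \<psi> t = poly p (weber_j t)"
  proof (rule level_one_holomorphic[OF _ _ N g'])
    show "\<psi> holomorphic_on upper_half_plane"
      using \<psi>_an analytic_on_analytic_at analytic_imp_holomorphic by (metis mem_Collect_eq)
    show "\<psi> (moebius A t) = \<psi> t" if "A \<in> SL2" "Im t > 0" for A t
      unfolding \<psi>_def using that inv0 by (intro remove_sings_moebius)
    have "eventually (\<lambda>t. Im t > Y) at_cusp" by (auto simp: eventually_filtercomap_at_top_dense)
    thus "eventually (\<lambda>t. \<psi> t = g' (cusp_param (8 * N) t)) at_cusp"
    proof eventually_elim
      case (elim t)
      have "Im t > 0" using elim by (simp add: Y_def)
      have "\<psi>0 analytic_on {t}" unfolding \<psi>0_def using \<open>Im t > 0\<close> an[OF elim] by (intro analytic_intros Dan)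
      hence "\<psi> t = D t * \<phi> t" unfolding \<psi>_def by (simp add: \<psi>0_def)
      moreover have w: "cusp_param (8 * N) t ^ N = cusp_param 8 t" "cusp_param (8 * N) t ^ (8 * N) = cusp_param 1 t"
         "cusp_param (8 * N) t ^ 8 = cusp_param N t"
        using cusp_param_mult[of N 8 t] cusp_param_mult[of "8 * N" 1 t] cusp_param_mult[of 8 N t] N
        by (simp_all add: mult.commute)
      moreover have "gJ (cusp_param (8 * N) t) = weber_j t"
        unfolding gJ_def w using G(3)[of t] by (simp add: cusp_param_def field_simps)
      moreover have "\<phi> t = g (cusp_param N t)" using Y0[of t] elim by (simp add: Y_def)
      ultimately show ?case by (simp add: g'_def D)
    qed
  qed (use mc in simp)
  then obtain p where p: "\<And>t. Im t > 0 \<Longrightarrow> \<psi> t = poly p (weber_j t)" by blast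
  have "eventually (\<lambda>t. poly q (weber_j t) * \<phi> t = poly p (weber_j t)) (at z)" if z: "Im z > 0" for z
  proof -
    have "isolated_singularity_at \<psi>0 z"
      using mero0 z by (auto simp: meromorphic_on_altdef)
    from eventually_remove_sings_eq_at[OF this] eventually_upper_half_plane_at[OF z]
    show ?thesis
      by eventually_elim (use p in \<open>auto simp: \<psi>_def \<psi>0_def D_def\<close>)
  qed
  thus ?thesis using q0 by blast
qed

section \<open>Polynomials in the Weber functions\<close>

lemma vector_4_nth [simp]:
  fixes w x y z :: "'a :: zero"
  shows "(vector [w, x, y, z] :: 'a ^ 4) $ 1 = w" "(vector [w, x, y, z] :: 'a ^ 4) $ 2 = x"
  "(vector [w, x, y, z] :: 'a ^ 4) $ 3 = y" "(vector [w, x, y, z] :: 'a ^ 4) $ 4 = z"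
  unfolding vector_def by simp_all

text \<open>Without finiteness the sums in \<open>forms\<close> would collapse to the default value
  0 of an infinite sum.\<close>

lemma finite_exponents: "finite {e :: 4 \<Rightarrow> nat. (\<Sum>i\<in>UNIV. e i) = d}"
proof (rule finite_subset)
  show "{e :: 4 \<Rightarrow> nat. (\<Sum>i\<in>UNIV. e i) = d} \<subseteq> (\<Pi>\<^sub>E i\<in>UNIV. {..d})"
    unfolding PiE_UNIV_domain using member_le_sum[of _ UNIV "_ :: 4 \<Rightarrow> nat"] by fastforce
qed (auto intro: finite_PiE)

lemma forms_monomial: "(\<lambda>x. \<Prod>i\<in>UNIV. (x $ i) ^ e i) \<in> forms (\<Sum>i\<in>UNIV. e i)"
proof -
  define d where "d = (\<Sum>i\<in>UNIV. e i)"
  have "(\<lambda>x :: complex ^ 4. \<Prod>i\<in>UNIV. (x $ i) ^ e i) =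
    (\<lambda>x. \<Sum>e' | (\<Sum>i\<in>UNIV. e' i) = d. (if e' = e then 1 else 0) * (\<Prod>i\<in>UNIV. (x $ i) ^ e' i))"
  proof
    fix x :: "complex ^ 4"
    have "(\<Sum>e' | (\<Sum>i\<in>UNIV. e' i) = d. (if e' = e then 1 else 0) * (\<Prod>i\<in>UNIV. (x $ i) ^ e' i)) =
      (\<Sum>e' | (\<Sum>i\<in>UNIV. e' i) = d. if e' = e then \<Prod>i\<in>UNIV. (x $ i) ^ e i else 0)"
      by (intro sum.cong) auto
    also have "\<dots> = (\<Prod>i\<in>UNIV. (x $ i) ^ e i)"
      by (subst sum.delta[OF finite_exponents]) (simp add: d_def)
    finally show "(\<Prod>i\<in>UNIV. (x $ i) ^ e i) =
      (\<Sum>e' | (\<Sum>i\<in>UNIV. e' i) = d. (if e' = e then 1 else 0) * (\<Prod>i\<in>UNIV. (x $ i) ^ e' i))" ..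
  qed
  thus ?thesis
    unfolding d_def[symmetric] unfolding forms_def mem_Collect_eq
    by (rule exI[of _ "\<lambda>e'. if e' = e then 1 else 0"])
qed

lemma forms_add:
  assumes "F \<in> forms d" "G \<in> forms d"
  shows "(\<lambda>x. F x + G x) \<in> forms d"
proof -
  obtain c c' where "F = (\<lambda>x. \<Sum>e | (\<Sum>i\<in>UNIV. e i) = d. c e * (\<Prod>i\<in>UNIV. (x $ i) ^ e i))"
    "G = (\<lambda>x. \<Sum>e | (\<Sum>i\<in>UNIV. e i) = d. c' e * (\<Prod>i\<in>UNIV. (x $ i) ^ e i))"
    using assms by (auto simp: forms_def)
  hence "(\<lambda>x. F x + G x) = (\<lambda>x. \<Sum>e | (\<Sum>i\<in>UNIV. e i) = d. (c e + c' e) * (\<Prod>i\<in>UNIV. (x $ i) ^ e i))"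
    by (simp add: sum.distrib distrib_right)
  thus ?thesis unfolding forms_def mem_Collect_eq by (rule exI[of _ "\<lambda>e. c e + c' e"])
qed

lemma forms_cmult:
  assumes "F \<in> forms d"
  shows "(\<lambda>x. a * F x) \<in> forms d"
proof -
  obtain c where "F = (\<lambda>x. \<Sum>e | (\<Sum>i\<in>UNIV. e i) = d. c e * (\<Prod>i\<in>UNIV. (x $ i) ^ e i))"
    using assms by (auto simp: forms_def)
  hence "(\<lambda>x. a * F x) = (\<lambda>x. \<Sum>e | (\<Sum>i\<in>UNIV. e i) = d. (a * c e) * (\<Prod>i\<in>UNIV. (x $ i) ^ e i))"
    by (simp add: sum_distrib_left mult.assoc)
  thus ?thesis unfolding forms_def mem_Collect_eq by (rule exI[of _ "\<lambda>e. a * c e"])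
qed

lemma forms_zero: "(\<lambda>_. 0) \<in> forms d"
  unfolding forms_def mem_Collect_eq by (rule exI[of _ "\<lambda>_. 0"]) simp

lemma forms_sum: "(\<And>i. i \<in> I \<Longrightarrow> F i \<in> forms d) \<Longrightarrow> (\<lambda>x. \<Sum>i\<in>I. F i x) \<in> forms d"
  by (induction I rule: infinite_finite_induct) (simp_all add: forms_zero forms_add)

lemma forms_mult:
  assumes "F \<in> forms d" "G \<in> forms d'"
  shows "(\<lambda>x. F x * G x) \<in> forms (d + d')"
proof -
  obtain c c' where FG: "F = (\<lambda>x. \<Sum>e | (\<Sum>i\<in>UNIV. e i) = d. c e * (\<Prod>i\<in>UNIV. (x $ i) ^ e i))"
    "G = (\<lambda>x. \<Sum>e | (\<Sum>i\<in>UNIV. e i) = d'. c' e * (\<Prod>i\<in>UNIV. (x $ i) ^ e i))"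
    using assms by (auto simp: forms_def)
  have "(\<lambda>x. F x * G x) = (\<lambda>x. \<Sum>e | (\<Sum>i\<in>UNIV. e i) = d. \<Sum>e' | (\<Sum>i\<in>UNIV. e' i) = d'.
      (c e * c' e') * (\<Prod>i\<in>UNIV. (x $ i) ^ (e i + e' i)))"
    unfolding FG sum_product by (intro ext sum.cong refl) (simp add: power_add prod.distrib mult_ac)
  also have "\<dots> \<in> forms (d + d')"
  proof (intro forms_sum forms_cmult)
    fix e e' :: "4 \<Rightarrow> nat"
    assume "e \<in> {e. (\<Sum>i\<in>UNIV. e i) = d}" "e' \<in> {e. (\<Sum>i\<in>UNIV. e i) = d'}"
    thus "(\<lambda>x. \<Prod>i\<in>UNIV. (x $ i) ^ (e i + e' i)) \<in> forms (d + d')"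
      using forms_monomial[of "\<lambda>i. e i + e' i"] by (simp add: sum.distrib)
  qed
  finally show ?thesis .
qed

lemma forms_const: "(\<lambda>_. a) \<in> forms 0"
  using forms_cmult[OF forms_monomial[of "\<lambda>_. 0"], of a] by simp

lemma forms_coordinate: "(\<lambda>x. x $ i) \<in> forms 1"
proof -
  have "(\<lambda>x. \<Prod>j\<in>UNIV. (x $ j) ^ (if j = i then 1 else 0)) = (\<lambda>x :: complex ^ 4. x $ i)"
    by (simp add: if_distrib[of "\<lambda>k. _ ^ k"] prod.delta cong: if_cong)
  thus ?thesis using forms_monomial[of "\<lambda>j. if j = i then 1 else 0"] by simp
qed

lemma forms_power: "F \<in> forms d \<Longrightarrow> (\<lambda>x. F x ^ n) \<in> forms (n * d)"
  by (induction n) (simp_all add: forms_const forms_mult)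

lemma form_scale:
  assumes "F \<in> forms d"
  shows "F (c *s x) = c ^ d * F x"
proof -
  obtain a where F: "F = (\<lambda>x. \<Sum>e | (\<Sum>i\<in>UNIV. e i) = d. a e * (\<Prod>i\<in>UNIV. (x $ i) ^ e i))"
    using assms by (auto simp: forms_def)
  have "F (c *s x) = (\<Sum>e | (\<Sum>i\<in>UNIV. e i) = d. a e * (c ^ d * (\<Prod>i\<in>UNIV. (x $ i) ^ e i)))"
    unfolding F by (intro sum.cong) (auto simp: power_mult_distrib prod.distrib power_sum)
  thus ?thesis by (simp add: F sum_distrib_left mult_ac)
qed

lemma form_holomorphic:
  fixes v :: "complex \<Rightarrow> complex ^ 4"
  assumes "F \<in> forms d" "\<And>i. (\<lambda>t. v t $ i) holomorphic_on S"
  shows "(\<lambda>t. F (v t)) holomorphic_on S"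
  using assms(1) unfolding forms_def by (auto intro!: holomorphic_intros assms(2))

lemma form_meromorphic:
  fixes v :: "complex \<Rightarrow> complex ^ 4"
  assumes "F \<in> forms d" "\<And>i. (\<lambda>w. v w $ i) meromorphic_on S"
  shows "(\<lambda>w. F (v w)) meromorphic_on S"
  using assms(1) unfolding forms_def by (auto intro!: meromorphic_intros assms(2))

section \<open>Forms evaluated along the parametrization\<close>

lemma weber_param_nth:
  "weber_param 4 t $ 1 = weber_x0 t" "weber_param 4 t $ 2 = weber_x1 t"
  "weber_param 4 t $ 3 = weber_x2 t" "weber_param 4 t $ 4 = 1"
  by (simp_all add: weber_param_4)

lemma weber_form_holomorphic:
  assumes "F \<in> forms d"
  shows "(\<lambda>t. F (weber_param 4 t)) holomorphic_on upper_half_plane"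
proof (rule form_holomorphic[OF assms])
  have "\<forall>i. (\<lambda>t. weber_param 4 t $ i) holomorphic_on upper_half_plane"
    by (auto simp: forall_4 weber_param_nth intro: weber_x_holomorphic)
  thus "(\<lambda>t. weber_param 4 t $ i) holomorphic_on upper_half_plane" for i ..
qed

lemma weber_param_invariant:
  assumes "A \<in> split_cartan 8" "Im t > 0"
  shows "weber_param 4 (moebius A t) = weber_param 4 t"
proof -
  have "weber_fixes A" using assms(1) weber_fixes_iff by (auto simp: split_cartan_def)
  thus ?thesis using assms(2) by (simp add: weber_param_4 weber_fixes_def)
qed

text \<open>A modular substitution permutes the first three coordinates up to constants, so the
  expansion at any cusp is the form evaluated at rearranged expansions at infinity, all in width
  8.\<close>

lemma weber_form_cusp:
  assumes "F \<in> forms d" "A \<in> SL2"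
  obtains g where "g meromorphic_on {0}" "\<forall>t. Im t > 0 \<longrightarrow> F (weber_param 4 (moebius A t)) = g (cusp_param 8 t)"
proof -
  obtain f0 f1 f2 c0 c1 c2 where "weber_permutes A f0 f1 f2 c0 c1 c2"
    using assms(2) by (rule weber_x_SL2)
  note * = weber_permutesD[OF this]
  have "\<exists>g. g meromorphic_on {0} \<and> (\<forall>t. f t = g (cusp_param 8 t))" if "f \<in> {weber_x0, weber_x1, weber_x2}" for f
    using that weber_x_expansion weber_g_meromorphic by blast
  hence "\<exists>g0. g0 meromorphic_on {0} \<and> (\<forall>t. f0 t = g0 (cusp_param 8 t))"
    "\<exists>g1. g1 meromorphic_on {0} \<and> (\<forall>t. f1 t = g1 (cusp_param 8 t))"
    "\<exists>g2. g2 meromorphic_on {0} \<and> (\<forall>t. f2 t = g2 (cusp_param 8 t))"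
    using *(7) by blast+
  then obtain g0 g1 g2 where g: "g0 meromorphic_on {0}" "g1 meromorphic_on {0}" "g2 meromorphic_on {0}"
    "\<And>t. f0 t = g0 (cusp_param 8 t)" "\<And>t. f1 t = g1 (cusp_param 8 t)" "\<And>t. f2 t = g2 (cusp_param 8 t)"
    by blast
  define v :: "complex \<Rightarrow> complex ^ 4" where "v = (\<lambda>w. vector [c0 * g0 w, c1 * g1 w, c2 * g2 w, 1])"
  have "\<forall>i. (\<lambda>w. v w $ i) meromorphic_on {0}"
    by (auto simp: forall_4 v_def intro!: meromorphic_intros g)
  hence "(\<lambda>w. F (v w)) meromorphic_on {0}" by (intro form_meromorphic[OF assms(1)]) auto
  moreover have "\<forall>t. Im t > 0 \<longrightarrow> F (weber_param 4 (moebius A t)) = F (v (cusp_param 8 t))"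
    using * g by (simp add: weber_param_4 v_def)
  ultimately show thesis by (rule that)
qed

text \<open>All polynomials in x0, x1, x2, homogenized by the last coordinate 1. Only the values on
  the upper half plane are prescribed, so such functions can be replaced freely by others agreeing
  there.\<close>

definition weber_polys :: "(complex \<Rightarrow> complex) set" where
  "weber_polys = {p. \<exists>d. \<exists>F\<in>forms d. \<forall>t. Im t > 0 \<longrightarrow> p t = F (weber_param 4 t)}"

lemma weber_polys_I: "F \<in> forms d \<Longrightarrow> (\<And>t. Im t > 0 \<Longrightarrow> p t = F (weber_param 4 t)) \<Longrightarrow> p \<in> weber_polys"
  by (auto simp: weber_polys_def)

text \<open>Since the last coordinate is 1, multiplying by a power of it adjusts the degree.\<close>
lemma weber_polys_pad:
  assumes "F \<in> forms d"
  shows "(\<lambda>x. F x * (x $ 4) ^ n) \<in> forms (d + n)" "F (weber_param 4 t) * (weber_param 4 t $ 4) ^ n = F (weber_param 4 t)"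
  using forms_mult[OF assms forms_power[OF forms_coordinate, of 4 n]] by (simp_all add: weber_param_nth)

lemma weber_polys_common_degree:
  assumes "p \<in> weber_polys" "q \<in> weber_polys"
  obtains d F G where "F \<in> forms d" "G \<in> forms d" "\<forall>t. Im t > 0 \<longrightarrow> p t = F (weber_param 4 t) \<and> q t = G (weber_param 4 t)"
proof -
  obtain d d' F G where FG: "F \<in> forms d" "G \<in> forms d'"
    "\<And>t. Im t > 0 \<Longrightarrow> p t = F (weber_param 4 t)" "\<And>t. Im t > 0 \<Longrightarrow> q t = G (weber_param 4 t)"
    using assms by (auto simp: weber_polys_def)
  show thesis
    using that[of "\<lambda>x. F x * (x $ 4) ^ d'" "d + d'" "\<lambda>x. G x * (x $ 4) ^ d"]
      weber_polys_pad[OF FG(1), where n = d'] weber_polys_pad[OF FG(2), where n = d] FG by (simp add: add.commute)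
qed

lemma weber_polys_const [simp, intro]: "(\<lambda>_. a) \<in> weber_polys"
  using weber_polys_I[OF forms_const] by auto

lemma weber_polys_x: "weber_x0 \<in> weber_polys" "weber_x1 \<in> weber_polys" "weber_x2 \<in> weber_polys"
  by (rule weber_polys_I[OF forms_coordinate], rule weber_param_nth[symmetric])+

lemma weber_polys_mult:
  assumes "p \<in> weber_polys" "q \<in> weber_polys"
  shows "(\<lambda>t. p t * q t) \<in> weber_polys"
proof -
  obtain d F G where "F \<in> forms d" "G \<in> forms d" "\<forall>t. Im t > 0 \<longrightarrow> p t = F (weber_param 4 t) \<and> q t = G (weber_param 4 t)"
    using assms by (rule weber_polys_common_degree)
  thus ?thesis by (intro weber_polys_I[OF forms_mult]) auto
qed

lemma weber_polys_add:
  assumes "p \<in> weber_polys" "q \<in> weber_polys"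
  shows "(\<lambda>t. p t + q t) \<in> weber_polys"
proof -
  obtain d F G where "F \<in> forms d" "G \<in> forms d" "\<forall>t. Im t > 0 \<longrightarrow> p t = F (weber_param 4 t) \<and> q t = G (weber_param 4 t)"
    using assms by (rule weber_polys_common_degree)
  thus ?thesis by (intro weber_polys_I[OF forms_add]) auto
qed

lemma weber_polys_uminus: "p \<in> weber_polys \<Longrightarrow> (\<lambda>t. - p t) \<in> weber_polys"
  using weber_polys_mult[of "\<lambda>_. - 1" p] by simp

lemma weber_polys_diff: "p \<in> weber_polys \<Longrightarrow> q \<in> weber_polys \<Longrightarrow> (\<lambda>t. p t - q t) \<in> weber_polys"
  using weber_polys_add[OF _ weber_polys_uminus, of p q] by simp

lemma weber_polys_power: "p \<in> weber_polys \<Longrightarrow> (\<lambda>t. p t ^ n) \<in> weber_polys"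
  by (induction n) (auto intro: weber_polys_mult)

lemma weber_polys_prod: "(\<And>i. i \<in> I \<Longrightarrow> p i \<in> weber_polys) \<Longrightarrow> (\<lambda>t. \<Prod>i\<in>I. p i t) \<in> weber_polys"
  by (induction I rule: infinite_finite_induct) (auto intro: weber_polys_mult)

lemma weber_j_weber_polys: "weber_j \<in> weber_polys"
  unfolding weber_j_def[abs_def]
  by (intro weber_polys_uminus weber_polys_add weber_polys_mult weber_polys_power weber_polys_x)

lemma poly_weber_polys: "f \<in> weber_polys \<Longrightarrow> (\<lambda>t. poly p (f t)) \<in> weber_polys"
  by (induction p) (auto intro!: weber_polys_add weber_polys_mult)

lemma weber_polys_holomorphic:
  assumes "p \<in> weber_polys"
  shows "p holomorphic_on upper_half_plane"
proof -
  obtain d F where F: "F \<in> forms d" "\<And>t. Im t > 0 \<Longrightarrow> p t = F (weber_param 4 t)"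
    using assms by (auto simp: weber_polys_def)
  show ?thesis
    by (rule holomorphic_transform[OF weber_form_holomorphic[OF F(1)]]) (simp add: F(2))
qed

lemma weber_polys_meromorphic: "p \<in> weber_polys \<Longrightarrow> p meromorphic_on upper_half_plane"
  using weber_polys_holomorphic open_upper_half_plane
  by (intro analytic_on_imp_meromorphic_on) (simp add: analytic_on_open)

lemma weber_polys_invariant:
  assumes "p \<in> weber_polys" "A \<in> split_cartan 8" "Im t > 0"
  shows "p (moebius A t) = p t"
proof -
  obtain d F where F: "F \<in> forms d" "\<And>t. Im t > 0 \<Longrightarrow> p t = F (weber_param 4 t)"
    using assms by (auto simp: weber_polys_def)
  have "Im (moebius A t) > 0"
    using assms moebius_in_upper_half_plane by (auto simp: split_cartan_def)
  thus ?thesis using F(2) assms(3) weber_param_invariant[OF assms(2,3)] by simp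
qed

lemma weber_polys_cusp:
  assumes "p \<in> weber_polys" "A \<in> SL2"
  obtains g where "g meromorphic_on {0}" "\<forall>t. Im t > 0 \<longrightarrow> p (moebius A t) = g (cusp_param 8 t)"
proof -
  obtain d F where F: "F \<in> forms d" "\<And>t. Im t > 0 \<Longrightarrow> p t = F (weber_param 4 t)"
    using assms by (auto simp: weber_polys_def)
  obtain g where "g meromorphic_on {0}" "\<forall>t. Im t > 0 \<longrightarrow> F (weber_param 4 (moebius A t)) = g (cusp_param 8 t)"
    using F(1) assms(2) by (rule weber_form_cusp)
  thus thesis using that F(2) moebius_in_upper_half_plane[OF assms(2)] by metis
qed

section \<open>Rational expressions in the Weber functions\<close>

lemma nonzero_eventually:
  assumes "p holomorphic_on upper_half_plane" "Im t > 0" "p t \<noteq> 0" "Im z > 0"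
  shows "eventually (\<lambda>w. p w \<noteq> 0) (at z)"
  using non_zero_neighbour_alt[OF assms(1) open_upper_half_plane connected_upper_half_plane, of z t] assms
  by (auto elim: eventually_mono)

lemma eventually_at_upper_half_plane_ex:
  assumes "eventually P (at z)" "Im z > 0"
  obtains t where "Im t > 0" "P t"
  using eventually_happens[OF eventually_conj[OF assms(1) eventually_upper_half_plane_at[OF assms(2)]]]
  by auto

lemma holomorphic_mult_nonzero:
  assumes "p holomorphic_on upper_half_plane" "q holomorphic_on upper_half_plane"
    and "\<exists>t. Im t > 0 \<and> p t \<noteq> 0" "\<exists>t. Im t > 0 \<and> q t \<noteq> 0"
  shows "\<exists>t. Im t > 0 \<and> p t * q t \<noteq> 0"
proof -
  have i: "Im \<i> > 0" by simp
  have "eventually (\<lambda>w. p w \<noteq> 0) (at \<i>)" "eventually (\<lambda>w. q w \<noteq> 0) (at \<i>)"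
    using assms nonzero_eventually i by blast+
  hence "eventually (\<lambda>w. p w * q w \<noteq> 0) (at \<i>)" by eventually_elim simp
  thus ?thesis using eventually_at_upper_half_plane_ex i by blast
qed

text \<open>The relation is asked for on punctured neighbourhoods of all points, which makes it
  insensitive to values at poles; sums and products need no normalization.\<close>

definition weber_rational :: "(complex \<Rightarrow> complex) \<Rightarrow> bool" where
  "weber_rational \<phi> \<longleftrightarrow> (\<exists>p\<in>weber_polys. \<exists>q\<in>weber_polys. (\<exists>t. Im t > 0 \<and> q t \<noteq> 0) \<and>
     (\<forall>z. Im z > 0 \<longrightarrow> eventually (\<lambda>t. q t * \<phi> t = p t) (at z)))"

lemma weber_rational_I:
  assumes "p \<in> weber_polys" "q \<in> weber_polys" "\<exists>t. Im t > 0 \<and> q t \<noteq> 0"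
    "\<And>z. Im z > 0 \<Longrightarrow> eventually (\<lambda>t. q t * \<phi> t = p t) (at z)"
  shows "weber_rational \<phi>"
  using assms unfolding weber_rational_def by blast

lemma weber_rational_E:
  assumes "weber_rational \<phi>"
  obtains p q where "p \<in> weber_polys" "q \<in> weber_polys" "\<exists>t. Im t > 0 \<and> q t \<noteq> 0"
    "\<forall>z. Im z > 0 \<longrightarrow> eventually (\<lambda>t. q t * \<phi> t = p t) (at z)"
  using assms unfolding weber_rational_def by blast

lemma weber_rational_weber_polys: "p \<in> weber_polys \<Longrightarrow> weber_rational p"
  by (rule weber_rational_I[of p "\<lambda>_. 1"]) (auto intro: exI[of _ \<i>])

lemma weber_rational_mult:
  assumes "weber_rational \<phi>" "weber_rational \<psi>"
  shows "weber_rational (\<lambda>t. \<phi> t * \<psi> t)"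
proof -
  obtain p q where pq: "p \<in> weber_polys" "q \<in> weber_polys" "\<exists>t. Im t > 0 \<and> q t \<noteq> 0"
    "\<forall>z. Im z > 0 \<longrightarrow> eventually (\<lambda>t. q t * \<phi> t = p t) (at z)" using assms(1) by (rule weber_rational_E)
  obtain r s where rs: "r \<in> weber_polys" "s \<in> weber_polys" "\<exists>t. Im t > 0 \<and> s t \<noteq> 0"
    "\<forall>z. Im z > 0 \<longrightarrow> eventually (\<lambda>t. s t * \<psi> t = r t) (at z)" using assms(2) by (rule weber_rational_E)
  show ?thesis
  proof (rule weber_rational_I[of "\<lambda>t. p t * r t" "\<lambda>t. q t * s t"])
    show "\<exists>t. Im t > 0 \<and> q t * s t \<noteq> 0"
      using pq rs by (intro holomorphic_mult_nonzero weber_polys_holomorphic)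
    fix z assume z: "Im z > 0"
    have "eventually (\<lambda>t. q t * \<phi> t = p t) (at z)" "eventually (\<lambda>t. s t * \<psi> t = r t) (at z)"
      using pq rs z by auto
    thus "eventually (\<lambda>t. q t * s t * (\<phi> t * \<psi> t) = p t * r t) (at z)"
    proof eventually_elim
      case (elim t)
      thus ?case unfolding elim[symmetric] by (simp only: mult_ac)
    qed
  qed (use pq rs in \<open>auto intro: weber_polys_mult\<close>)
qed

lemma weber_rational_add:
  assumes "weber_rational \<phi>" "weber_rational \<psi>"
  shows "weber_rational (\<lambda>t. \<phi> t + \<psi> t)"
proof -
  obtain p q where pq: "p \<in> weber_polys" "q \<in> weber_polys" "\<exists>t. Im t > 0 \<and> q t \<noteq> 0"
    "\<forall>z. Im z > 0 \<longrightarrow> eventually (\<lambda>t. q t * \<phi> t = p t) (at z)" using assms(1) by (rule weber_rational_E)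
  obtain r s where rs: "r \<in> weber_polys" "s \<in> weber_polys" "\<exists>t. Im t > 0 \<and> s t \<noteq> 0"
    "\<forall>z. Im z > 0 \<longrightarrow> eventually (\<lambda>t. s t * \<psi> t = r t) (at z)" using assms(2) by (rule weber_rational_E)
  show ?thesis
  proof (rule weber_rational_I[of "\<lambda>t. p t * s t + r t * q t" "\<lambda>t. q t * s t"])
    show "\<exists>t. Im t > 0 \<and> q t * s t \<noteq> 0"
      using pq rs by (intro holomorphic_mult_nonzero weber_polys_holomorphic)
    fix z assume z: "Im z > 0"
    have "eventually (\<lambda>t. q t * \<phi> t = p t) (at z)" "eventually (\<lambda>t. s t * \<psi> t = r t) (at z)"
      using pq rs z by auto
    thus "eventually (\<lambda>t. q t * s t * (\<phi> t + \<psi> t) = p t * s t + r t * q t) (at z)"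
    proof eventually_elim
      case (elim t)
      thus ?case unfolding elim[symmetric] by (simp only: algebra_simps)
    qed
  qed (use pq rs in \<open>auto intro: weber_polys_mult weber_polys_add\<close>)
qed

lemma weber_rational_sum: "(\<And>i. i \<in> I \<Longrightarrow> weber_rational (\<phi> i)) \<Longrightarrow> weber_rational (\<lambda>t. \<Sum>i\<in>I. \<phi> i t)"
  by (induction I rule: infinite_finite_induct) (auto intro: weber_rational_add weber_rational_weber_polys)

lemma weber_rational_divide:
  assumes "weber_rational \<psi>" "p \<in> weber_polys" "\<exists>t. Im t > 0 \<and> p t \<noteq> 0"
    and "\<And>t. Im t > 0 \<Longrightarrow> p t * \<phi> t = \<psi> t"
  shows "weber_rational \<phi>"
proof -
  obtain r s where rs: "r \<in> weber_polys" "s \<in> weber_polys" "\<exists>t. Im t > 0 \<and> s t \<noteq> 0"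
    "\<forall>z. Im z > 0 \<longrightarrow> eventually (\<lambda>t. s t * \<psi> t = r t) (at z)" using assms(1) by (rule weber_rational_E)
  show ?thesis
  proof (rule weber_rational_I[of r "\<lambda>t. s t * p t"])
    show "\<exists>t. Im t > 0 \<and> s t * p t \<noteq> 0"
      using assms rs by (intro holomorphic_mult_nonzero weber_polys_holomorphic)
    fix z assume z: "Im z > 0"
    have "eventually (\<lambda>t. s t * \<psi> t = r t) (at z)" using rs z by auto
    thus "eventually (\<lambda>t. s t * p t * \<phi> t = r t) (at z)"
      using eventually_upper_half_plane_at[OF z] by eventually_elim (simp add: assms(4) mult.assoc)
  qed (use assms rs in \<open>auto intro: weber_polys_mult\<close>)
qed

lemma level_one_weber_rational:
  assumes "\<phi> meromorphic_on upper_half_plane"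
    and "\<And>A t. A \<in> SL2 \<Longrightarrow> Im t > 0 \<Longrightarrow> \<phi> (moebius A t) = \<phi> t"
    and "N > 0" and "g meromorphic_on {0}"
    and "eventually (\<lambda>t. \<phi> t = g (cusp_param N t)) at_cusp"
  shows "weber_rational \<phi>"
proof -
  obtain p q where "q \<noteq> 0"
    "\<And>z. Im z > 0 \<Longrightarrow> eventually (\<lambda>t. poly q (weber_j t) * \<phi> t = poly p (weber_j t)) (at z)"
    using level_one_meromorphic[OF assms] by blast
  thus ?thesis
    using poly_weber_j_nonzero[of q]
    by (intro weber_rational_I[of "\<lambda>t. poly p (weber_j t)" "\<lambda>t. poly q (weber_j t)"]
        poly_weber_polys weber_j_weber_polys) auto
qed

section \<open>Averaging over cosets\<close>

text \<open>On determinant one the classes are the cosets of Gamma(8). They refine those of the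
  split Cartan group, are finite in number for evident reasons, and are compatible with right
  multiplication.\<close>

definition cong8 :: "int ^ 2 ^ 2 \<Rightarrow> int ^ 2 ^ 2 \<Rightarrow> bool" where
  "cong8 A B \<longleftrightarrow> (\<forall>i j. A $ i $ j mod 8 = B $ i $ j mod 8)"

lemma cong8_refl: "cong8 A A"
  by (simp add: cong8_def)

lemma cong8_sym: "cong8 A B \<Longrightarrow> cong8 B A"
  by (simp add: cong8_def)

lemma cong8_trans: "cong8 A B \<Longrightarrow> cong8 B C \<Longrightarrow> cong8 A C"
  by (simp add: cong8_def)

lemma cong8_mult: "cong8 A A' \<Longrightarrow> cong8 (A ** B) (A' ** B)"
  by (auto simp: cong8_def matrix_matrix_mult_def sum_2 intro!: mod_add_cong mod_mult_cong)

lemma cong8_mult_cancel: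
  assumes "B \<in> SL2" "cong8 (A ** B) (A' ** B)"
  shows "cong8 A A'"
  using cong8_mult[OF assms(2), of "adj2 B"] SL2_adj_mult(1)[OF assms(1)]
  by (simp flip: matrix_mul_assoc)

lemma split_cartan_iff_cong8:
  "A \<in> split_cartan 8 \<longleftrightarrow> A \<in> SL2 \<and> A $ 1 $ 2 mod 8 = 0 \<and> A $ 2 $ 1 mod 8 = 0"
  by (auto simp: split_cartan_def)

lemma split_cartan_SL2: "A \<in> split_cartan N \<Longrightarrow> A \<in> SL2"
  by (simp add: split_cartan_def)

lemma split_cartan_adj: "A \<in> SL2 \<Longrightarrow> adj2 A \<in> split_cartan 8 \<longleftrightarrow> A \<in> split_cartan 8"
  using SL2_adj by (auto simp: split_cartan_def adj2_def)

lemma cong8_quotient: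
  assumes "A \<in> SL2" "B \<in> SL2" "cong8 A B"
  shows "A ** adj2 B \<in> split_cartan 8"
proof -
  have c: "cong8 (A ** adj2 B) (mat 1)"
    using cong8_mult[OF assms(3), of "adj2 B"] SL2_adj_mult(1)[OF assms(2)] by simp
  have "A ** adj2 B \<in> SL2" using assms SL2_adj SL2_mult by blast
  thus ?thesis using c unfolding split_cartan_iff_cong8 cong8_def by (auto simp: mat_1_mat2 forall_2)
qed

definition cosets_invariant :: "(complex \<Rightarrow> complex) \<Rightarrow> bool" where
  "cosets_invariant \<phi> \<longleftrightarrow> (\<forall>A\<in>split_cartan 8. \<forall>t. Im t > 0 \<longrightarrow> \<phi> (moebius A t) = \<phi> t)"

lemma cosets_invariant_cong8:
  assumes "cosets_invariant \<phi>" "A \<in> SL2" "B \<in> SL2" "cong8 A B" "Im t > 0"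
  shows "\<phi> (moebius A t) = \<phi> (moebius B t)"
proof -
  have C: "A ** adj2 B \<in> split_cartan 8" using assms by (intro cong8_quotient)
  have "A = (A ** adj2 B) ** B"
    using SL2_adj_mult(2)[OF assms(3)] by (simp flip: matrix_mul_assoc)
  hence "moebius A t = moebius (A ** adj2 B) (moebius B t)"
    using moebius_mult[OF split_cartan_SL2[OF C] assms(3,5)] by simp
  thus ?thesis
    using assms(1) C moebius_in_upper_half_plane[OF assms(3,5)] by (simp add: cosets_invariant_def)
qed

text \<open>Congruent matrices have the same set of candidates, hence the same choice; this makes
  the representative a function of the class.\<close>

definition coset_rep :: "int ^ 2 ^ 2 \<Rightarrow> int ^ 2 ^ 2" where
  "coset_rep A = (SOME B. B \<in> SL2 \<and> cong8 B A)"

definition coset_reps :: "(int ^ 2 ^ 2) set" where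
  "coset_reps = coset_rep ` SL2"

lemma coset_rep:
  assumes "A \<in> SL2"
  shows "coset_rep A \<in> SL2" "cong8 (coset_rep A) A"
  using someI[of "\<lambda>B. B \<in> SL2 \<and> cong8 B A" A] assms cong8_refl by (auto simp: coset_rep_def)

lemma coset_rep_cong: "cong8 A B \<Longrightarrow> coset_rep A = coset_rep B"
  unfolding coset_rep_def using cong8_trans cong8_sym by (intro arg_cong[of _ _ Eps]) blast

lemma coset_reps_SL2: "r \<in> coset_reps \<Longrightarrow> r \<in> SL2"
  using coset_rep by (auto simp: coset_reps_def)

lemma coset_reps_eq:
  assumes "r \<in> coset_reps" "s \<in> coset_reps" "cong8 r s"
  shows "r = s"
proof -
  obtain A B where A: "A \<in> SL2" "r = coset_rep A" and B: "B \<in> SL2" "s = coset_rep B"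
    using assms by (auto simp: coset_reps_def)
  have "cong8 A B"
    using coset_rep[OF A(1)] coset_rep[OF B(1)] assms(3) A(2) B(2) cong8_trans cong8_sym by blast
  thus ?thesis using A B coset_rep_cong by simp
qed

lemma finite_coset_reps: "finite coset_reps"
proof (rule finite_imageD)
  define m where "m = (\<lambda>A :: int ^ 2 ^ 2. (A $ 1 $ 1 mod 8, A $ 1 $ 2 mod 8, A $ 2 $ 1 mod 8, A $ 2 $ 2 mod 8))"
  have "m ` coset_reps \<subseteq> {0..<8} \<times> {0..<8} \<times> {0..<8} \<times> {0..<8}"
    by (auto simp: m_def)
  thus "finite (m ` coset_reps)" by (rule finite_subset) auto
  show "inj_on m coset_reps"
    by (intro inj_onI coset_reps_eq) (auto simp: m_def cong8_def forall_2)
qed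

definition coset_trace :: "(complex \<Rightarrow> complex) \<Rightarrow> complex \<Rightarrow> complex" where
  "coset_trace \<phi> t = (\<Sum>r\<in>coset_reps. \<phi> (moebius r t))"

text \<open>Right multiplication by \<open>B\<close> permutes the finitely many classes, and an
  invariant function takes the same values along congruent matrices.\<close>

lemma coset_trace_invariant:
  assumes "cosets_invariant \<phi>" "B \<in> SL2" "Im t > 0"
  shows "coset_trace \<phi> (moebius B t) = coset_trace \<phi> t"
proof -
  define \<pi> where "\<pi> = (\<lambda>r. coset_rep (r ** B))"
  have SL: "r ** B \<in> SL2" if "r \<in> coset_reps" for r
    using that assms(2) coset_reps_SL2 SL2_mult by blast
  have "inj_on \<pi> coset_reps"
  proof (rule inj_onI)
    fix r s assume rs: "r \<in> coset_reps" "s \<in> coset_reps" "\<pi> r = \<pi> s"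
    hence "cong8 (r ** B) (s ** B)"
      using coset_rep(2)[OF SL[OF rs(1)]] coset_rep(2)[OF SL[OF rs(2)]] cong8_trans cong8_sym
      unfolding \<pi>_def by metis
    thus "r = s" using coset_reps_eq rs cong8_mult_cancel[OF assms(2)] by blast
  qed
  moreover have "\<pi> ` coset_reps \<subseteq> coset_reps"
    using SL by (auto simp: \<pi>_def coset_reps_def)
  ultimately have bij: "bij_betw \<pi> coset_reps coset_reps"
    using endo_inj_surj[OF finite_coset_reps] by (simp add: bij_betw_def)
  have "coset_trace \<phi> (moebius B t) = (\<Sum>r\<in>coset_reps. \<phi> (moebius (\<pi> r) t))"
    unfolding coset_trace_def
  proof (rule sum.cong[OF refl])
    fix r assume r: "r \<in> coset_reps"
    have "\<phi> (moebius r (moebius B t)) = \<phi> (moebius (r ** B) t)"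
      using moebius_mult[OF coset_reps_SL2[OF r] assms(2,3)] by simp
    also have "\<dots> = \<phi> (moebius (\<pi> r) t)"
      using cosets_invariant_cong8[OF assms(1) coset_rep(1)[OF SL[OF r]] SL[OF r] coset_rep(2)[OF SL[OF r]] assms(3)]
      by (simp add: \<pi>_def)
    finally show "\<phi> (moebius r (moebius B t)) = \<phi> (moebius (\<pi> r) t)" .
  qed
  also have "\<dots> = coset_trace \<phi> t"
    unfolding coset_trace_def using sum.reindex_bij_betw[OF bij] .
  finally show ?thesis .
qed

text \<open>Only the cusp at infinity is considered; the other cusps are reached by composing with a
  modular substitution. The width is left free so that functions of different widths can be
  combined.\<close>

definition mero_at_cusp :: "(complex \<Rightarrow> complex) \<Rightarrow> bool" where
  "mero_at_cusp \<phi> \<longleftrightarrow> (\<exists>N>0. \<exists>g. g meromorphic_on {0} \<and> eventually (\<lambda>t. \<phi> t = g (cusp_param N t)) at_cusp)"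

text \<open>Widths \<open>N\<close> and \<open>M\<close> are brought to the common width
  \<open>N * M\<close>, where each old parameter is a power of the new one.\<close>

lemma mero_at_cusp_binop:
  assumes "mero_at_cusp \<phi>" "mero_at_cusp \<psi>"
    and op: "\<And>f g. f meromorphic_on {0} \<Longrightarrow> g meromorphic_on {0} \<Longrightarrow> (\<lambda>w. h (f w) (g w)) meromorphic_on {0}"
  shows "mero_at_cusp (\<lambda>t. h (\<phi> t) (\<psi> t))"
proof -
  obtain N f where f: "N > 0" "f meromorphic_on {0}" "eventually (\<lambda>t. \<phi> t = f (cusp_param N t)) at_cusp"
    using assms(1) by (auto simp: mero_at_cusp_def)
  obtain M g where g: "M > 0" "g meromorphic_on {0}" "eventually (\<lambda>t. \<psi> t = g (cusp_param M t)) at_cusp"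
    using assms(2) by (auto simp: mero_at_cusp_def)
  have pow: "(\<lambda>w. k (w ^ n)) meromorphic_on {0}" if "k meromorphic_on {0}" "n > 0" for k :: "complex \<Rightarrow> complex" and n
    by (rule meromorphic_on_compose[OF that(1)]) (use that in \<open>auto intro!: analytic_intros\<close>)
  have "(\<lambda>w. h (f (w ^ M)) (g (w ^ N))) meromorphic_on {0}"
    by (intro op pow f g)
  moreover have "eventually (\<lambda>t. h (\<phi> t) (\<psi> t) = h (f (cusp_param (N * M) t ^ M)) (g (cusp_param (N * M) t ^ N))) at_cusp"
    using f(3) g(3)
    by eventually_elim (use f(1) g(1) cusp_param_mult[of N M] cusp_param_mult[of M N] in \<open>simp add: mult.commute\<close>)
  ultimately show ?thesis using f(1) g(1) unfolding mero_at_cusp_def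
    by (intro exI[of _ "N * M"] conjI exI[of _ "\<lambda>w. h (f (w ^ M)) (g (w ^ N))"]) auto
qed

lemma mero_at_cusp_const: "mero_at_cusp (\<lambda>_. c)"
  unfolding mero_at_cusp_def by (intro exI[of _ 1] conjI exI[of _ "\<lambda>_. c"]) auto

lemma mero_at_cusp_sum: "(\<And>i. i \<in> I \<Longrightarrow> mero_at_cusp (\<phi> i)) \<Longrightarrow> mero_at_cusp (\<lambda>t. \<Sum>i\<in>I. \<phi> i t)"
  by (induction I rule: infinite_finite_induct)
     (auto intro!: mero_at_cusp_const mero_at_cusp_binop[of _ _ "(+)"] meromorphic_intros)

lemma mero_at_cusp_weber_polys:
  assumes "p \<in> weber_polys" "A \<in> SL2"
  shows "mero_at_cusp (\<lambda>t. p (moebius A t))"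
proof -
  obtain g where g: "g meromorphic_on {0}" "\<forall>t. Im t > 0 \<longrightarrow> p (moebius A t) = g (cusp_param 8 t)"
    using assms by (rule weber_polys_cusp)
  have "eventually (\<lambda>t. Im t > 0) at_cusp" by (auto simp: eventually_filtercomap_at_top_dense)
  hence "eventually (\<lambda>t. p (moebius A t) = g (cusp_param 8 t)) at_cusp"
    by eventually_elim (use g(2) in auto)
  thus ?thesis unfolding mero_at_cusp_def using g(1) by (intro exI[of _ 8]) auto
qed

lemma weber_polys_cosets_invariant: "p \<in> weber_polys \<Longrightarrow> cosets_invariant p"
  using weber_polys_invariant by (simp add: cosets_invariant_def)

lemma coset_trace_weber_rational:
  assumes "\<phi> meromorphic_on upper_half_plane" "cosets_invariant \<phi>"
    and "\<And>A. A \<in> SL2 \<Longrightarrow> mero_at_cusp (\<lambda>t. \<phi> (moebius A t))"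
  shows "weber_rational (coset_trace \<phi>)"
proof -
  have "mero_at_cusp (coset_trace \<phi>)"
    unfolding coset_trace_def[abs_def] using assms(3) coset_reps_SL2 by (intro mero_at_cusp_sum) auto
  then obtain N g where "N > 0" "g meromorphic_on {0}" "eventually (\<lambda>t. coset_trace \<phi> t = g (cusp_param N t)) at_cusp"
    by (auto simp: mero_at_cusp_def)
  moreover have "coset_trace \<phi> meromorphic_on upper_half_plane"
    unfolding coset_trace_def[abs_def] using assms(1) coset_reps_SL2
    by (intro meromorphic_intros meromorphic_on_moebius) auto
  ultimately show ?thesis
    using coset_trace_invariant[OF assms(2)] by (intro level_one_weber_rational) auto
qed

section \<open>A separating function\<close>

lemma weber_fixes_cong8:
  assumes "A \<in> SL2" "B \<in> SL2" "cong8 A B" "weber_fixes A"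
  shows "weber_fixes B"
  using assms(4) cosets_invariant_cong8[OF weber_polys_cosets_invariant assms(1-3)] weber_polys_x
  unfolding weber_fixes_def by metis

text \<open>For a representative r that moves some x_i, the difference of h at r t and at t is, for
  a suitable t, a nonzero polynomial of degree at most 2 in the parameter a. Finitely many
  representatives exclude finitely many values of a.\<close>

lemma separating_weber_poly:
  obtains h where "h \<in> weber_polys" "\<forall>A\<in>SL2. (\<lambda>t. h (moebius A t)) \<in> weber_polys"
    "\<forall>A\<in>SL2. (\<forall>t. Im t > 0 \<longrightarrow> h (moebius A t) = h t) \<longrightarrow> A \<in> split_cartan 8"
proof -
  define h where "h = (\<lambda>a t. weber_x0 t + a * weber_x1 t + a\<^sup>2 * weber_x2 t)"
  have "\<exists>T. finite T \<and> (\<forall>a. (\<forall>t. Im t > 0 \<longrightarrow> h a (moebius r t) = h a t) \<longrightarrow> a \<in> T)"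
    if r: "\<not> weber_fixes r" for r
  proof -
    obtain t where t: "Im t > 0" "weber_x0 (moebius r t) \<noteq> weber_x0 t \<or> weber_x1 (moebius r t) \<noteq> weber_x1 t
        \<or> weber_x2 (moebius r t) \<noteq> weber_x2 t"
      using r by (auto simp: weber_fixes_def)
    define p where "p = [:weber_x0 (moebius r t) - weber_x0 t, weber_x1 (moebius r t) - weber_x1 t,
        weber_x2 (moebius r t) - weber_x2 t:]"
    have p: "p \<noteq> 0" using t(2) by (auto simp: p_def)
    have "poly p a = 0" if "\<forall>t. Im t > 0 \<longrightarrow> h a (moebius r t) = h a t" for a
      using that t(1) by (simp add: p_def h_def algebra_simps power2_eq_square)
    thus ?thesis using poly_roots_finite[OF p] by blast
  qed
  then obtain T where T: "\<And>r. \<not> weber_fixes r \<Longrightarrow> finite (T r)"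
    "\<And>r a. \<not> weber_fixes r \<Longrightarrow> (\<forall>t. Im t > 0 \<longrightarrow> h a (moebius r t) = h a t) \<Longrightarrow> a \<in> T r"
    by metis
  have "finite (\<Union>r\<in>{r\<in>coset_reps. \<not> weber_fixes r}. T r)"
    using finite_coset_reps T(1) by auto
  then obtain a where a: "a \<notin> (\<Union>r\<in>{r\<in>coset_reps. \<not> weber_fixes r}. T r)"
    using ex_new_if_finite[OF infinite_UNIV_char_0] by blast
  have xA: "(\<lambda>t. f (moebius A t)) \<in> weber_polys" if "A \<in> SL2" "f \<in> {weber_x0, weber_x1, weber_x2}" for A f
  proof -
    note A = that
    obtain f0 f1 f2 c0 c1 c2 where "weber_permutes A f0 f1 f2 c0 c1 c2"
      using A(1) by (rule weber_x_SL2)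
    note * = weber_permutesD[OF this]
    have "f0 \<in> weber_polys" "f1 \<in> weber_polys" "f2 \<in> weber_polys"
      using *(7) weber_polys_x by auto
    then obtain c g where "g \<in> weber_polys" "\<forall>t. Im t > 0 \<longrightarrow> f (moebius A t) = c * g t"
      using A(2) *(1-3) by blast
    hence "(\<lambda>t. c * g t) \<in> weber_polys" "\<forall>t. Im t > 0 \<longrightarrow> f (moebius A t) = c * g t"
      by (auto intro: weber_polys_mult)
    thus ?thesis by (auto simp: weber_polys_def)
  qed
  have hA: "(\<lambda>t. h a (moebius A t)) \<in> weber_polys" if "A \<in> SL2" for A
    unfolding h_def using that by (intro weber_polys_add weber_polys_mult weber_polys_const xA) auto
  have h: "h a \<in> weber_polys"
    unfolding h_def by (intro weber_polys_add weber_polys_mult weber_polys_const weber_polys_x)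
  have "A \<in> split_cartan 8" if A: "A \<in> SL2" "\<forall>t. Im t > 0 \<longrightarrow> h a (moebius A t) = h a t" for A
  proof -
    define r where "r = coset_rep A"
    have r: "r \<in> coset_reps" "r \<in> SL2" "cong8 r A"
      using A(1) coset_rep[OF A(1)] by (auto simp: r_def coset_reps_def)
    have "\<forall>t. Im t > 0 \<longrightarrow> h a (moebius r t) = h a t"
      \<comment> \<open>Infinitely many matrices are reduced to the finitely many representatives
        for which the parameter was chosen.\<close>
      using A(2) cosets_invariant_cong8[OF weber_polys_cosets_invariant[OF h] r(2) A(1) r(3)] by simp
    hence "weber_fixes r" using T(2)[of r a] a r(1) by blast
    hence "weber_fixes A" using weber_fixes_cong8 r A(1) by blast
    thus ?thesis using weber_fixes_iff[OF A(1)] by simp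
  qed
  thus thesis using that[of "h a"] h hA by blast
qed

lemma holomorphic_prod_nonzero:
  assumes "finite I" "\<And>i. i \<in> I \<Longrightarrow> p i \<in> weber_polys" "\<And>i. i \<in> I \<Longrightarrow> \<exists>t. Im t > 0 \<and> p i t \<noteq> 0"
  shows "\<exists>t. Im t > 0 \<and> (\<Prod>i\<in>I. p i t) \<noteq> 0"
  using assms
proof (induction I)
  case empty
  show ?case by (auto intro: exI[of _ \<i>])
next
  case (insert i I)
  have "\<exists>t. Im t > 0 \<and> p i t * (\<Prod>i\<in>I. p i t) \<noteq> 0"
    using insert by (intro holomorphic_mult_nonzero weber_polys_holomorphic weber_polys_prod) auto
  thus ?case using insert.hyps by simp
qed

text \<open>
  With \<open>h\<close> separating the cosets, the average of \<open>F \<cdot> \<Prod>\<^sub>r (s - h \<circ> r)\<close> over the cosets, taken at the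
  parameter value \<open>s = h\<close>, has only one kind of surviving term, a nonzero multiple of \<open>F\<close>. Its
  coefficients as a polynomial in \<open>s\<close> have level one.
\<close>
lemma modular_function_weber_rational:
  assumes F: "F meromorphic_on upper_half_plane" "cosets_invariant F"
    and Fcusp: "\<And>A. A \<in> SL2 \<Longrightarrow> mero_at_cusp (\<lambda>t. F (moebius A t))"
  shows "weber_rational F"
proof -
  obtain h where h: "h \<in> weber_polys" "\<forall>A\<in>SL2. (\<lambda>t. h (moebius A t)) \<in> weber_polys"
    "\<forall>A\<in>SL2. (\<forall>t. Im t > 0 \<longrightarrow> h (moebius A t) = h t) \<longrightarrow> A \<in> split_cartan 8"
    using separating_weber_poly by blast
  \<comment> \<open>By the separation property these are exactly the representatives outside the
    split Cartan group.\<close>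
  define I where "I = {r \<in> coset_reps. \<not> (\<forall>t. Im t > 0 \<longrightarrow> h (moebius r t) = h t)}"
  have I: "finite I" "\<And>r. r \<in> I \<Longrightarrow> r \<in> SL2"
    using finite_coset_reps coset_reps_SL2 by (auto simp: I_def)
  have hr: "(\<lambda>t. h (moebius r t)) \<in> weber_polys" if "r \<in> I" for r
    using h(2) I(2)[OF that] by blast
  \<comment> \<open>Classes modulo 8 are finer than cosets, so the trivial coset is met
    \<open>n\<close> times and the surviving term appears with this multiplicity.\<close>
  define n where "n = card (coset_reps \<inter> split_cartan 8)"
  define D where "D = (\<lambda>t. \<Prod>r\<in>I. h t - h (moebius r t))"
  \<comment> \<open>Expanding the product over \<open>I\<close>, the subset \<open>J\<close>
    collects the factors that contribute s; the remaining factors together with \<open>F\<close>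
    form the function whose trace has level one.\<close>
  define \<Psi> where "\<Psi> = (\<lambda>J t. F t * (\<Prod>r\<in>I - J. - h (moebius r t)))"
  have \<Psi>: "weber_rational (coset_trace (\<Psi> J))" for J
  proof (rule coset_trace_weber_rational)
    have P: "(\<lambda>t. \<Prod>r\<in>I - J. - h (moebius r t)) \<in> weber_polys"
      using hr by (intro weber_polys_prod weber_polys_uminus) auto
    show "\<Psi> J meromorphic_on upper_half_plane"
      unfolding \<Psi>_def by (intro meromorphic_on_mult F weber_polys_meromorphic P)
    show "cosets_invariant (\<Psi> J)"
      using F(2) weber_polys_cosets_invariant[OF P] by (simp add: cosets_invariant_def \<Psi>_def)
    show "mero_at_cusp (\<lambda>t. \<Psi> J (moebius A t))" if "A \<in> SL2" for A
      unfolding \<Psi>_def using Fcusp[OF that] mero_at_cusp_weber_polys[OF P that]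
      by (rule mero_at_cusp_binop[of _ _ "(*)"]) (rule meromorphic_on_mult)
  qed
  have key: "of_nat n * D t * F t = (\<Sum>J\<in>Pow I. h t ^ card J * coset_trace (\<Psi> J) t)" if t: "Im t > 0" for t
  proof -
    have "(\<Sum>J\<in>Pow I. h t ^ card J * coset_trace (\<Psi> J) t) =
      (\<Sum>J\<in>Pow I. \<Sum>g\<in>coset_reps. F (moebius g t) * (h t ^ card J * (\<Prod>r\<in>I - J. - h (moebius r (moebius g t)))))"
      by (simp add: coset_trace_def \<Psi>_def sum_distrib_left mult_ac)
    also have "\<dots> = (\<Sum>g\<in>coset_reps. F (moebius g t) *
        (\<Sum>J\<in>Pow I. h t ^ card J * (\<Prod>r\<in>I - J. - h (moebius r (moebius g t)))))"
      by (subst sum.swap) (simp add: sum_distrib_left)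
    also have "\<dots> = (\<Sum>g\<in>coset_reps. F (moebius g t) * (\<Prod>r\<in>I. h t - h (moebius r (moebius g t))))"
    proof -
      have "(\<Sum>J\<in>Pow I. h t ^ card J * (\<Prod>r\<in>I - J. - y r)) = (\<Prod>r\<in>I. h t - y r)" for y
        using prod_add[OF I(1), of "\<lambda>_. h t" "\<lambda>r. - y r"] by simp
      thus ?thesis by simp
    qed
    also have "\<dots> = (\<Sum>g\<in>coset_reps. if g \<in> split_cartan 8 then D t * F t else 0)"
    proof (rule sum.cong[OF refl])
      fix g assume g: "g \<in> coset_reps"
      have gSL: "g \<in> SL2" using g by (rule coset_reps_SL2)
      have gt: "Im (moebius g t) > 0" using gSL t by (rule moebius_in_upper_half_plane)
      show "F (moebius g t) * (\<Prod>r\<in>I. h t - h (moebius r (moebius g t))) = (if g \<in> split_cartan 8 then D t * F t else 0)"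
      proof (cases "g \<in> split_cartan 8")
        case True
        \<comment> \<open>Composed with \<open>r\<close>, the function \<open>h\<close> is again a
          polynomial in the x_i and thus invariant under \<open>g\<close>.\<close>
        have "h (moebius r (moebius g t)) = h (moebius r t)" if "r \<in> I" for r
          using weber_polys_invariant[OF hr[OF that] True t] .
        moreover have "F (moebius g t) = F t" using F(2) True t by (simp add: cosets_invariant_def)
        ultimately show ?thesis using True by (simp add: D_def)
      next
        case False
        \<comment> \<open>The representative of the inverse of \<open>g\<close> lies in
          \<open>I\<close> and returns h at \<open>g t\<close> to its value at \<open>t\<close>, so
          one factor of the product vanishes.\<close>
        define r where "r = coset_rep (adj2 g)"
        have ag: "adj2 g \<in> SL2" using gSL by (rule SL2_adj)
        have r: "r \<in> coset_reps" "r \<in> SL2" "cong8 r (adj2 g)"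
          using ag coset_rep[OF ag] by (auto simp: r_def coset_reps_def)
        have eq: "h (moebius r z) = h (moebius (adj2 g) z)" if "Im z > 0" for z
          using cosets_invariant_cong8[OF weber_polys_cosets_invariant[OF h(1)] r(2) ag r(3) that] .
        have "adj2 g \<notin> split_cartan 8" using False split_cartan_adj[OF gSL] by simp
        hence "r \<in> I" using h(3) ag eq r(1) unfolding I_def by force
        moreover have "h (moebius r (moebius g t)) = h t"
          using eq[OF gt] moebius_adj(1)[OF gSL t] by simp
        ultimately have "(\<Prod>r\<in>I. h t - h (moebius r (moebius g t))) = 0"
          using I(1) by (intro prod_zero bexI[of _ r]) auto
        thus ?thesis using False by simp
      qed
    qed
    also have "\<dots> = of_nat n * D t * F t"
      using finite_coset_reps by (simp add: sum.If_cases n_def Int_def)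
    finally show ?thesis ..
  qed
  have "n \<noteq> 0"
  proof -
    have "coset_rep (mat 1) \<in> split_cartan 8"
      using coset_rep[OF SL2_one] unfolding split_cartan_iff_cong8 cong8_def by (auto simp: mat_1_mat2 forall_2)
    hence "coset_rep (mat 1) \<in> coset_reps \<inter> split_cartan 8"
      using SL2_one by (simp add: coset_reps_def)
    thus ?thesis using finite_coset_reps by (auto simp: n_def card_eq_0_iff)
  qed
  have facts: "(\<lambda>t. h t - h (moebius r t)) \<in> weber_polys" "\<exists>t. Im t > 0 \<and> h t - h (moebius r t) \<noteq> 0" if "r \<in> I" for r
    using weber_polys_diff[OF h(1) hr[OF that]] that by (auto simp: I_def)
  show ?thesis
  proof (rule weber_rational_divide)
    show "weber_rational (\<lambda>t. \<Sum>J\<in>Pow I. h t ^ card J * coset_trace (\<Psi> J) t)"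
      by (intro weber_rational_sum weber_rational_mult \<Psi> weber_rational_weber_polys weber_polys_power h)
    show "(\<lambda>t. of_nat n * D t) \<in> weber_polys"
      unfolding D_def by (intro weber_polys_mult weber_polys_const weber_polys_prod facts)
    show "\<exists>t. Im t > 0 \<and> of_nat n * D t \<noteq> 0"
      using holomorphic_prod_nonzero[OF I(1) facts] \<open>n \<noteq> 0\<close> by (simp add: D_def)
  qed (use key in simp)
qed

section \<open>The function field of the Weber curve\<close>

abbreviation (input) "W4 \<equiv> weber_curve 4"
abbreviation (input) "nonzero_form G \<equiv> \<exists>t. Im t > 0 \<and> G (weber_param 4 t) \<noteq> 0"

lemma forms_diff: "F \<in> forms d \<Longrightarrow> G \<in> forms d \<Longrightarrow> (\<lambda>x. F x - G x) \<in> forms d"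
  using forms_add[OF _ forms_cmult[of G d "- 1"], of F] by simp

text \<open>Passing to the Zariski closure creates no new condition on a form, and homogeneity makes
  the choice of coordinate vector irrelevant.\<close>

lemma vanishes_on_weber_curve:
  assumes "F \<in> forms d"
  shows "vanishes_on F W4 \<longleftrightarrow> (\<forall>t. Im t > 0 \<longrightarrow> F (weber_param 4 t) = 0)"
proof
  assume v: "vanishes_on F W4"
  show "\<forall>t. Im t > 0 \<longrightarrow> F (weber_param 4 t) = 0"
  proof safe
    fix t assume t: "0 < Im t"
    have "weber_param 4 t \<noteq> 0" using weber_param_nth(4)[of t] by auto
    hence "proj_point (weber_param 4 t) \<in> W4"
      using t by (auto simp: weber_curve_def zariski_closure_def proj_space_def vanishes_on_def)
    moreover have "weber_param 4 t \<in> proj_point (weber_param 4 t)"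
      unfolding proj_point_def by (auto intro!: exI[of _ 1])
    ultimately show "F (weber_param 4 t) = 0" using v by (auto simp: vanishes_on_def)
  qed
next
  assume "\<forall>t. Im t > 0 \<longrightarrow> F (weber_param 4 t) = 0"
  hence "vanishes_on F ((\<lambda>t. proj_point (weber_param 4 t)) ` upper_half_plane)"
    by (auto simp: vanishes_on_def proj_point_def form_scale[OF assms])
  thus "vanishes_on F W4"
    using assms by (auto simp: weber_curve_def zariski_closure_def vanishes_on_def)
qed

text \<open>The pullback of a single pair of forms; the choice of a representative in
  \<open>weber_pullback\<close> is thereby dealt with once.\<close>

definition weber_fraction :: "(complex ^ 4 \<Rightarrow> complex) \<times> (complex ^ 4 \<Rightarrow> complex) \<Rightarrow> complex \<Rightarrow> complex" where
  "weber_fraction p = normalize_mero (\<lambda>t. fst p (weber_param 4 t) / snd p (weber_param 4 t))"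

lemma fractions_weber_curve:
  "(F, G) \<in> fractions W4 \<longleftrightarrow>
     (\<exists>d. F \<in> forms d \<and> G \<in> forms d \<and> (\<exists>t. Im t > 0 \<and> G (weber_param 4 t) \<noteq> 0))"
  by (auto simp: fractions_def vanishes_on_weber_curve)

lemma fractions_weber_curveE:
  assumes "p \<in> fractions W4"
  obtains F G d where "p = (F, G)" "F \<in> forms d" "G \<in> forms d" "nonzero_form G"
  using assms fractions_weber_curve by (cases p) blast

lemma weber_form_eventually_nonzero:
  assumes "G \<in> forms d" "nonzero_form G" "Im z > 0"
  shows "eventually (\<lambda>t. G (weber_param 4 t) \<noteq> 0) (at z)"
  using nonzero_eventually[OF weber_form_holomorphic[OF assms(1)]] assms(2,3) by blast

lemma weber_quotient_meromorphic:
  assumes "F \<in> forms d" "G \<in> forms d'"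
  shows "(\<lambda>t. F (weber_param 4 t) / G (weber_param 4 t)) meromorphic_on upper_half_plane"
  using weber_form_holomorphic assms open_upper_half_plane
  by (intro meromorphic_on_divide analytic_on_imp_meromorphic_on) (auto simp: analytic_on_open)

lemma eventually_normalize_mero:
  assumes "f meromorphic_on upper_half_plane" "Im z > 0"
  shows "eventually (\<lambda>t. normalize_mero f t = f t) (at z)"
proof -
  have "isolated_singularity_at f z" using assms by (auto simp: meromorphic_on_altdef)
  from eventually_remove_sings_eq_at[OF this] eventually_upper_half_plane_at[OF assms(2)]
  show ?thesis by eventually_elim (simp add: normalize_mero_def)
qed

lemma normalize_mero_cong:
  assumes "\<And>z. Im z > 0 \<Longrightarrow> eventually (\<lambda>t. f t = g t) (at z)"
  shows "normalize_mero f = normalize_mero g"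
  using assms by (auto simp: normalize_mero_def fun_eq_iff intro!: remove_sings_cong)

lemma eventually_weber_fraction:
  assumes "F \<in> forms d" "G \<in> forms d'" "Im z > 0"
  shows "eventually (\<lambda>t. weber_fraction (F, G) t = F (weber_param 4 t) / G (weber_param 4 t)) (at z)"
  unfolding weber_fraction_def fst_conv snd_conv
  using assms by (intro eventually_normalize_mero weber_quotient_meromorphic)

text \<open>Away from the zeros of the denominators, equality of quotients is equality of cross
  products. The difference of cross products is a form, and by the identity theorem it vanishes
  along the whole parametrization once it vanishes near i.\<close>

lemma weber_fraction_eq_iff:
  assumes FG: "F \<in> forms d" "G \<in> forms d" "nonzero_form G"
    and FG': "F' \<in> forms d'" "G' \<in> forms d'" "nonzero_form G'"
  shows "weber_fraction (F, G) = weber_fraction (F', G') \<longleftrightarrow>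
    vanishes_on (\<lambda>x. F x * G' x - F' x * G x) W4"
proof -
  have form: "(\<lambda>x. F x * G' x - F' x * G x) \<in> forms (d + d')"
    using forms_mult[OF FG(1) FG'(2)] forms_mult[OF FG'(1) FG(2)] by (intro forms_diff) (simp_all add: add.commute)
  note ev = weber_form_eventually_nonzero[OF FG(2,3)] weber_form_eventually_nonzero[OF FG'(2,3)]
  show ?thesis
  proof
    assume eq: "weber_fraction (F, G) = weber_fraction (F', G')"
    have i: "Im \<i> > 0" by simp
    have "eventually (\<lambda>t. F (weber_param 4 t) * G' (weber_param 4 t) - F' (weber_param 4 t) * G (weber_param 4 t) = 0) (at \<i>)"
      using eventually_weber_fraction[OF FG(1,2) i] eventually_weber_fraction[OF FG'(1,2) i] ev[OF i]
      by eventually_elim (simp add: eq field_simps)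
    hence "\<not> eventually (\<lambda>t. F (weber_param 4 t) * G' (weber_param 4 t) - F' (weber_param 4 t) * G (weber_param 4 t) \<noteq> 0) (at \<i>)"
      using eventually_happens[OF eventually_conj] trivial_limit_at by blast
    thus "vanishes_on (\<lambda>x. F x * G' x - F' x * G x) W4"
      unfolding vanishes_on_weber_curve[OF form] using weber_form_eventually_nonzero[OF form _ i] by blast
  next
    assume "vanishes_on (\<lambda>x. F x * G' x - F' x * G x) W4"
    hence v: "F (weber_param 4 t) * G' (weber_param 4 t) = F' (weber_param 4 t) * G (weber_param 4 t)" if "Im t > 0" for t
      using that unfolding vanishes_on_weber_curve[OF form] by simp
    show "weber_fraction (F, G) = weber_fraction (F', G')"
      unfolding weber_fraction_def fst_conv snd_conv
    proof (rule normalize_mero_cong)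
      fix z assume z: "Im z > 0"
      show "eventually (\<lambda>t. F (weber_param 4 t) / G (weber_param 4 t) = F' (weber_param 4 t) / G' (weber_param 4 t)) (at z)"
        using ev[OF z] eventually_upper_half_plane_at[OF z]
        by eventually_elim (use v in \<open>simp add: frac_eq_eq\<close>)
    qed
  qed
qed

text \<open>So the relation is the kernel of a map; this makes it an equivalence and the pullback
  injective.\<close>

lemma fraction_rel_weber_curve:
  "fraction_rel W4 = {(p, q). p \<in> fractions W4 \<and> q \<in> fractions W4 \<and> weber_fraction p = weber_fraction q}"
proof -
  have "(p, q) \<in> fraction_rel W4 \<longleftrightarrow> weber_fraction p = weber_fraction q"
    if p: "p \<in> fractions W4" and q: "q \<in> fractions W4" for p q
  proof -
    obtain F G d where FG: "p = (F, G)" "F \<in> forms d" "G \<in> forms d" "nonzero_form G"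
      using p by (rule fractions_weber_curveE)
    obtain F' G' d' where FG': "q = (F', G')" "F' \<in> forms d'" "G' \<in> forms d'" "nonzero_form G'"
      using q by (rule fractions_weber_curveE)
    show ?thesis
      using weber_fraction_eq_iff[OF FG(2-4) FG'(2-4)] p q by (simp add: fraction_rel_def FG(1) FG'(1))
  qed
  moreover have "p \<in> fractions W4" "q \<in> fractions W4" if "(p, q) \<in> fraction_rel W4" for p q
    using that by (auto simp: fraction_rel_def)
  ultimately have "(p, q) \<in> fraction_rel W4 \<longleftrightarrow>
      p \<in> fractions W4 \<and> q \<in> fractions W4 \<and> weber_fraction p = weber_fraction q" for p q
    by blast
  thus ?thesis unfolding set_eq_iff split_paired_All mem_Collect_eq case_prod_conv by blast
qed

abbreviation (input) "fclass p \<equiv> fraction_rel W4 `` {p}"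

lemma fclass_eq_iff:
  assumes "p \<in> fractions W4" "q \<in> fractions W4"
  shows "fclass p = fclass q \<longleftrightarrow> weber_fraction p = weber_fraction q"
  using assms by (auto simp: fraction_rel_weber_curve)

lemma mem_fclass: "p \<in> fractions W4 \<Longrightarrow> q \<in> fclass p \<longleftrightarrow> q \<in> fractions W4 \<and> weber_fraction q = weber_fraction p"
  by (auto simp: fraction_rel_weber_curve)

lemma weber_pullback_fclass:
  assumes "p \<in> fractions W4"
  shows "weber_pullback 4 (fclass p) = weber_fraction p"
proof -
  define s where "s = (SOME q. q \<in> fclass p)"
  have "p \<in> fclass p" by (rule iffD2[OF mem_fclass[OF assms]]) (use assms in simp)
  hence "s \<in> fclass p" unfolding s_def by (rule someI)
  hence s: "weber_fraction s = weber_fraction p" using mem_fclass[OF assms, of s] by blast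
  have "weber_pullback 4 (fclass p) = weber_fraction s"
    unfolding weber_pullback_def weber_fraction_def s_def[symmetric] case_prod_unfold ..
  thus ?thesis unfolding s .
qed

lemma carrier_function_field: "carrier (function_field W4) = fclass ` fractions W4"
  by (auto simp: function_field_def quotient_def)

lemma fractions_mult:
  assumes "(F, G) \<in> fractions W4" "(F', G') \<in> fractions W4"
  shows "(\<lambda>x. F x * F' x, \<lambda>x. G x * G' x) \<in> fractions W4"
    "weber_fraction (\<lambda>x. F x * F' x, \<lambda>x. G x * G' x) =
      normalize_mero (\<lambda>t. weber_fraction (F, G) t * weber_fraction (F', G') t)"
    "(\<lambda>x. F x * G' x + F' x * G x, \<lambda>x. G x * G' x) \<in> fractions W4"
    "weber_fraction (\<lambda>x. F x * G' x + F' x * G x, \<lambda>x. G x * G' x) =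
      normalize_mero (\<lambda>t. weber_fraction (F, G) t + weber_fraction (F', G') t)"
proof -
  obtain d d' where FG: "F \<in> forms d" "G \<in> forms d" "nonzero_form G"
    and FG': "F' \<in> forms d'" "G' \<in> forms d'" "nonzero_form G'"
    using assms by (auto simp: fractions_weber_curve)
  have nz: "\<exists>t. Im t > 0 \<and> G (weber_param 4 t) * G' (weber_param 4 t) \<noteq> 0"
    using FG FG' by (intro holomorphic_mult_nonzero weber_form_holomorphic)
  have GG: "(\<lambda>x. G x * G' x) \<in> forms (d + d')" and FF: "(\<lambda>x. F x * F' x) \<in> forms (d + d')"
    using FG FG' by (auto intro: forms_mult)
  have FpG: "(\<lambda>x. F x * G' x + F' x * G x) \<in> forms (d + d')"
    using forms_mult[OF FG(1) FG'(2)] forms_mult[OF FG'(1) FG(2)] by (intro forms_add) (simp_all add: add.commute)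
  show "(\<lambda>x. F x * F' x, \<lambda>x. G x * G' x) \<in> fractions W4" "(\<lambda>x. F x * G' x + F' x * G x, \<lambda>x. G x * G' x) \<in> fractions W4"
    using nz GG FF FpG unfolding fractions_weber_curve by blast+
  note ev = eventually_weber_fraction[OF FG(1,2)] eventually_weber_fraction[OF FG'(1,2)]
    weber_form_eventually_nonzero[OF FG(2,3)] weber_form_eventually_nonzero[OF FG'(2,3)]
  have m: "eventually (\<lambda>t. fst (\<lambda>x. F x * F' x, \<lambda>x. G x * G' x) (weber_param 4 t) /
      snd (\<lambda>x. F x * F' x, \<lambda>x. G x * G' x) (weber_param 4 t) = weber_fraction (F, G) t * weber_fraction (F', G') t) (at z)"
    if z: "Im z > 0" for z
    using ev[OF z] by eventually_elim simp
  have a: "eventually (\<lambda>t. fst (\<lambda>x. F x * G' x + F' x * G x, \<lambda>x. G x * G' x) (weber_param 4 t) /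
      snd (\<lambda>x. F x * G' x + F' x * G x, \<lambda>x. G x * G' x) (weber_param 4 t) =
      weber_fraction (F, G) t + weber_fraction (F', G') t) (at z)"
    if z: "Im z > 0" for z
    using ev[OF z] by eventually_elim (simp add: add_frac_eq)
  show "weber_fraction (\<lambda>x. F x * F' x, \<lambda>x. G x * G' x) =
      normalize_mero (\<lambda>t. weber_fraction (F, G) t * weber_fraction (F', G') t)"
    unfolding weber_fraction_def[of "(\<lambda>x. F x * F' x, \<lambda>x. G x * G' x)"] by (intro normalize_mero_cong m)
  show "weber_fraction (\<lambda>x. F x * G' x + F' x * G x, \<lambda>x. G x * G' x) =
      normalize_mero (\<lambda>t. weber_fraction (F, G) t + weber_fraction (F', G') t)"
    unfolding weber_fraction_def[of "(\<lambda>x. F x * G' x + F' x * G x, \<lambda>x. G x * G' x)"] by (intro normalize_mero_cong a)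
qed

text \<open>The unions in the field operations run over all representatives. Each contributes the
  same class, because the pullback of the result depends only on the pullbacks of the arguments,
  through \<open>k\<close>.\<close>

lemma UN_fclass:
  assumes p: "(F, G) \<in> fractions W4" and q: "(F', G') \<in> fractions W4"
    and op: "\<And>F G F' G'. (F, G) \<in> fractions W4 \<Longrightarrow> (F', G') \<in> fractions W4 \<Longrightarrow> op F G F' G' \<in> fractions W4 \<and>
      weber_fraction (op F G F' G') = k (weber_fraction (F, G)) (weber_fraction (F', G'))"
  shows "(\<Union>(F, G)\<in>fclass (F, G). \<Union>(F', G')\<in>fclass (F', G'). fclass (op F G F' G')) = fclass (op F G F' G')"
proof -
  have "fclass (op K L K' L') = fclass (op F G F' G')"
    if "(K, L) \<in> fclass (F, G)" "(K', L') \<in> fclass (F', G')" for K L K' L'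
  proof -
    have K: "(K, L) \<in> fractions W4" "weber_fraction (K, L) = weber_fraction (F, G)"
      "(K', L') \<in> fractions W4" "weber_fraction (K', L') = weber_fraction (F', G')"
      using that unfolding mem_fclass[OF p] mem_fclass[OF q] by blast+
    show ?thesis using op[OF K(1,3)] op[OF p q] K(2,4) fclass_eq_iff by metis
  qed
  moreover have "(F, G) \<in> fclass (F, G)" "(F', G') \<in> fclass (F', G')"
    by (rule iffD2[OF mem_fclass]; use p q in simp)+
  ultimately show ?thesis by blast
qed

lemma fclass_mult:
  assumes "(F, G) \<in> fractions W4" "(F', G') \<in> fractions W4"
  shows "fclass (F, G) \<otimes>\<^bsub>function_field W4\<^esub> fclass (F', G') = fclass (\<lambda>x. F x * F' x, \<lambda>x. G x * G' x)"
    "fclass (F, G) \<oplus>\<^bsub>function_field W4\<^esub> fclass (F', G') = fclass (\<lambda>x. F x * G' x + F' x * G x, \<lambda>x. G x * G' x)"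
  using UN_fclass[OF assms, of "\<lambda>F G F' G'. (\<lambda>x. F x * F' x, \<lambda>x. G x * G' x)" "\<lambda>f g. normalize_mero (\<lambda>t. f t * g t)"]
    UN_fclass[OF assms, of "\<lambda>F G F' G'. (\<lambda>x. F x * G' x + F' x * G x, \<lambda>x. G x * G' x)" "\<lambda>f g. normalize_mero (\<lambda>t. f t + g t)"]
    fractions_mult
  by (simp_all add: function_field_def)

section \<open>The isomorphism\<close>

lemma normalize_mero_nicely_meromorphic:
  assumes "f meromorphic_on upper_half_plane"
  shows "normalize_mero f nicely_meromorphic_on upper_half_plane"
proof -
  have nice: "remove_sings f nicely_meromorphic_on upper_half_plane"
    using assms by (rule remove_sings_nicely_meromorphic)
  have ev: "eventually (\<lambda>w. normalize_mero f w = remove_sings f w) (at z)" if "Im z > 0" for z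
    using eventually_upper_half_plane_at[OF that] by eventually_elim (simp add: normalize_mero_def)
  have "normalize_mero f meromorphic_on upper_half_plane"
    using nice ev by (subst meromorphic_on_cong[where g = "remove_sings f"]) (auto simp: nicely_meromorphic_on_def)
  moreover have "is_pole (normalize_mero f) z \<and> normalize_mero f z = 0 \<or> normalize_mero f \<midarrow>z\<rightarrow> normalize_mero f z"
    if z: "Im z > 0" for z
  proof -
    have "is_pole (normalize_mero f) z \<longleftrightarrow> is_pole (remove_sings f) z"
      using ev[OF z] by (intro is_pole_cong) auto
    moreover have "normalize_mero f \<midarrow>z\<rightarrow> remove_sings f z \<longleftrightarrow> remove_sings f \<midarrow>z\<rightarrow> remove_sings f z"
      using ev[OF z] by (rule tendsto_cong)
    moreover have "normalize_mero f z = remove_sings f z" using z by (simp add: normalize_mero_def)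
    ultimately show ?thesis using nice z unfolding nicely_meromorphic_on_def by auto
  qed
  ultimately show ?thesis unfolding nicely_meromorphic_on_def by auto
qed

text \<open>The expansion of the denominator has no zeros in a punctured neighbourhood of 0. High up
  the quotient is therefore analytic and normalization leaves its values unchanged.\<close>

lemma weber_fraction_at_cusp:
  assumes FG: "F \<in> forms d" "G \<in> forms d" "nonzero_form G" and A: "A \<in> SL2"
  shows "\<exists>g y. g meromorphic_on {0} \<and>
    (\<forall>t. Im t > y \<and> Im t > 0 \<longrightarrow> weber_fraction (F, G) (moebius A t) = g (cusp_param 8 t))"
proof -
  obtain gF where gF: "gF meromorphic_on {0}" "\<forall>t. Im t > 0 \<longrightarrow> F (weber_param 4 (moebius A t)) = gF (cusp_param 8 t)"
    using FG(1) A by (rule weber_form_cusp)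
  obtain gG where gG: "gG meromorphic_on {0}" "\<forall>t. Im t > 0 \<longrightarrow> G (weber_param 4 (moebius A t)) = gG (cusp_param 8 t)"
    using FG(2) A by (rule weber_form_cusp)
  have cp: "filterlim (cusp_param 8) (at 0) at_cusp" by (rule filterlim_cusp_param) simp
  \<comment> \<open>Otherwise the denominator would vanish on a half plane high up, and, carried
    over by \<open>A\<close>, near a point where a nonzero form has no zeros nearby.\<close>
  have "frequently (\<lambda>w. gG w \<noteq> 0) (at 0)"
  proof (rule ccontr)
    assume "\<not> frequently (\<lambda>w. gG w \<noteq> 0) (at 0)"
    hence "eventually (\<lambda>w. gG w = 0) (at 0)" by (simp add: frequently_def)
    hence "eventually (\<lambda>t. gG (cusp_param 8 t) = 0) at_cusp"
      using cp unfolding filterlim_iff by blast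
    then obtain Y where Y: "\<And>t. Im t > Y \<Longrightarrow> gG (cusp_param 8 t) = 0"
      unfolding eventually_filtercomap_at_top_dense by blast
    define z where "z = Complex 0 (max Y 0 + 1)"
    have z: "Im z > 0" "Im z > Y" by (auto simp: z_def)
    have "eventually (\<lambda>t. Im t > Y) (at z)"
      using eventually_nhds_in_open[OF open_halfspace_Im_gt[of Y], of z] z by (auto simp: eventually_at_filter elim: eventually_mono)
    hence "eventually (\<lambda>t. G (weber_param 4 (moebius A t)) = 0) (at z)"
      using eventually_upper_half_plane_at[OF z(1)] by eventually_elim (use Y gG in auto)
    hence "eventually (\<lambda>t. G (weber_param 4 t) = 0) (at (moebius A z))"
      unfolding filtermap_moebius[OF A z(1), symmetric] eventually_filtermap .
    moreover have "eventually (\<lambda>t. G (weber_param 4 t) \<noteq> 0) (at (moebius A z))"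
      using weber_form_eventually_nonzero[OF FG(2,3)] moebius_in_upper_half_plane[OF A z(1)] by blast
    ultimately have "eventually (\<lambda>_. False) (at (moebius A z))" by eventually_elim simp
    thus False by simp
  qed
  hence "eventually (\<lambda>w. gG w \<noteq> 0) (at 0)"
    using gG(1) by (intro non_zero_neighbour) (auto simp: meromorphic_at_iff)
  hence "eventually (\<lambda>t. gG (cusp_param 8 t) \<noteq> 0) at_cusp"
    using cp unfolding filterlim_iff by blast
  then obtain y where y: "\<And>t. Im t > y \<Longrightarrow> gG (cusp_param 8 t) \<noteq> 0"
    unfolding eventually_filtercomap_at_top_dense by blast
  have "weber_fraction (F, G) (moebius A t) = gF (cusp_param 8 t) / gG (cusp_param 8 t)" if "Im t > y" "Im t > 0" for t
  proof -
    have At: "Im (moebius A t) > 0" using A that by (intro moebius_in_upper_half_plane)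
    have nz: "G (weber_param 4 (moebius A t)) \<noteq> 0" using y gG that by auto
    have "(\<lambda>t. F (weber_param 4 t)) analytic_on {moebius A t}" "(\<lambda>t. G (weber_param 4 t)) analytic_on {moebius A t}"
      using FG weber_form_holomorphic open_upper_half_plane At
      by (auto intro!: holomorphic_on_imp_analytic_at[of _ upper_half_plane])
    hence "(\<lambda>t. F (weber_param 4 t) / G (weber_param 4 t)) analytic_on {moebius A t}"
      using nz by (intro analytic_intros) auto
    thus ?thesis using At gF gG that by (simp add: weber_fraction_def normalize_mero_def)
  qed
  moreover have "(\<lambda>w. gF w / gG w) meromorphic_on {0}" by (intro meromorphic_intros gF gG)
  ultimately show ?thesis by blast
qed

lemma weber_fraction_modular:
  assumes "p \<in> fractions W4"
  shows "weber_fraction p \<in> modular_functions (Gamma_s 8)"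
proof -
  obtain F G d where FG: "p = (F, G)" "F \<in> forms d" "G \<in> forms d" "nonzero_form G"
    using assms by (rule fractions_weber_curveE)
  have "invariant_under g (weber_fraction p)" if g: "g \<in> Gamma_s 8" for g
  proof -
    obtain A where A: "A \<in> split_cartan 8" "g = to_PSL2Z A" using g by (auto simp: Gamma_s_def)
    have SL: "A \<in> SL2" using A(1) by (rule split_cartan_SL2)
    show ?thesis unfolding A(2) invariant_under_to_PSL2Z weber_fraction_def normalize_mero_def
      using moebius_in_upper_half_plane[OF SL] weber_param_invariant[OF A(1)]
      by (auto intro!: remove_sings_moebius[OF SL])
  qed
  moreover have "meromorphic_at_cusps (weber_fraction p)"
    unfolding meromorphic_at_cusps_def FG(1)
    using weber_fraction_at_cusp[OF FG(2-4)] by (intro ballI exI[of _ 8]) (simp add: cusp_param_def)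
  moreover have "weber_fraction p nicely_meromorphic_on upper_half_plane"
    unfolding weber_fraction_def FG(1) fst_conv snd_conv
    using FG by (intro normalize_mero_nicely_meromorphic weber_quotient_meromorphic)
  ultimately show ?thesis
    by (auto simp: modular_functions_def weber_fraction_def normalize_mero_def)
qed

text \<open>Surjectivity of the pullback. The rational expression agrees with \<open>f\<close> only
  on punctured neighbourhoods; a nicely meromorphic function is determined by these, so
  normalization gives equality everywhere.\<close>

lemma modular_function_weber_fraction:
  assumes f: "f \<in> modular_functions (Gamma_s 8)"
  obtains p where "p \<in> fractions W4" "weber_fraction p = f"
proof -
  have nice: "f nicely_meromorphic_on upper_half_plane" and out: "\<And>t. \<not> Im t > 0 \<Longrightarrow> f t = 0"
    and inv: "\<And>g. g \<in> Gamma_s 8 \<Longrightarrow> invariant_under g f" and cusps: "meromorphic_at_cusps f"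
    using f by (auto simp: modular_functions_def)
  have mero: "f meromorphic_on upper_half_plane" using nice by (simp add: nicely_meromorphic_on_def)
  have "cosets_invariant f"
    using inv[unfolded Gamma_s_def] invariant_under_to_PSL2Z unfolding cosets_invariant_def by blast
  moreover have "mero_at_cusp (\<lambda>t. f (moebius A t))" if "A \<in> SL2" for A
  proof -
    from cusps[unfolded meromorphic_at_cusps_def, rule_format, OF that]
    obtain N g y where g: "N > 0" "g meromorphic_on {0}"
      "\<And>t. Im t > y \<and> Im t > 0 \<Longrightarrow> f (moebius A t) = g (exp (2 * of_real pi * \<i> * t / of_nat N))"
      by blast
    have "eventually (\<lambda>t. f (moebius A t) = g (cusp_param N t)) at_cusp"
      unfolding eventually_filtercomap_at_top_dense cusp_param_def
      using g(3) by (intro exI[of _ "max y 0"]) auto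
    thus ?thesis using g(1,2) unfolding mero_at_cusp_def by blast
  qed
  ultimately have "weber_rational f" using mero by (intro modular_function_weber_rational)
  then obtain p q where pq: "p \<in> weber_polys" "q \<in> weber_polys" "\<exists>t. Im t > 0 \<and> q t \<noteq> 0"
    "\<forall>z. Im z > 0 \<longrightarrow> eventually (\<lambda>t. q t * f t = p t) (at z)" by (rule weber_rational_E)
  obtain d F G where FG: "F \<in> forms d" "G \<in> forms d" "\<forall>t. Im t > 0 \<longrightarrow> p t = F (weber_param 4 t) \<and> q t = G (weber_param 4 t)"
    using pq(1,2) by (rule weber_polys_common_degree)
  have nz: "nonzero_form G" using pq(3) FG(3) by metis
  have "weber_fraction (F, G) t = f t" for t
  proof (cases "Im t > 0")
    case True
    have "eventually (\<lambda>t. q t * f t = p t) (at t)" using pq(4) True by blast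
    hence "eventually (\<lambda>t. F (weber_param 4 t) / G (weber_param 4 t) = f t) (at t)"
      using weber_form_eventually_nonzero[OF FG(2) nz True] eventually_upper_half_plane_at[OF True]
      by eventually_elim (use FG(3) in \<open>auto simp: field_simps\<close>)
    hence "remove_sings (\<lambda>t. F (weber_param 4 t) / G (weber_param 4 t)) t = remove_sings f t"
      by (intro remove_sings_cong) auto
    moreover have "remove_sings f t = f t"
      using nice True by (auto simp: nicely_meromorphic_on_def)
    ultimately show ?thesis using True by (simp add: weber_fraction_def normalize_mero_def)
  qed (simp add: out weber_fraction_def normalize_mero_def)
  moreover have "(F, G) \<in> fractions W4" using FG nz unfolding fractions_weber_curve by blast
  ultimately show thesis using that by blast
qed

lemma weber_pullback_ring_iso:
  "weber_pullback 4 \<in> ring_iso (function_field W4) (split_cartan_curve_field 8)"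
proof -
  let ?R = "function_field W4" and ?S = "split_cartan_curve_field 8"
  have S: "carrier ?S = modular_functions (Gamma_s 8)"
    "f \<otimes>\<^bsub>?S\<^esub> g = normalize_mero (\<lambda>t. f t * g t)" "f \<oplus>\<^bsub>?S\<^esub> g = normalize_mero (\<lambda>t. f t + g t)"
    "\<one>\<^bsub>?S\<^esub> = normalize_mero (\<lambda>_. 1)" for f g
    by (simp_all add: split_cartan_curve_field_def modular_curve_field_def)
  have "bij_betw (weber_pullback 4) (carrier ?R) (carrier ?S)"
    unfolding bij_betw_def
  proof
    show "inj_on (weber_pullback 4) (carrier ?R)"
      unfolding carrier_function_field
    proof (rule inj_onI)
      fix a b assume "a \<in> fclass ` fractions W4" "b \<in> fclass ` fractions W4"
        and eq: "weber_pullback 4 a = weber_pullback 4 b"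
      then obtain p q where pq: "p \<in> fractions W4" "q \<in> fractions W4" "a = fclass p" "b = fclass q" by blast
      show "a = b"
        using eq unfolding pq(3,4) weber_pullback_fclass[OF pq(1)] weber_pullback_fclass[OF pq(2)]
          fclass_eq_iff[OF pq(1,2)] .
    qed
    have "weber_pullback 4 ` carrier ?R = weber_fraction ` fractions W4"
      unfolding carrier_function_field image_image by (intro image_cong refl weber_pullback_fclass)
    also have "\<dots> = carrier ?S"
      unfolding S using weber_fraction_modular by (auto elim: modular_function_weber_fraction)
    finally show "weber_pullback 4 ` carrier ?R = carrier ?S" .
  qed
  moreover have "weber_pullback 4 \<in> ring_hom ?R ?S"
  proof (rule ring_hom_memI)
    show "weber_pullback 4 a \<in> carrier ?S" if "a \<in> carrier ?R" for a
      using that unfolding carrier_function_field S by (auto simp: weber_pullback_fclass weber_fraction_modular)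
    fix a b assume "a \<in> carrier ?R" "b \<in> carrier ?R"
    then obtain F G F' G' where ab: "a = fclass (F, G)" "b = fclass (F', G')"
      and FG: "(F, G) \<in> fractions W4" "(F', G') \<in> fractions W4"
      by (auto simp: carrier_function_field)
    show "weber_pullback 4 (a \<otimes>\<^bsub>?R\<^esub> b) = weber_pullback 4 a \<otimes>\<^bsub>?S\<^esub> weber_pullback 4 b"
      "weber_pullback 4 (a \<oplus>\<^bsub>?R\<^esub> b) = weber_pullback 4 a \<oplus>\<^bsub>?S\<^esub> weber_pullback 4 b"
      unfolding ab fclass_mult[OF FG] S using fractions_mult[OF FG] FG
      by (simp_all add: weber_pullback_fclass)
  next
    have one: "(\<lambda>_. 1, \<lambda>_. 1) \<in> fractions W4"
      unfolding fractions_weber_curve using forms_const[of 1] by (intro exI[of _ 0]) (auto intro: exI[of _ \<i>])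
    have "\<one>\<^bsub>?R\<^esub> = fclass (\<lambda>_. 1, \<lambda>_. 1)" by (simp add: function_field_def)
    thus "weber_pullback 4 \<one>\<^bsub>?R\<^esub> = \<one>\<^bsub>?S\<^esub>"
      using weber_pullback_fclass[OF one] by (simp add: S weber_fraction_def)
  qed
  ultimately show ?thesis by (simp add: ring_iso_def)
qed

theorem proposition9:
  shows "weber_kernel_group 4 = Gamma_s 8 \<and>
    weber_pullback 4 \<in> ring_iso (function_field (weber_curve 4)) (split_cartan_curve_field 8)"
  using weber_kernel_group_4 weber_pullback_ring_iso by blast

end
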